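(* Fix $p\ge3$ and let $(\beta,h)\in\Theta$ be $p$-regular, with $h$ known and $\bm X\sim\mathbb P_{\beta,h,p}$. Let $m_*$ be the unique global maximizer of $H=H_{\beta,h,p}$. Then as $N\to\infty$: (a) If $m_*\ne0$, then $N^{1/2}(\hat\beta_N-\beta)\to N\big(0,-\frac{H''(m_* )}{p^2m_*^{2p-2}}\big)$ in distribution. (b) If $m_*=0$ (equivalently $h=0$ and $\beta<\tilde\beta_p$), then $\hat\beta_N\to\frac12\delta_{\tilde\beta_p}+\frac12\delta_{-\tilde\beta_p}$ in distribution if $p$ is odd, and $\hat\beta_N\to\gamma_p\delta_{-\infty}+(1-\gamma_p)\delta_{\tilde\beta_p}$ in distribution if $p$ is even, where $\gamma_p=\mathbb P(Z^p\le\mathbb EZ^p)$ with $Z\sim N(0,1)$.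
   Context: The $p$-tensor Curie–Weiss model on $\{-1,1\}^N$: $\mathbb P_{\beta,h,p}(\bm X)=\frac{1}{2^NZ_N(\beta,h,p)}\exp\{N(\beta\bar X_N^p+h\bar X_N)\}$ with $\bar X_N=N^{-1}\sum_iX_i$, $(\beta,h)\in\mathbb R^2$; $\Theta=[0,\infty)\times\mathbb R$. $I(x)=\frac12[(1+x)\log(1+x)+(1-x)\log(1-x)]$, $H_{\beta,h,p}(x)=\beta x^p+hx-I(x)$ on $[-1,1]$. $(\beta,h)$ is $p$-regular if $H_{\beta,h,p}$ has a unique global maximizer $m_*\in(-1,1)$ with $H''(m_* )<0$. $\tilde\beta_p=\sup\{\beta\ge0:\sup_{x\in[-1,1]}H_{\beta,0,p}(x)=0\}$. For known $h$, $\hat\beta_N\in[-\infty,\infty]$ is the maximum likelihood estimate of $\beta$ over $\beta\in\mathbb R$, i.e. the solution in $\beta$ of $\mathbb E_{\beta,h,p}(\bar X_N^p)=\bar X_N^p$. Convergence to laws with atoms at $\pm\infty$ is weak convergence on the extended line $[-\infty,\infty]$. *)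

theory Defs
  imports "HOL-Probability.Probability"
begin

definition configs :: "nat \<Rightarrow> (nat \<Rightarrow> real) set" where
  "configs N = PiE {..<N} (\<lambda>_. {-1, 1})"

definition xbar :: "nat \<Rightarrow> (nat \<Rightarrow> real) \<Rightarrow> real" where
  "xbar N x = (\<Sum>i<N. x i) / real N"

definition cw_Z :: "nat \<Rightarrow> real \<Rightarrow> real \<Rightarrow> nat \<Rightarrow> real" where
  "cw_Z N b h p = (\<Sum>x\<in>configs N. exp (real N * (b * xbar N x ^ p + h * xbar N x))) / 2 ^ N"

definition cw_prob :: "nat \<Rightarrow> real \<Rightarrow> real \<Rightarrow> nat \<Rightarrow> (nat \<Rightarrow> real) \<Rightarrow> real" where
  "cw_prob N b h p x =
     exp (real N * (b * xbar N x ^ p + h * xbar N x)) / (2 ^ N * cw_Z N b h p)"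

definition cw_measure :: "nat \<Rightarrow> real \<Rightarrow> real \<Rightarrow> nat \<Rightarrow> (nat \<Rightarrow> real) measure" where
  "cw_measure N b h p = density (count_space (configs N)) (\<lambda>x. ennreal (cw_prob N b h p x))"

text \<open>Maximum likelihood estimate of beta (h known), with values in the extended reals:
  the solution b of E_{b,h,p}(xbar^p) = xbar^p; +infinity if xbar^p exceeds E_b for every b,
  -infinity if it is below E_b for every b.\<close>
definition cw_mle :: "nat \<Rightarrow> real \<Rightarrow> nat \<Rightarrow> (nat \<Rightarrow> real) \<Rightarrow> ereal" where
  "cw_mle N h p x =
     (let E = (\<lambda>b. integral\<^sup>L (cw_measure N b h p) (\<lambda>y. xbar N y ^ p));
          t = xbar N x ^ p
      in if \<exists>b. E b = t then ereal (THE b. E b = t)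
         else if \<forall>b. E b < t then \<infinity> else - \<infinity>)"

definition I_fun :: "real \<Rightarrow> real" where
  "I_fun x = ((1 + x) * ln (1 + x) + (1 - x) * ln (1 - x)) / 2"

definition H_fun :: "real \<Rightarrow> real \<Rightarrow> nat \<Rightarrow> real \<Rightarrow> real" where
  "H_fun b h p x = b * x ^ p + h * x - I_fun x"

definition p_regular :: "real \<Rightarrow> real \<Rightarrow> nat \<Rightarrow> bool" where
  "p_regular b h p \<longleftrightarrow>
     (\<exists>m\<in>{-1<..<1}. (\<forall>x\<in>{-1..1}. x \<noteq> m \<longrightarrow> H_fun b h p x < H_fun b h p m)
                    \<and> deriv (deriv (H_fun b h p)) m < 0)"

definition beta_tilde :: "nat \<Rightarrow> real" where
  "beta_tilde p = Sup {b. b \<ge> 0 \<and> (SUP x\<in>{-1..1}. H_fun b 0 p x) = 0}"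

definition weak_conv_ereal :: "(nat \<Rightarrow> ereal measure) \<Rightarrow> ereal measure \<Rightarrow> bool" where
  "weak_conv_ereal Ms M \<longleftrightarrow>
     (\<forall>f :: ereal \<Rightarrow> real. continuous_on UNIV f \<longrightarrow> bounded (range f) \<longrightarrow>
        (\<lambda>n. integral\<^sup>L (Ms n) f) \<longlonglongrightarrow> integral\<^sup>L M f)"

definition gamma_p :: "nat \<Rightarrow> real" where
  "gamma_p p = measure (density lborel std_normal_density)
     {z. z ^ p \<le> integral\<^sup>L (density lborel std_normal_density) (\<lambda>z. z ^ p)}"

end

theory Submission
  imports Defs
begin

text \<open>Let \<open>Q\<close> make the spins independent with mean \<open>m\<close>. Since \<open>H\<close> is stationary at \<open>m\<close>, the
  Gibbs measure has a density with respect to \<open>Q\<close> proportional to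
  \<open>exp (N * b * (t ^ p - m ^ p - p * m ^ (p - 1) * (t - m)))\<close> with \<open>t = xbar\<close>. Under \<open>Q\<close> the variable
  \<open>Y = sqrt N * (t - m)\<close> satisfies the central limit theorem, and the density converges to a Gaussian
  factor in \<open>Y\<close>. Chernoff bounds on the blocks \<open>j \<le> \<bar>Y\<bar> < j + 1\<close> combined with
  \<open>H x \<le> H m - k * (x - m)\<^sup>2\<close> give tails that are summable uniformly in \<open>N\<close>. Hence Gibbs
  expectations of functions of \<open>Y\<close> of exponential growth converge to Gaussian expectations, without
  Stirling's formula.

  As the mean of \<open>xbar ^ p\<close> is strictly increasing in \<open>b\<close>, the estimate is at most \<open>s\<close> iff
  \<open>xbar ^ p\<close> is at most its mean at \<open>s\<close>. For \<open>m \<noteq> 0\<close> and \<open>s = b + u / sqrt N\<close> this mean is a ratio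
  of exponential moments of \<open>Y\<close> under the parameter \<open>b\<close>. For \<open>m = 0\<close> the mean, multiplied by
  \<open>N powr (p / 2)\<close>, tends to the \<open>p\<close>-th Gaussian moment when \<open>s\<close> is subcritical, while it stays
  away from \<open>0\<close> when \<open>s\<close> is supercritical.\<close>

section \<open>Averages over spin configurations\<close>

text \<open>The independent law of mean \<open>m\<close> is the one with external field
  \<open>artanh m\<close>. Stationarity says that this field is \<open>h\<close> plus the slope of
  \<open>b * t ^ p\<close> at \<open>m\<close>, so the density against \<open>Q\<close> has no
  linear term and tends to \<open>exp (b * S 0 * Y^2)\<close>, with \<open>S 0\<close> half the
  second derivative of \<open>t ^ p\<close> at \<open>m\<close>. This factor may be unbounded, so
  the central limit theorem is applied only to truncated integrands; what lies outside the
  truncation is controlled by the global maximality of \<open>m\<close>. The Chernoff exponent is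
  exact because \<open>I_fun\<close> is the Legendre transform of \<open>ln cosh\<close>. The
  parameter \<open>b + s / sqrt N\<close> moves with \<open>N\<close>. A supercritical
  \<open>s\<close> may have several maximizers, so there only a variational lower bound for the mean
  is used. For \<open>m = 0\<close> the limiting cdf is constant between the critical values, which
  produces the atoms; for even \<open>p\<close> no negative \<open>s\<close> is supercritical, so
  mass escapes to \<open>- \<infinity>\<close>.\<close>

lemma finite_configs [simp]: "finite (configs N)"
  unfolding configs_def by (intro finite_PiE) auto

lemma configs_nonempty [simp]: "configs N \<noteq> {}"
  unfolding configs_def by (simp add: PiE_eq_empty_iff)

lemma configs_cases: "x \<in> configs N \<Longrightarrow> i < N \<Longrightarrow> x i = -1 \<or> x i = 1"
  unfolding configs_def by (auto simp: PiE_def Pi_def)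

lemma real_mult_xbar: "real N * xbar N x = (\<Sum>i<N. x i)"
  by (simp add: xbar_def)

lemma abs_xbar_le_1:
  assumes "x \<in> configs N"
  shows "\<bar>xbar N x\<bar> \<le> 1"
proof -
  have "\<bar>\<Sum>i<N. x i\<bar> \<le> (\<Sum>i<N. \<bar>x i\<bar>)"
    by (rule sum_abs)
  also have "\<dots> \<le> (\<Sum>i<N. 1)"
    using configs_cases[OF assms] by (intro sum_mono) force
  finally show ?thesis
    by (cases "N = 0") (auto simp: xbar_def abs_divide)
qed

text \<open>Distributivity over the sites, the form in which independence of the spins enters. A
  general semiring serves both real weights (moment generating function) and complex ones
  (characteristic function).\<close>

lemma sum_configs_prod:
  fixes f :: "real \<Rightarrow> 'a :: comm_semiring_1"
  shows "(\<Sum>x\<in>configs N. \<Prod>i<N. f (x i)) = (f (-1) + f 1) ^ N"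
proof -
  have "(\<Prod>i<N. \<Sum>s\<in>{-1, 1::real}. f s) = (\<Sum>x\<in>configs N. \<Prod>i<N. f (x i))"
    unfolding configs_def by (rule prod_sum_PiE) auto
  then show ?thesis
    by simp
qed

text \<open>Gibbs expectations of functions of \<open>xbar\<close> become quotients of these uniform
  averages, so the estimates concern finite sums and the Gibbs measure appears only at the
  interface.\<close>

definition cfg_avg :: "nat \<Rightarrow> (real \<Rightarrow> real) \<Rightarrow> real" where
  "cfg_avg N g = (\<Sum>x\<in>configs N. g (xbar N x)) / 2 ^ N"

lemma cfg_avg_cmult: "cfg_avg N (\<lambda>t. c * g t) = c * cfg_avg N g"
  by (simp add: cfg_avg_def sum_distrib_left)

lemma cfg_avg_diff: "cfg_avg N (\<lambda>t. f t - g t) = cfg_avg N f - cfg_avg N g"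
  by (simp add: cfg_avg_def sum_subtractf diff_divide_distrib)

lemma cfg_avg_sum: "cfg_avg N (\<lambda>t. \<Sum>j\<in>J. f j t) = (\<Sum>j\<in>J. cfg_avg N (f j))"
  unfolding cfg_avg_def by (subst sum.swap) (simp add: sum_divide_distrib)

lemma cfg_avg_mono:
  assumes "\<And>t. \<bar>t\<bar> \<le> 1 \<Longrightarrow> f t \<le> g t"
  shows "cfg_avg N f \<le> cfg_avg N g"
  unfolding cfg_avg_def using assms abs_xbar_le_1
  by (intro divide_right_mono sum_mono) auto

lemma cfg_avg_abs: "\<bar>cfg_avg N f\<bar> \<le> cfg_avg N (\<lambda>t. \<bar>f t\<bar>)"
  unfolding cfg_avg_def abs_divide using sum_abs[of "\<lambda>x. f (xbar N x)" "configs N"]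
  by (simp add: divide_right_mono)

lemma cfg_avg_pos: "(\<And>t. 0 < f t) \<Longrightarrow> 0 < cfg_avg N f"
  unfolding cfg_avg_def by (intro divide_pos_pos sum_pos) auto

text \<open>At \<open>b = 0\<close> the sites decouple; this is the partition function of
  independent spins in the field \<open>a\<close>.\<close>

lemma cfg_avg_exp: "cfg_avg N (\<lambda>t. exp (real N * (a * t))) = cosh a ^ N"
proof -
  have "exp (real N * (a * xbar N x)) = (\<Prod>i<N. exp (a * x i))" for x
    using real_mult_xbar[of N x]
    by (simp add: exp_sum[symmetric] sum_distrib_left[symmetric] mult.left_commute)
  then show ?thesis
    by (simp add: cfg_avg_def sum_configs_prod[where f = "\<lambda>s. exp (a * s)"] cosh_def
        power_divide add.commute)
qed

section \<open>Gibbs weights and the Gibbs measure as finite sums\<close>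

definition gibbs :: "nat \<Rightarrow> real \<Rightarrow> real \<Rightarrow> nat \<Rightarrow> real \<Rightarrow> real" where
  "gibbs N b h p t = exp (real N * (b * t ^ p + h * t))"

lemma gibbs_pos [simp]: "0 < gibbs N b h p t"
  by (simp add: gibbs_def)

lemma cw_Z_eq_cfg_avg: "cw_Z N b h p = cfg_avg N (gibbs N b h p)"
  by (simp add: cw_Z_def cfg_avg_def gibbs_def)

lemma cw_Z_pos [simp]: "0 < cw_Z N b h p"
  unfolding cw_Z_eq_cfg_avg by (intro cfg_avg_pos) simp

lemma cw_prob_eq: "cw_prob N b h p x = gibbs N b h p (xbar N x) / 2 ^ N / cw_Z N b h p"
  by (simp add: cw_prob_def gibbs_def)

lemma space_cw_measure [simp]: "space (cw_measure N b h p) = configs N"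
  and sets_cw_measure [simp]: "sets (cw_measure N b h p) = Pow (configs N)"
  by (simp_all add: cw_measure_def)

lemma measurable_cw_measure [measurable]: "f \<in> borel_measurable (cw_measure N b h p)"
  by (auto simp: measurable_def)

lemma cw_prob_nonneg: "0 \<le> cw_prob N b h p x"
  unfolding cw_prob_eq by (intro divide_nonneg_pos) (auto intro: less_imp_le)

lemma integral_cw_measure:
  fixes f :: "(nat \<Rightarrow> real) \<Rightarrow> 'a :: {banach, second_countable_topology}"
  shows "integral\<^sup>L (cw_measure N b h p) f = (\<Sum>x\<in>configs N. cw_prob N b h p x *\<^sub>R f x)"
  unfolding cw_measure_def
  by (subst integral_density)
    (auto simp: cw_prob_nonneg lebesgue_integral_count_space_finite)

lemma integrable_cw_measure:
  fixes f :: "(nat \<Rightarrow> real) \<Rightarrow> real"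
  shows "integrable (cw_measure N b h p) f"
  unfolding cw_measure_def
  by (subst integrable_density) (auto simp: cw_prob_nonneg integrable_count_space)

lemma integral_cw_measure_xbar:
  "integral\<^sup>L (cw_measure N b h p) (\<lambda>x. F (xbar N x)) =
     cfg_avg N (\<lambda>t. gibbs N b h p t * F t) / cfg_avg N (gibbs N b h p)"
proof -
  have "cw_prob N b h p x * F (xbar N x) =
      gibbs N b h p (xbar N x) * F (xbar N x) / 2 ^ N / cw_Z N b h p" for x
    by (simp add: cw_prob_eq)
  then show ?thesis
    by (simp add: integral_cw_measure cfg_avg_def sum_divide_distrib cw_Z_eq_cfg_avg)
qed

lemma prob_space_cw_measure: "prob_space (cw_measure N b h p)"
proof (rule prob_spaceI)
  have "(\<Sum>x\<in>configs N. cw_prob N b h p x) = 1"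
    using integral_cw_measure_xbar[of N b h p "\<lambda>_. 1"] cw_Z_pos[of N b h p]
    unfolding integral_cw_measure by (simp add: cw_Z_eq_cfg_avg)
  then show "emeasure (cw_measure N b h p) (space (cw_measure N b h p)) = 1"
    by (simp add: cw_measure_def emeasure_density nn_integral_count_space_finite
        cw_prob_nonneg sum_ennreal)
qed

lemma measure_cw_measure:
  "measure (cw_measure N b h p) {x \<in> configs N. P x} =
     integral\<^sup>L (cw_measure N b h p) (indicator {x. P x})"
proof -
  have "{x. P x} \<inter> configs N = {x \<in> configs N. P x}"
    by blast
  then show ?thesis
    by simp
qed

section \<open>The rate function\<close>

text \<open>A spin \<open>s\<close> with weight proportional to \<open>exp (artanh x * s)\<close>
  has mean \<open>x\<close>; this evaluates its normaliser and later turns the weight into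
  \<open>(1 + x * s) / 2\<close>.\<close>

lemma cosh_artanh:
  fixes x :: real
  assumes "\<bar>x\<bar> < 1"
  shows "cosh (artanh x) = exp (artanh x) / (1 + x)"
proof -
  have pos: "0 < 1 + x" "0 < 1 - x" using assms by auto
  have "exp (2 * artanh x) = (1 + x) / (1 - x)"
    using pos by (simp add: artanh_def)
  then have e: "exp (artanh x) ^ 2 = (1 + x) / (1 - x)"
    by (simp add: exp_double[symmetric])
  have "cosh (artanh x) = exp (artanh x) * (1 + inverse (exp (artanh x) ^ 2)) / 2"
    by (simp add: cosh_def exp_minus field_simps power2_eq_square)
  also have "\<dots> = exp (artanh x) / (1 + x)"
    unfolding e using pos by (simp add: field_simps)
  finally show ?thesis .
qed

text \<open>The Legendre transform of \<open>ln cosh\<close>, written at its maximising field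
  \<open>artanh x\<close>. It links the entropy in \<open>H_fun\<close> to the moment generating
  function \<open>cosh a ^ N\<close>.\<close>

lemma I_fun_eq_artanh:
  assumes "\<bar>x\<bar> < 1"
  shows "I_fun x = artanh x * x - ln (cosh (artanh x))"
proof -
  have pos: "0 < 1 + x" "0 < 1 - x" using assms by auto
  have a: "artanh x = ln (1 + x) / 2 - ln (1 - x) / 2"
    using pos by (simp add: artanh_def ln_div diff_divide_distrib)
  have "ln (cosh (artanh x)) = artanh x - ln (1 + x)"
    using pos by (simp add: cosh_artanh[OF assms] ln_div)
  then show ?thesis
    unfolding I_fun_def a using pos by (simp add: field_simps)
qed

lemma I_fun_minus: "I_fun (- x) = I_fun x"
  by (simp add: I_fun_def)

lemma I_fun_0 [simp]: "I_fun 0 = 0"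
  by (simp add: I_fun_def)

text \<open>Only \<open>0\<close> is at issue: there \<open>ln v <= v\<close> at
  \<open>v = 1 / sqrt u\<close> bounds \<open>\<bar>u * ln u\<bar>\<close> by
  \<open>2 * sqrt u\<close>. It yields continuity of \<open>I_fun\<close> up to the endpoints, where
  the derivative diverges.\<close>

lemma continuous_on_xlnx: "continuous_on {0..} (\<lambda>t::real. t * ln t)"
  unfolding continuous_on_eq_continuous_within
proof
  fix t :: real
  assume t: "t \<in> {0..}"
  show "continuous (at t within {0..}) (\<lambda>t. t * ln t)"
  proof (cases "t = 0")
    case True
    have bound: "\<bar>u * ln u\<bar> \<le> 2 * sqrt u" if "0 < u" "u < 1" for u :: real
    proof -
      have "- ln u = 2 * ln (1 / sqrt u)"
        using that by (simp add: ln_div ln_sqrt)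
      also have "\<dots> \<le> 2 * (1 / sqrt u)"
        using that by (intro mult_left_mono ln_bound) auto
      finally have "u * (- ln u) \<le> u * (2 * (1 / sqrt u))"
        using that by (intro mult_left_mono) auto
      also have "\<dots> = 2 * sqrt u"
        using that real_div_sqrt[of u] by (simp add: mult.commute[of u 2])
      finally show ?thesis
        using that mult_pos_neg[of u "ln u"] by (simp add: abs_if)
    qed
    have "((\<lambda>u. u * ln u) \<longlongrightarrow> (0::real)) (at 0 within {0..})"
    proof (rule Lim_null_comparison)
      show "\<forall>\<^sub>F u in at 0 within {0..}. norm (u * ln u) \<le> 2 * sqrt u"
        unfolding eventually_at using bound by (intro exI[of _ 1]) auto
      show "((\<lambda>u. 2 * sqrt u) \<longlongrightarrow> 0) (at 0 within {0..})"
        by (auto intro!: tendsto_eq_intros)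
    qed
    then show ?thesis
      using True by (simp add: continuous_within)
  next
    case False
    then show ?thesis
      using t by (auto intro!: continuous_intros)
  qed
qed

lemma continuous_on_I_fun: "continuous_on {-1..1} I_fun"
proof -
  have "continuous_on {-1..1} (\<lambda>x::real. (1 + x) * ln (1 + x))"
    by (rule continuous_on_compose2[OF continuous_on_xlnx]) (auto intro!: continuous_intros)
  moreover have "continuous_on {-1..1} (\<lambda>x::real. (1 - x) * ln (1 - x))"
    by (rule continuous_on_compose2[OF continuous_on_xlnx]) (auto intro!: continuous_intros)
  ultimately show ?thesis
    unfolding I_fun_def[abs_def] by (intro continuous_on_divide continuous_on_add) auto
qed

lemma continuous_on_H_fun: "continuous_on {-1..1} (H_fun b h p)"
  unfolding H_fun_def[abs_def] by (intro continuous_intros continuous_on_I_fun)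

lemma I_fun_has_real_derivative:
  assumes "\<bar>x\<bar> < 1"
  shows "(I_fun has_real_derivative artanh x) (at x)"
proof -
  have pos: "0 < 1 + x" "0 < 1 - x" using assms by auto
  have 1: "((\<lambda>x. (1 + x) * ln (1 + x)) has_real_derivative ln (1 + x) + 1) (at x)"
    using pos by (auto intro!: derivative_eq_intros)
  have 2: "((\<lambda>x. (1 - x) * ln (1 - x)) has_real_derivative - ln (1 - x) - 1) (at x)"
    using pos by (auto intro!: derivative_eq_intros)
  have "(I_fun has_real_derivative ((ln (1 + x) + 1) + (- ln (1 - x) - 1)) / 2) (at x)"
    unfolding I_fun_def[abs_def] by (intro DERIV_cdivide DERIV_add 1 2)
  then show ?thesis
    using pos by (simp add: artanh_def ln_div)
qed

definition dH :: "real \<Rightarrow> real \<Rightarrow> nat \<Rightarrow> real \<Rightarrow> real" where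
  "dH b h p x = b * (real p * x ^ (p - 1)) + h - artanh x"

definition ddH :: "real \<Rightarrow> nat \<Rightarrow> real \<Rightarrow> real" where
  "ddH b p x = b * (real p * (real (p - 1) * x ^ (p - 2))) - 1 / (1 - x\<^sup>2)"

lemma H_fun_has_real_derivative:
  assumes "\<bar>x\<bar> < 1"
  shows "(H_fun b h p has_real_derivative dH b h p x) (at x)"
  unfolding H_fun_def[abs_def] dH_def using I_fun_has_real_derivative[OF assms]
  by (auto intro!: derivative_eq_intros)

lemma dH_has_real_derivative:
  assumes "\<bar>x\<bar> < 1"
  shows "(dH b h p has_real_derivative ddH b p x) (at x)"
  unfolding dH_def[abs_def] ddH_def using assms
  by (auto intro!: derivative_eq_intros simp: numeral_2_eq_2)

lemma deriv_deriv_H_fun: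
  assumes "\<bar>x\<bar> < 1"
  shows "deriv (deriv (H_fun b h p)) x = ddH b p x"
proof -
  have "deriv (H_fun b h p) y = dH b h p y" if "\<bar>y\<bar> < 1" for y
    using H_fun_has_real_derivative[OF that] by (rule DERIV_imp_deriv)
  then have "\<forall>\<^sub>F y in nhds x. deriv (H_fun b h p) y = dH b h p y"
    using assms by (intro eventually_mono[OF eventually_nhds_in_open[of "{-1<..<1}" x]]) auto
  then have "deriv (deriv (H_fun b h p)) x = deriv (dH b h p) x"
    by (rule deriv_cong_ev) simp
  also have "\<dots> = ddH b p x"
    using dH_has_real_derivative[OF assms] by (rule DERIV_imp_deriv)
  finally show ?thesis .
qed

lemma stationary_at_max:
  assumes m: "\<bar>m\<bar> < 1" and max: "\<And>x. \<bar>x\<bar> \<le> 1 \<Longrightarrow> x \<noteq> m \<Longrightarrow> H_fun b h p x < H_fun b h p m"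
  shows "dH b h p m = 0"
proof (rule DERIV_local_max[OF H_fun_has_real_derivative[OF m]])
  show "0 < 1 - \<bar>m\<bar>" using m by simp
  show "\<forall>y. \<bar>m - y\<bar> < 1 - \<bar>m\<bar> \<longrightarrow> H_fun b h p y \<le> H_fun b h p m"
  proof safe
    fix y assume "\<bar>m - y\<bar> < 1 - \<bar>m\<bar>"
    then have "\<bar>y\<bar> \<le> 1" by linarith
    then show "H_fun b h p y \<le> H_fun b h p m"
      using max[of y] by (cases "y = m") auto
  qed
qed

text \<open>Near \<open>m\<close> the difference quotient of \<open>dH\<close> at \<open>m\<close>
  is below \<open>- c\<close>, so adding \<open>c / 2 * (x - m)\<^sup>2\<close> keeps
  \<open>m\<close> a local maximum; this uses the second derivative at \<open>m\<close> alone. Away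
  from \<open>m\<close> compactness gives a fixed gap.\<close>

lemma quadratic_decay:
  assumes m: "\<bar>m\<bar> < 1" and max: "\<And>x. \<bar>x\<bar> \<le> 1 \<Longrightarrow> x \<noteq> m \<Longrightarrow> H_fun b h p x < H_fun b h p m"
    and neg: "ddH b p m < 0"
  shows "\<exists>\<kappa>>0. \<forall>x. \<bar>x\<bar> \<le> 1 \<longrightarrow> H_fun b h p x \<le> H_fun b h p m - \<kappa> * (x - m)\<^sup>2"
proof -
  \<comment> \<open>Half of \<open>- H'' m\<close>, which leaves room for a strict inequality on a
    neighbourhood.\<close>
  define c where "c = - ddH b p m / 2"
  have c: "c > 0" using neg by (simp add: c_def)
  have st: "dH b h p m = 0" by (rule stationary_at_max[OF m max])
  have "(\<lambda>x. (dH b h p x - dH b h p m) / (x - m)) \<midarrow>m\<rightarrow> ddH b p m"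
    using dH_has_real_derivative[OF m] by (simp add: has_field_derivative_iff)
  then have "\<forall>\<^sub>F x in at m. (dH b h p x - dH b h p m) / (x - m) < - c"
    by (rule order_tendstoD) (use neg in \<open>simp add: c_def\<close>)
  then obtain d0 where d0: "d0 > 0"
    "\<And>x. x \<noteq> m \<Longrightarrow> \<bar>x - m\<bar> < d0 \<Longrightarrow> dH b h p x / (x - m) < - c"
    unfolding eventually_at using st by (auto simp: dist_real_def)
  define d where "d = min d0 (1 - \<bar>m\<bar>)"
  have d: "d > 0" using d0 m by (simp add: d_def)
  define k where "k x = H_fun b h p x + c / 2 * (x - m)\<^sup>2" for x
  have dk: "(k has_real_derivative dH b h p x + c * (x - m)) (at x)" if "\<bar>x - m\<bar> < d" for x
  proof -
    have "\<bar>x\<bar> < 1" using that by (auto simp: d_def)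
    then show ?thesis
      unfolding k_def by (auto intro!: derivative_eq_intros H_fun_has_real_derivative)
  qed
  have near: "k x \<le> k m" if x: "\<bar>x - m\<bar> < d" for x
  proof (cases x m rule: linorder_cases)
    case less
    show ?thesis
    proof (rule DERIV_nonneg_imp_nondecreasing[where f = k])
      fix y assume y: "x \<le> y" "y \<le> m"
      have "0 \<le> dH b h p y + c * (y - m)"
      proof (cases "y = m")
        case False
        then have "dH b h p y / (y - m) < - c"
          using x y less by (intro d0) (auto simp: d_def)
        then show ?thesis
          using False y by (simp add: field_simps)
      qed (simp add: st)
      then show "\<exists>z. (k has_real_derivative z) (at y) \<and> 0 \<le> z"
        using dk[of y] x y less by (intro exI conjI) auto
    qed (use less in simp)
  next
    case equal
    then show ?thesis by simp
  next
    case greater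
    show ?thesis
    proof (rule DERIV_nonpos_imp_nonincreasing[where f = k])
      fix y assume y: "m \<le> y" "y \<le> x"
      have "dH b h p y + c * (y - m) \<le> 0"
      proof (cases "y = m")
        case False
        then have "dH b h p y / (y - m) < - c"
          using x y greater by (intro d0) (auto simp: d_def)
        then show ?thesis
          using False y by (simp add: field_simps)
      qed (simp add: st)
      then show "\<exists>z. (k has_real_derivative z) (at y) \<and> z \<le> 0"
        using dk[of y] x y greater by (intro exI conjI) auto
    qed (use greater in simp)
  qed
  define K where "K = {-1..1} - {m - d<..<m + d}"
  have K: "compact K"
    unfolding K_def by (intro compact_diff) auto
  obtain e where e: "e > 0" "\<And>x. x \<in> K \<Longrightarrow> H_fun b h p x \<le> H_fun b h p m - e"
  proof (cases "K = {}")
    case True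
    then show ?thesis using that[of 1] by auto
  next
    case False
    have "continuous_on K (H_fun b h p)"
      by (rule continuous_on_subset[OF continuous_on_H_fun]) (auto simp: K_def)
    from continuous_attains_sup[OF K False this] obtain z where
      z: "z \<in> K" "\<And>x. x \<in> K \<Longrightarrow> H_fun b h p x \<le> H_fun b h p z"
      by blast
    have "H_fun b h p z < H_fun b h p m"
      using z(1) d by (intro max) (auto simp: K_def)
    then show ?thesis
      using z(2) by (intro that[of "H_fun b h p m - H_fun b h p z"]) auto
  qed
  show ?thesis
  \<comment> \<open>The value \<open>e / 4\<close> works because
    \<open>\<bar>x - m\<bar> <= 2\<close> makes the quadratic term at most \<open>e\<close>.\<close>
  proof (intro exI[of _ "min (c / 2) (e / 4)"] conjI allI impI)
    show "0 < min (c / 2) (e / 4)" using c e by simp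
    fix x :: real assume x: "\<bar>x\<bar> \<le> 1"
    show "H_fun b h p x \<le> H_fun b h p m - min (c / 2) (e / 4) * (x - m)\<^sup>2"
    proof (cases "\<bar>x - m\<bar> < d")
      case True
      have "min (c / 2) (e / 4) * (x - m)\<^sup>2 \<le> c / 2 * (x - m)\<^sup>2"
        by (intro mult_right_mono) auto
      then show ?thesis
        using near[OF True] by (simp add: k_def)
    next
      case False
      then have "x \<in> K" using x by (auto simp: K_def)
      have "\<bar>x - m\<bar> \<le> 2" using x m by auto
      then have "(x - m)\<^sup>2 \<le> 2\<^sup>2" by (rule power2_le_iff_abs_le[THEN iffD2, rotated]) simp
      then have "min (c / 2) (e / 4) * (x - m)\<^sup>2 \<le> e / 4 * 2\<^sup>2"
        using c e by (intro mult_mono) auto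
      then show ?thesis
        using e(2)[OF \<open>x \<in> K\<close>] by simp
    qed
  qed
qed

section \<open>Exponential tails\<close>

lemma artanh_less_iff_real:
  fixes x y :: real
  assumes "\<bar>x\<bar> < 1" "\<bar>y\<bar> < 1"
  shows "artanh x < artanh y \<longleftrightarrow> x < y"
proof -
  have pos: "0 < 1 + x" "0 < 1 - x" "0 < 1 + y" "0 < 1 - y" using assms by auto
  have "artanh x < artanh y \<longleftrightarrow> (1 + x) / (1 - x) < (1 + y) / (1 - y)"
    using pos by (simp add: artanh_def)
  also have "\<dots> \<longleftrightarrow> x < y"
    using pos by (simp add: divide_simps) (simp add: algebra_simps)
  finally show ?thesis .
qed

text \<open>The indicator selects the \<open>t\<close> beyond \<open>x\<close> as seen from
  \<open>m\<close>. There a further tilt by \<open>artanh x - artanh m\<close> only increases the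
  integrand, as \<open>artanh\<close> is increasing, and the tilted average is
  \<open>cosh (artanh x) ^ N\<close>; \<open>I_fun_eq_artanh\<close> then gives the
  exponent.\<close>

lemma chernoff_interior:
  assumes m: "\<bar>m\<bar> < 1" and x: "\<bar>x\<bar> < 1"
  shows "cfg_avg N (\<lambda>t. indicator {t. 0 \<le> (t - x) * (x - m)} t * exp (real N * (artanh m * t)))
    \<le> exp (real N * (artanh m * x - I_fun x))"
proof -
  define a c where "a = artanh x" and "c = artanh m"
  have sgn: "0 \<le> (a - c) * (t - x)" if "0 \<le> (t - x) * (x - m)" for t
    using that artanh_less_iff_real[OF m x] artanh_less_iff_real[OF x m]
    by (cases x m rule: linorder_cases) (auto simp: a_def c_def zero_le_mult_iff)
  have "cfg_avg N (\<lambda>t. indicator {t. 0 \<le> (t - x) * (x - m)} t * exp (real N * (c * t)))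
      \<le> cfg_avg N (\<lambda>t. exp (- real N * ((a - c) * x)) * exp (real N * (a * t)))"
  proof (rule cfg_avg_mono)
    fix t
    show "indicator {t. 0 \<le> (t - x) * (x - m)} t * exp (real N * (c * t))
        \<le> exp (- real N * ((a - c) * x)) * exp (real N * (a * t))"
    proof (cases "0 \<le> (t - x) * (x - m)")
      case True
      have "exp (real N * (c * t)) \<le> exp (real N * (c * t) + real N * ((a - c) * (t - x)))"
        using sgn[OF True] by simp
      also have "\<dots> = exp (- real N * ((a - c) * x)) * exp (real N * (a * t))"
        by (simp add: exp_add[symmetric] algebra_simps)
      finally show ?thesis using True by simp
    qed simp
  qed
  also have "\<dots> = exp (- real N * ((a - c) * x)) * exp (ln (cosh a)) ^ N"
    by (subst cfg_avg_cmult) (simp add: cfg_avg_exp)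
  also have "\<dots> = exp (real N * (c * x - (a * x - ln (cosh a))))"
    by (simp only: exp_of_nat_mult[symmetric] exp_add[symmetric]) (simp add: algebra_simps)
  finally show ?thesis
    by (simp add: a_def c_def I_fun_eq_artanh[OF x])
qed

text \<open>At \<open>x = 1\<close> and \<open>x = -1\<close> no tilt exists. The event for
  \<open>x\<close> is contained in the one for \<open>r * x\<close> when
  \<open>\<bar>m\<bar> < r < 1\<close>, so the bound follows as \<open>r\<close> tends to
  \<open>1\<close>, by continuity of \<open>I_fun\<close>.\<close>

lemma chernoff:
  assumes m: "\<bar>m\<bar> < 1" and x: "\<bar>x\<bar> \<le> 1"
  shows "cfg_avg N (\<lambda>t. indicator {t. 0 \<le> (t - x) * (x - m)} t * exp (real N * (artanh m * t)))
    \<le> exp (real N * (artanh m * x - I_fun x))"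
proof (cases "\<bar>x\<bar> < 1")
  case True
  then show ?thesis by (rule chernoff_interior[OF m])
next
  case False
  then have x1: "x = 1 \<or> x = -1" using x by auto
  have "continuous_on {0..1} (\<lambda>r. exp (real N * (artanh m * (r * x) - I_fun (r * x))))"
    by (intro continuous_intros continuous_on_compose2[OF continuous_on_I_fun])
      (use x1 in auto)
  then have "((\<lambda>r. exp (real N * (artanh m * (r * x) - I_fun (r * x)))) \<longlongrightarrow>
      exp (real N * (artanh m * (1 * x) - I_fun (1 * x)))) (at 1 within {0..1})"
    unfolding continuous_on_def by (rule bspec) simp
  then have lim: "((\<lambda>r. exp (real N * (artanh m * (r * x) - I_fun (r * x)))) \<longlongrightarrow>
      exp (real N * (artanh m * (1 * x) - I_fun (1 * x)))) (at_left 1)"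
    by (simp only: at_within_Icc_at_left[OF zero_less_one])
  have ev: "\<forall>\<^sub>F r in at_left 1.
      cfg_avg N (\<lambda>t. indicator {t. 0 \<le> (t - x) * (x - m)} t * exp (real N * (artanh m * t)))
      \<le> exp (real N * (artanh m * (r * x) - I_fun (r * x)))"
    unfolding eventually_at_left_field
  proof (intro exI[of _ "\<bar>m\<bar>"] conjI allI impI m)
    fix r :: real assume r: "\<bar>m\<bar> < r" "r < 1"
    have "cfg_avg N (\<lambda>t. indicator {t. 0 \<le> (t - x) * (x - m)} t * exp (real N * (artanh m * t)))
      \<le> cfg_avg N (\<lambda>t. indicator {t. 0 \<le> (t - r * x) * (r * x - m)} t * exp (real N * (artanh m * t)))"
    proof (rule cfg_avg_mono)
      fix t :: real assume t: "\<bar>t\<bar> \<le> 1"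
      have "0 \<le> (t - r * x) * (r * x - m)" if "0 \<le> (t - x) * (x - m)"
        using x1 that r t m by (auto simp: zero_le_mult_iff)
      then show "indicator {t. 0 \<le> (t - x) * (x - m)} t * exp (real N * (artanh m * t))
        \<le> indicator {t. 0 \<le> (t - r * x) * (r * x - m)} t * exp (real N * (artanh m * t))"
        by (auto simp: indicator_def)
    qed
    also have "\<dots> \<le> exp (real N * (artanh m * (r * x) - I_fun (r * x)))"
      using x1 r by (intro chernoff_interior[OF m]) auto
    finally show "cfg_avg N (\<lambda>t. indicator {t. 0 \<le> (t - x) * (x - m)} t * exp (real N * (artanh m * t)))
      \<le> exp (real N * (artanh m * (r * x) - I_fun (r * x)))" .
  qed
  show ?thesis
    using tendsto_lowerbound[OF lim ev] by simp
qed

text \<open>The remainder of linearising \<open>z ^ p\<close> at \<open>m\<close> has Lipschitz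
  constant \<open>p^2 * d\<close> within distance \<open>d\<close> of \<open>m\<close>. With
  \<open>d\<close> about \<open>j / sqrt N\<close> and \<open>t - x\<close> about
  \<open>1 / sqrt N\<close>, multiplication by \<open>N\<close> leaves an error linear in
  \<open>j\<close>, which Gaussian decay in \<open>j\<close> absorbs.\<close>

lemma power_tangent_diff:
  fixes m t x d :: real
  assumes m: "\<bar>m\<bar> \<le> 1" and t: "\<bar>t\<bar> \<le> 1" "\<bar>t - m\<bar> \<le> d" and x: "\<bar>x\<bar> \<le> 1" "\<bar>x - m\<bar> \<le> d"
  shows "\<bar>t ^ p - x ^ p - real p * m ^ (p - 1) * (t - x)\<bar> \<le> (real p)\<^sup>2 * d * \<bar>t - x\<bar>"
proof -
  let ?f = "\<lambda>z. z ^ p - real p * m ^ (p - 1) * z"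
  have "norm (?f t - ?f x) \<le> ((real p)\<^sup>2 * d) * norm (t - x)"
  proof (rule field_differentiable_bound[where S = "cball 0 1 \<inter> cball m d"])
    fix z assume "z \<in> cball 0 1 \<inter> cball m d"
    then have z: "\<bar>z\<bar> \<le> 1" "\<bar>z - m\<bar> \<le> d" by (auto simp: dist_real_def)
    show "(?f has_field_derivative real p * z ^ (p - 1) - real p * m ^ (p - 1))
        (at z within cball 0 1 \<inter> cball m d)"
      by (auto intro!: derivative_eq_intros)
    have "norm (z ^ (p - 1) - m ^ (p - 1)) \<le> real (p - 1) * norm (z - m)"
      by (rule norm_power_diff) (use z m in auto)
    also have "\<dots> \<le> real p * d"
      using z by (intro mult_mono) auto
    finally have "real p * \<bar>z ^ (p - 1) - m ^ (p - 1)\<bar> \<le> real p * (real p * d)"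
      by (intro mult_left_mono) auto
    then show "norm (real p * z ^ (p - 1) - real p * m ^ (p - 1)) \<le> (real p)\<^sup>2 * d"
      by (simp add: right_diff_distrib[symmetric] abs_mult power2_eq_square mult.assoc)
  qed (use t x in \<open>auto simp: dist_real_def intro: convex_Int\<close>)
  then show ?thesis
    by (simp add: algebra_simps)
qed

text \<open>The sign of \<open>b\<close> is left free: in the degenerate regime the locale is also
  interpreted at candidate values of the estimate, which may be negative.\<close>

locale cw_max =
  fixes p :: nat and b h m :: real
  assumes p2: "2 \<le> p" and m1: "\<bar>m\<bar> < 1"
    and max: "\<And>x. \<bar>x\<bar> \<le> 1 \<Longrightarrow> x \<noteq> m \<Longrightarrow> H_fun b h p x < H_fun b h p m"
    and neg: "ddH b p m < 0"
begin

text \<open>Dividing out the exponential order \<open>exp (N * H m)\<close> makes the averages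
  converge to positive constants.\<close>

definition wt :: "nat \<Rightarrow> real \<Rightarrow> real" where
  "wt N t = exp (real N * (b * t ^ p + h * t - H_fun b h p m))"

lemma wt_pos [simp]: "0 < wt N t"
  by (simp add: wt_def)

lemma gibbs_eq_wt: "gibbs N b h p t = exp (real N * H_fun b h p m) * wt N t"
  by (simp add: gibbs_def wt_def exp_add[symmetric] algebra_simps)

lemma stationary: "artanh m = b * (real p * m ^ (p - 1)) + h"
  using stationary_at_max[OF m1 max] by (simp add: dH_def)

text \<open>\<open>s\<close> is the side of \<open>m\<close>, and \<open>x\<close> the endpoint of
  the block nearest to it. On the block \<open>b * t ^ p\<close> is replaced by a line with the
  slope at \<open>m\<close>; stationarity turns this slope into the field \<open>artanh m\<close>,
  so \<open>chernoff\<close> applies and leaves \<open>N * (H x - H m)\<close>, at most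
  \<open>- \<kappa> * j^2\<close>.\<close>

lemma block_bound:
  assumes \<kappa>: "\<And>x. \<bar>x\<bar> \<le> 1 \<Longrightarrow> H_fun b h p x \<le> H_fun b h p m - \<kappa> * (x - m)\<^sup>2"
    and N: "N \<ge> 1" and s: "s \<in> {-1, 1::real}"
  shows "cfg_avg N (\<lambda>t. indicator {t. s * (sqrt N * (t - m)) \<in> {real j..<real j + 1}} t * wt N t)
    \<le> exp (- \<kappa> * (real j)\<^sup>2 + \<bar>b\<bar> * (real p)\<^sup>2 * (real j + 1))"
proof -
  define rt where "rt = sqrt (real N)"
  have rt: "rt > 0" "rt * rt = real N" using N by (auto simp: rt_def)
  define x where "x = m + s * real j / rt"
  define d where "d = (real j + 1) / rt"
  define B where "B = {t. s * (rt * (t - m)) \<in> {real j..<real j + 1}}"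
  have xm: "x - m = s * real j / rt" by (simp add: x_def)
  have ss: "s * s = 1" "\<bar>s\<bar> = 1" using s by auto
  have tx: "s * (t - x) = (s * (rt * (t - m)) - real j) / rt" for t
    using rt ss by (simp add: x_def field_simps)
  have B: "0 \<le> s * (t - x)" "s * (t - x) \<le> 1 / rt" "0 \<le> (t - x) * (x - m)" "\<bar>t - m\<bar> \<le> d"
    if "t \<in> B" for t
  proof -
    show 1: "0 \<le> s * (t - x)" and "s * (t - x) \<le> 1 / rt"
      unfolding tx using that rt by (auto simp: B_def divide_right_mono)
    have "0 \<le> s * (t - x) * (real j / rt)" using 1 rt by simp
    then show "0 \<le> (t - x) * (x - m)" unfolding xm by (simp add: mult_ac)
    have "rt * \<bar>t - m\<bar> = \<bar>s * (rt * (t - m))\<bar>" using rt ss by (simp add: abs_mult)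
    also have "\<dots> \<le> real j + 1" using that by (auto simp: B_def)
    finally show "\<bar>t - m\<bar> \<le> d" using rt by (simp add: d_def field_simps)
  qed
  have "cfg_avg N (\<lambda>t. indicator B t * wt N t)
      \<le> exp (- \<kappa> * (real j)\<^sup>2 + \<bar>b\<bar> * (real p)\<^sup>2 * (real j + 1))"
  proof (cases "\<bar>x\<bar> \<le> 1")
    case False
    \<comment> \<open>If \<open>x\<close> has left \<open>[-1, 1]\<close>, the block lies beyond it
      and contains no possible value of \<open>xbar\<close>.\<close>
    have "cfg_avg N (\<lambda>t. indicator B t * wt N t) \<le> cfg_avg N (\<lambda>t. 0)"
    proof (rule cfg_avg_mono)
      fix t :: real assume t: "\<bar>t\<bar> \<le> 1"
      have "0 \<le> s * (x - m)" unfolding xm using ss rt by (simp add: mult.assoc[symmetric])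
      then have "\<not> 0 \<le> s * (t - x)"
        using False t s m1 by auto
      then have "t \<notin> B"
        using B(1)[of t] by blast
      then show "indicator B t * wt N t \<le> 0" by simp
    qed
    also have "\<dots> = 0" by (simp add: cfg_avg_def)
    finally show ?thesis by (rule order_trans) simp
  next
    case True
    define C where "C = real N * (b * x ^ p + (h - artanh m) * x - H_fun b h p m)
        + \<bar>b\<bar> * (real p)\<^sup>2 * (real j + 1)"
    have "cfg_avg N (\<lambda>t. indicator B t * wt N t) \<le>
      cfg_avg N (\<lambda>t. exp C * (indicator {t. 0 \<le> (t - x) * (x - m)} t * exp (real N * (artanh m * t))))"
    proof (rule cfg_avg_mono)
      fix t :: real assume t: "\<bar>t\<bar> \<le> 1"
      show "indicator B t * wt N t \<le>
        exp C * (indicator {t. 0 \<le> (t - x) * (x - m)} t * exp (real N * (artanh m * t)))"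
      proof (cases "t \<in> B")
        case tB: True
        have "\<bar>x - m\<bar> \<le> d" unfolding xm using rt ss by (simp add: abs_mult d_def divide_right_mono)
        then have "\<bar>t ^ p - x ^ p - real p * m ^ (p - 1) * (t - x)\<bar> \<le> (real p)\<^sup>2 * d * \<bar>t - x\<bar>"
          using power_tangent_diff[of m t d x p] m1 t True B(4)[OF tB] by simp
        also have "\<dots> \<le> (real p)\<^sup>2 * d * (1 / rt)"
        proof (rule mult_left_mono)
          show "\<bar>t - x\<bar> \<le> 1 / rt"
            using B(1,2)[OF tB] s by auto
        qed (use rt in \<open>simp add: d_def\<close>)
        finally have *: "\<bar>b\<bar> * \<bar>t ^ p - x ^ p - real p * m ^ (p - 1) * (t - x)\<bar>
          \<le> \<bar>b\<bar> * ((real p)\<^sup>2 * d * (1 / rt))"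
          by (intro mult_left_mono) auto
        have "b * (t ^ p - x ^ p - real p * m ^ (p - 1) * (t - x)) \<le>
            \<bar>b\<bar> * ((real p)\<^sup>2 * d * (1 / rt))"
          using * unfolding abs_mult[symmetric] by (rule order_trans[OF abs_ge_self])
        then have "real N * (b * (t ^ p - x ^ p - real p * m ^ (p - 1) * (t - x))) \<le>
            real N * (\<bar>b\<bar> * ((real p)\<^sup>2 * d * (1 / rt)))"
          by (intro mult_left_mono) auto
        also have "\<dots> = \<bar>b\<bar> * (real p)\<^sup>2 * (d * (real N / rt))"
          by simp
        also have "d * (real N / rt) = real j + 1"
          using rt(1) unfolding rt(2)[symmetric] by (simp add: d_def)
        finally have "real N * (b * t ^ p + h * t - H_fun b h p m) \<le> C + real N * (artanh m * t)"
          unfolding C_def stationary by (simp add: algebra_simps)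
        then show ?thesis
          using tB B(3)[OF tB] by (simp add: wt_def exp_add[symmetric])
      qed simp
    qed
    also have "\<dots> \<le> exp C * exp (real N * (artanh m * x - I_fun x))"
      unfolding cfg_avg_cmult by (intro mult_left_mono chernoff[OF m1 True]) simp
    also have "\<dots> = exp (real N * (H_fun b h p x - H_fun b h p m) + \<bar>b\<bar> * (real p)\<^sup>2 * (real j + 1))"
      by (simp add: C_def H_fun_def exp_add[symmetric] algebra_simps)
    also have "real N * (H_fun b h p x - H_fun b h p m) \<le> real N * (- \<kappa> * (x - m)\<^sup>2)"
      using \<kappa>[OF True] by (intro mult_left_mono) auto
    also have "\<dots> = - \<kappa> * (real j)\<^sup>2"
    proof -
      have "(x - m)\<^sup>2 = (s * s) * (real j)\<^sup>2 / (rt * rt)"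
        unfolding xm by (simp add: power2_eq_square)
      then show ?thesis
        using ss rt N by simp
    qed
    finally show ?thesis by simp
  qed
  then show ?thesis by (simp add: B_def rt_def)
qed

text \<open>Summing the block bounds over \<open>j >= K\<close> gives the tail of one convergent
  series, the same for all \<open>N\<close>. The factor \<open>exp (a * Y)\<close> changes only the
  term linear in \<open>j\<close>.\<close>

lemma tail_bound:
  assumes a: "a \<ge> 0"
  shows "\<exists>\<tau>. \<tau> \<longlonglongrightarrow> 0 \<and> (\<forall>N\<ge>1. \<forall>K::nat.
    cfg_avg N (\<lambda>t. indicator {t. real K \<le> sqrt N * \<bar>t - m\<bar>} t * (wt N t * exp (a * (sqrt N * \<bar>t - m\<bar>)))) \<le> \<tau> K)"
proof -
  obtain \<kappa> where \<kappa>: "\<kappa> > 0" "\<And>x. \<bar>x\<bar> \<le> 1 \<Longrightarrow> H_fun b h p x \<le> H_fun b h p m - \<kappa> * (x - m)\<^sup>2"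
    using quadratic_decay[OF m1 max neg] by blast
  define c where "c = \<bar>b\<bar> * (real p)\<^sup>2 + a"
  \<comment> \<open>The factor 2 counts the blocks on the two sides of \<open>m\<close>.\<close>
  define f where "f j = 2 * exp (- \<kappa> * (real j)\<^sup>2 + c * (real j + 1))" for j
  have "summable f"
  proof (rule summable_comparison_test')
    show "summable (\<lambda>j. 2 * exp (c + (c + 1)\<^sup>2 / (4 * \<kappa>)) * exp (- 1 :: real) ^ j)"
      by (intro summable_mult summable_geometric) simp
    fix j
    \<comment> \<open>Completing the square against the slope \<open>c + 1\<close> rather than
      \<open>c\<close> leaves a surplus \<open>- j\<close>, hence a geometric majorant.\<close>
    have "0 \<le> (2 * \<kappa> * real j - (c + 1))\<^sup>2 / (4 * \<kappa>)" using \<kappa> by simp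
    also have "\<dots> = \<kappa> * (real j)\<^sup>2 - (c + 1) * real j + (c + 1)\<^sup>2 / (4 * \<kappa>)"
      using \<kappa>(1) by (simp add: power2_eq_square field_simps)
    finally have "- \<kappa> * (real j)\<^sup>2 + c * (real j + 1) \<le> c + (c + 1)\<^sup>2 / (4 * \<kappa>) + real j * (- 1)"
      by (simp add: algebra_simps)
    then have "exp (- \<kappa> * (real j)\<^sup>2 + c * (real j + 1)) \<le>
        exp (c + (c + 1)\<^sup>2 / (4 * \<kappa>)) * exp (- 1) ^ j"
      unfolding exp_of_nat_mult[symmetric] exp_add[symmetric] by simp
    then show "norm (f j) \<le> 2 * exp (c + (c + 1)\<^sup>2 / (4 * \<kappa>)) * exp (- 1) ^ j"
      by (simp add: f_def)
  qed
  define \<tau> where "\<tau> K = (\<Sum>j. f (j + K))" for K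
  have "\<tau> \<longlonglongrightarrow> 0"
    unfolding \<tau>_def by (rule suminf_exist_split2[OF \<open>summable f\<close>])
  moreover have "cfg_avg N (\<lambda>t. indicator {t. real K \<le> sqrt N * \<bar>t - m\<bar>} t *
      (wt N t * exp (a * (sqrt N * \<bar>t - m\<bar>)))) \<le> \<tau> K" if N: "N \<ge> 1" for N K :: nat
  proof -
    \<comment> \<open>Since \<open>\<bar>t - m\<bar> <= 2\<close>, finitely many blocks suffice for
      each \<open>N\<close>.\<close>
    define J where "J = nat \<lfloor>sqrt N * 2\<rfloor>"
    define B where "B j s = {t. s * (sqrt N * (t - m)) \<in> {real j..<real j + 1}}" for j :: nat and s :: real
    have "cfg_avg N (\<lambda>t. indicator {t. real K \<le> sqrt N * \<bar>t - m\<bar>} t *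
        (wt N t * exp (a * (sqrt N * \<bar>t - m\<bar>)))) \<le>
      cfg_avg N (\<lambda>t. \<Sum>j\<in>{K..J}. \<Sum>s\<in>{-1,1}. exp (a * (real j + 1)) * (indicator (B j s) t * wt N t))"
    proof (rule cfg_avg_mono)
      fix t :: real assume t: "\<bar>t\<bar> \<le> 1"
      let ?S = "\<Sum>j\<in>{K..J}. \<Sum>s\<in>{-1,1}. exp (a * (real j + 1)) * (indicator (B j s) t * wt N t)"
      have nn: "0 \<le> exp (a * (real j + 1)) * (indicator (B j s) t * wt N t)" for j s
        by (intro mult_nonneg_nonneg) (auto intro: less_imp_le)
      show "indicator {t. real K \<le> sqrt N * \<bar>t - m\<bar>} t *
          (wt N t * exp (a * (sqrt N * \<bar>t - m\<bar>))) \<le> ?S"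
      proof (cases "real K \<le> sqrt N * \<bar>t - m\<bar>")
        case True
        define s :: real where "s = (if t \<ge> m then 1 else -1)"
        define y where "y = sqrt N * \<bar>t - m\<bar>"
        define j where "j = nat \<lfloor>y\<rfloor>"
        have y: "y \<ge> 0" "real K \<le> y" using True by (auto simp: y_def)
        have ys: "y = s * (sqrt N * (t - m))" by (auto simp: y_def s_def algebra_simps)
        have j: "real j \<le> y" "y < real j + 1" using y by (auto simp: j_def)
        have tB: "t \<in> B j s" using j by (simp add: B_def ys)
        have "K \<le> j" using y(2) by (simp add: j_def le_nat_iff le_floor_iff)
        have "\<bar>t - m\<bar> \<le> 2" using t m1 by linarith
        then have "y \<le> sqrt N * 2" unfolding y_def by (intro mult_left_mono) auto
        then have "j \<le> J" unfolding j_def J_def by (intro nat_mono floor_mono)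
        have "wt N t * exp (a * y) \<le> exp (a * (real j + 1)) * (indicator (B j s) t * wt N t)"
          using j a tB by (simp add: mult.commute mult_left_mono)
        also have "\<dots> \<le> (\<Sum>s\<in>{-1,1}. exp (a * (real j + 1)) * (indicator (B j s) t * wt N t))"
          by (rule member_le_sum) (use nn in \<open>auto simp: s_def\<close>)
        also have "\<dots> \<le> ?S"
          using \<open>K \<le> j\<close> \<open>j \<le> J\<close> nn by (intro member_le_sum sum_nonneg) auto
        finally show ?thesis using True by (simp add: y_def)
      next
        case False
        then show ?thesis using nn by (simp add: sum_nonneg)
      qed
    qed
    also have "\<dots> = (\<Sum>j\<in>{K..J}. \<Sum>s\<in>{-1,1}. exp (a * (real j + 1)) * cfg_avg N (\<lambda>t. indicator (B j s) t * wt N t))"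
      unfolding cfg_avg_sum cfg_avg_cmult ..
    also have "\<dots> \<le> (\<Sum>j\<in>{K..J}. \<Sum>s\<in>{-1,1::real}. exp (a * (real j + 1)) *
        exp (- \<kappa> * (real j)\<^sup>2 + \<bar>b\<bar> * (real p)\<^sup>2 * (real j + 1)))"
      unfolding B_def by (intro sum_mono mult_left_mono block_bound \<kappa> N) auto
    also have "\<dots> = (\<Sum>j\<in>{K..J}. f j)"
      by (simp add: f_def c_def exp_add[symmetric] algebra_simps)
    also have "\<dots> \<le> (\<Sum>j<Suc J. f (j + K))"
    proof -
      have "(\<Sum>j\<in>{K..J}. f j) \<le> (\<Sum>j\<in>{0+K..J+K}. f j)"
        by (rule sum_mono2) (auto simp: f_def)
      also have "\<dots> = (\<Sum>j<Suc J. f (j + K))"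
        by (subst sum.shift_bounds_cl_nat_ivl) (simp add: atLeast0AtMost lessThan_Suc_atMost)
      finally show ?thesis .
    qed
    also have "\<dots> \<le> \<tau> K"
      unfolding \<tau>_def
      by (intro sum_le_suminf summable_ignore_initial_segment \<open>summable f\<close>) (auto simp: f_def)
    finally show ?thesis .
  qed
  ultimately show ?thesis by blast
qed

end

section \<open>Central limit theorem for independent spins\<close>

lemma filterlim_sqrt_real_at_top: "filterlim (\<lambda>N. sqrt (real N)) at_top sequentially"
  by (intro filterlim_compose[OF sqrt_at_top] filterlim_real_sequentially)

text \<open>Third-order Taylor estimate for a centred spin of mean \<open>m\<close>, whose variance
  is \<open>1 - m^2\<close>. The constant 2 is generous: \<open>\<bar>v\<bar> <= 2\<close> gives
  \<open>8 / 6\<close>.\<close>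

lemma tilted_spin_char:
  fixes m u :: real
  assumes m: "\<bar>m\<bar> \<le> 1"
  shows "norm (complex_of_real ((1 - m) / 2) * iexp (u * (- 1 - m)) + complex_of_real ((1 + m) / 2) * iexp (u * (1 - m))
      - complex_of_real (1 - u\<^sup>2 * (1 - m\<^sup>2) / 2)) \<le> 2 * \<bar>u\<bar> ^ 3"
proof -
  define P where "P x = 1 + \<i> * complex_of_real x - complex_of_real (x\<^sup>2 / 2)" for x
  have approx: "norm (iexp x - P x) \<le> \<bar>x\<bar> ^ 3 / 6" for x
  proof -
    have "(\<Sum>k\<le>2. (\<i> * complex_of_real x) ^ k / fact k) = P x"
      by (simp add: P_def numeral_2_eq_2 mult_ac)
    then show ?thesis
      using iexp_approx1[of x 2] by (simp add: fact_numeral)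
  qed
  have bound: "norm (iexp (u * v) - P (u * v)) \<le> 2 * \<bar>u\<bar> ^ 3" if "\<bar>v\<bar> \<le> 2" for v
  proof -
    have "\<bar>u * v\<bar> ^ 3 = \<bar>u\<bar> ^ 3 * \<bar>v\<bar> ^ 3" by (simp add: abs_mult power_mult_distrib)
    also have "\<dots> \<le> \<bar>u\<bar> ^ 3 * 2 ^ 3" using that by (intro mult_left_mono power_mono) auto
    also have "\<dots> = 8 * \<bar>u\<bar> ^ 3" by simp
    finally have "\<bar>u * v\<bar> ^ 3 / 6 \<le> 2 * \<bar>u\<bar> ^ 3"
      using zero_le_power[OF abs_ge_zero[of u], of 3] by linarith
    then show ?thesis by (rule order_trans[OF approx])
  qed
  have eq: "complex_of_real ((1 - m) / 2) * iexp (u * (- 1 - m)) + complex_of_real ((1 + m) / 2) * iexp (u * (1 - m))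
      - complex_of_real (1 - u\<^sup>2 * (1 - m\<^sup>2) / 2) =
    complex_of_real ((1 - m) / 2) * (iexp (u * (- 1 - m)) - P (u * (- 1 - m))) +
    complex_of_real ((1 + m) / 2) * (iexp (u * (1 - m)) - P (u * (1 - m)))"
    unfolding P_def of_real_mult of_real_add of_real_diff of_real_divide of_real_power of_real_1 of_real_numeral of_real_minus
    by (simp add: field_simps power2_eq_square)
  have "norm (complex_of_real ((1 - m) / 2) * (iexp (u * (- 1 - m)) - P (u * (- 1 - m))) +
      complex_of_real ((1 + m) / 2) * (iexp (u * (1 - m)) - P (u * (1 - m))))
    \<le> (1 - m) / 2 * (2 * \<bar>u\<bar> ^ 3) + (1 + m) / 2 * (2 * \<bar>u\<bar> ^ 3)"
  proof (intro order_trans[OF norm_triangle_ineq] add_mono)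
    show "norm (complex_of_real ((1 - m) / 2) * (iexp (u * (- 1 - m)) - P (u * (- 1 - m)))) \<le> (1 - m) / 2 * (2 * \<bar>u\<bar> ^ 3)"
      unfolding norm_mult norm_of_real using m by (intro mult_mono bound) auto
    show "norm (complex_of_real ((1 + m) / 2) * (iexp (u * (1 - m)) - P (u * (1 - m)))) \<le> (1 + m) / 2 * (2 * \<bar>u\<bar> ^ 3)"
      unfolding norm_mult norm_of_real using m by (intro mult_mono bound) auto
  qed
  also have "\<dots> = 2 * \<bar>u\<bar> ^ 3" by (simp add: field_simps)
  finally show ?thesis unfolding eq .
qed

text \<open>Identifies the product measure \<open>Q\<close> with \<open>cw_measure\<close> at
  \<open>b = 0\<close> and field \<open>artanh m\<close>, so no second measure has to be
  constructed.\<close>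

lemma cw_prob_product:
  assumes m: "\<bar>m\<bar> < 1" and x: "x \<in> configs N"
  shows "cw_prob N 0 (artanh m) p x = (\<Prod>i<N. (1 + m * x i) / 2)"
proof -
  have spin: "exp (artanh m * s) / (2 * cosh (artanh m)) = (1 + m * s) / 2" if "s = -1 \<or> s = 1" for s
    using that cosh_artanh[of m] cosh_artanh[of "-m"] m
    by (auto simp: exp_minus field_simps)
  have "cw_Z N 0 (artanh m) p = cosh (artanh m) ^ N"
    using cfg_avg_exp[of N "artanh m"] by (simp add: cw_Z_eq_cfg_avg gibbs_def[abs_def])
  moreover have "gibbs N 0 (artanh m) p (xbar N x) = (\<Prod>i<N. exp (artanh m * x i))"
    using real_mult_xbar[of N x]
    by (simp add: gibbs_def exp_sum[symmetric] sum_distrib_left[symmetric] mult.left_commute)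
  ultimately have "cw_prob N 0 (artanh m) p x = (\<Prod>i<N. exp (artanh m * x i) / (2 * cosh (artanh m)))"
    by (simp add: cw_prob_eq prod_dividef power_mult_distrib)
  also have "\<dots> = (\<Prod>i<N. (1 + m * x i) / 2)"
    using configs_cases[OF x] by (intro prod.cong spin) auto
  finally show ?thesis .
qed

definition ymean :: "nat \<Rightarrow> real \<Rightarrow> real \<Rightarrow> real" where
  "ymean N m t = sqrt (real N) * (t - m)"

lemma char_tilted:
  assumes m: "\<bar>m\<bar> < 1" and N: "N \<ge> 1"
  shows "char (distr (cw_measure N 0 (artanh m) p) borel (\<lambda>x. ymean N m (xbar N x) / c)) t =
    (complex_of_real ((1 - m) / 2) * iexp (t / (sqrt N * c) * (- 1 - m)) +
     complex_of_real ((1 + m) / 2) * iexp (t / (sqrt N * c) * (1 - m))) ^ N"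
proof -
  define u where "u = t / (sqrt N * c)"
  have "iexp (t * (ymean N m (xbar N x) / c)) = (\<Prod>i<N. iexp (u * (x i - m)))" for x
  proof -
    have "t * (ymean N m (xbar N x) / c) = u * (real N * (xbar N x - m))"
    proof -
      have "u * real N = t / c * (real N / sqrt (real N))" by (simp add: u_def)
      also have "\<dots> = t / c * sqrt (real N)" by (simp add: real_div_sqrt)
      finally show ?thesis by (simp add: ymean_def mult.assoc[symmetric])
    qed
    also have "real N * (xbar N x - m) = (\<Sum>i<N. x i - m)"
      using real_mult_xbar[of N x] by (simp add: sum_subtractf right_diff_distrib)
    finally have "t * (ymean N m (xbar N x) / c) = (\<Sum>i<N. u * (x i - m))"
      by (simp add: sum_distrib_left)
    then show ?thesis
      by (simp add: exp_sum[symmetric] sum_distrib_left)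
  qed
  then have "char (distr (cw_measure N 0 (artanh m) p) borel (\<lambda>x. ymean N m (xbar N x) / c)) t =
    (\<Sum>x\<in>configs N. complex_of_real (\<Prod>i<N. (1 + m * x i) / 2) * (\<Prod>i<N. iexp (u * (x i - m))))"
    unfolding char_def
    by (subst integral_distr) (auto simp: integral_cw_measure cw_prob_product[OF m] scaleR_conv_of_real)
  also have "\<dots> = (\<Sum>x\<in>configs N. \<Prod>i<N. complex_of_real ((1 + m * x i) / 2) * iexp (u * (x i - m)))"
    by (simp only: of_real_prod prod.distrib)
  also have "\<dots> = (complex_of_real ((1 + m * (-1)) / 2) * iexp (u * (-1 - m)) +
      complex_of_real ((1 + m * 1) / 2) * iexp (u * (1 - m))) ^ N"
    by (rule sum_configs_prod)
  finally show ?thesis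
    by (simp add: u_def)
qed

text \<open>Levy continuity, with \<open>norm (z ^ N - w ^ N)\<close> at most
  \<open>N * norm (z - w)\<close> in the unit disc; the error per spin is of order
  \<open>N powr (- 3 / 2)\<close>.\<close>

lemma clt_tilted:
  assumes m: "\<bar>m\<bar> < 1"
  shows "weak_conv_m (\<lambda>N. distr (cw_measure N 0 (artanh m) p) borel
    (\<lambda>x. ymean N m (xbar N x) / sqrt (1 - m\<^sup>2))) std_normal_distribution"
proof (rule levy_continuity)
  define c where "c = sqrt (1 - m\<^sup>2)"
  have c: "c > 0" "c\<^sup>2 = 1 - m\<^sup>2" "m\<^sup>2 \<noteq> 1"
    using m abs_square_less_1[of m] by (simp_all add: c_def)
  let ?D = "\<lambda>N. distr (cw_measure N 0 (artanh m) p) borel (\<lambda>x. ymean N m (xbar N x) / c)"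
  show real_distr: "real_distribution (distr (cw_measure N 0 (artanh m) p) borel
    (\<lambda>x. ymean N m (xbar N x) / sqrt (1 - m\<^sup>2)))" for N
    by (intro prob_space.real_distribution_distr prob_space_cw_measure) simp
  show "real_distribution std_normal_distribution"
    by (rule real_dist_normal_dist)
  show "(\<lambda>N. char (distr (cw_measure N 0 (artanh m) p) borel
    (\<lambda>x. ymean N m (xbar N x) / sqrt (1 - m\<^sup>2))) t) \<longlonglongrightarrow> char std_normal_distribution t" for t
  proof -
    define C where "C = 2 * \<bar>t\<bar> ^ 3 / c ^ 3"
    have "\<forall>\<^sub>F N in sequentially. norm (char (?D N) t - complex_of_real ((1 + (- (t\<^sup>2) / 2) / real N) ^ N))
        \<le> C / sqrt (real N)"
      \<comment> \<open>From \<open>N >= t^2 / 4\<close> on, the Taylor polynomial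
        \<open>1 - t^2 / (2 * N)\<close> lies in the unit disc.\<close>
      using eventually_ge_at_top[of "max 1 (nat \<lceil>t\<^sup>2 / 4\<rceil>)"]
    proof eventually_elim
      case (elim N)
      then have N: "N \<ge> 1" "real N \<ge> t\<^sup>2 / 4" by (auto simp: nat_le_iff ceiling_le_iff)
      define u where "u = t / (sqrt N * c)"
      have uu: "u\<^sup>2 * (1 - m\<^sup>2) / 2 = (t\<^sup>2 / 2) / real N"
        using c N by (simp add: u_def power_divide power_mult_distrib)
      define z where "z = complex_of_real ((1 - m) / 2) * iexp (u * (- 1 - m)) +
        complex_of_real ((1 + m) / 2) * iexp (u * (1 - m))"
      have z1: "norm z \<le> 1"
      proof -
        have "norm z \<le> \<bar>(1 - m) / 2\<bar> + \<bar>(1 + m) / 2\<bar>"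
          unfolding z_def by (rule order_trans[OF norm_triangle_ineq]) (simp only: norm_mult norm_of_real norm_exp_i_times mult_1_right order_refl)
        then show ?thesis using m by (simp add: field_simps)
      qed
      have w1: "norm (complex_of_real (1 - (t\<^sup>2 / 2) / real N)) \<le> 1"
      proof -
        have "\<bar>1 - (t\<^sup>2 / 2) / real N\<bar> \<le> 1"
          using N by (simp add: abs_le_iff field_simps)
        then show ?thesis by (simp only: norm_of_real)
      qed
      have "norm (char (?D N) t - complex_of_real ((1 + (- (t\<^sup>2) / 2) / real N) ^ N)) =
          norm (z ^ N - complex_of_real (1 - (t\<^sup>2 / 2) / real N) ^ N)"
        unfolding char_tilted[OF m N(1)] z_def u_def by simp
      also have "\<dots> \<le> real N * norm (z - complex_of_real (1 - (t\<^sup>2 / 2) / real N))"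
        by (rule norm_power_diff[OF z1 w1])
      also have "\<dots> \<le> real N * (2 * \<bar>u\<bar> ^ 3)"
        using tilted_spin_char[of m u] m unfolding z_def uu by (intro mult_left_mono) auto
      also have "\<dots> = C / sqrt (real N)"
      proof -
        have "sqrt (real N) ^ 3 = real N * sqrt (real N)" by (simp add: power3_eq_cube)
        then show ?thesis
          using N c by (simp add: u_def C_def abs_mult power_divide power_mult_distrib field_simps)
      qed
      finally show ?case .
    qed
    moreover have "(\<lambda>N. C / sqrt (real N)) \<longlonglongrightarrow> 0"
      by (intro real_tendsto_divide_at_top[OF tendsto_const] filterlim_sqrt_real_at_top)
    ultimately have diff: "(\<lambda>N. char (?D N) t - complex_of_real ((1 + (- (t\<^sup>2) / 2) / real N) ^ N)) \<longlonglongrightarrow> 0"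
      by (rule Lim_null_comparison)
    have "(\<lambda>N. complex_of_real ((1 + (- (t\<^sup>2) / 2) / real N) ^ N)) \<longlonglongrightarrow> complex_of_real (exp (- (t\<^sup>2) / 2))"
      by (intro tendsto_of_real tendsto_exp_limit_sequentially)
    from Lim_transform[OF this diff]
    have "(\<lambda>N. char (?D N) t) \<longlonglongrightarrow> complex_of_real (exp (- (t\<^sup>2) / 2))" .
    then show ?thesis
      by (simp add: c_def char_std_normal_distribution)
  qed
qed

lemma std_normal_scaled_AE:
  assumes "finite D" "c \<noteq> (0::real)"
  shows "AE z in std_normal_distribution. c * z \<notin> D"
proof -
  have "{z. c * z \<in> D} = (\<lambda>y. y / c) ` D"
    using assms(2) by (auto simp: image_iff intro!: bexI[of _ "c * _"])
  then have "finite {z. c * z \<in> D}"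
    using assms(1) by simp
  then have "AE z in lborel. z \<notin> {z. c * z \<in> D}"
    by (intro AE_not_in finite_imp_null_set_lborel)
  then show ?thesis
    by (subst AE_density) auto
qed

text \<open>An extended continuous mapping theorem: the integrand varies with \<open>N\<close> and
  may be discontinuous on the null set \<open>D\<close>. Skorohod's coupling makes the convergence
  pointwise, so that dominated convergence applies. The bound is asked from \<open>start\<close> on,
  since truncated integrands are controlled only for large \<open>N\<close>.\<close>

lemma tilted_limit:
  fixes F :: "nat \<Rightarrow> real \<Rightarrow> real"
  assumes m: "\<bar>m\<bar> < 1"
    and F [measurable]: "\<And>N. F N \<in> borel_measurable borel"
    and G [measurable]: "G \<in> borel_measurable borel"
    and D: "finite D"
    and conv: "\<And>y yn. y \<notin> D \<Longrightarrow> yn \<longlonglongrightarrow> y \<Longrightarrow> (\<lambda>N. F N (yn N)) \<longlonglongrightarrow> G y"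
    and bound: "\<And>N y. N \<ge> start \<Longrightarrow> \<bar>F N y\<bar> \<le> B"
  shows "(\<lambda>N. \<integral>x. F N (ymean N m (xbar N x)) \<partial>cw_measure N 0 (artanh m) p) \<longlonglongrightarrow>
    (\<integral>z. G (sqrt (1 - m\<^sup>2) * z) \<partial>std_normal_distribution)"
proof -
  define c where "c = sqrt (1 - m\<^sup>2)"
  have c: "c > 0"
    using m abs_square_less_1[of m] by (simp add: c_def)
  define \<mu> where "\<mu> N = distr (cw_measure N 0 (artanh m) p) borel (\<lambda>x. ymean N m (xbar N x) / c)" for N
  have rd: "real_distribution (\<mu> N)" for N
    unfolding \<mu>_def by (intro prob_space.real_distribution_distr prob_space_cw_measure) simp
  have wc: "weak_conv_m \<mu> std_normal_distribution"
    using clt_tilted[OF m, of p] unfolding \<mu>_def c_def .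
  obtain \<Omega> :: "real measure" and Y_seq Y where \<Omega>: "prob_space \<Omega>"
    and Ys [measurable]: "\<And>n. Y_seq n \<in> borel_measurable \<Omega>"
    and distr_Ys: "\<And>n. distr \<Omega> borel (Y_seq n) = \<mu> n"
    and Y: "Y \<in> measurable \<Omega> lborel"
    and distr_Y: "distr \<Omega> borel Y = std_normal_distribution"
    and lim: "\<And>x. x \<in> space \<Omega> \<Longrightarrow> (\<lambda>n. Y_seq n x) \<longlonglongrightarrow> Y x"
    using Skorohod[OF rd real_dist_normal_dist wc] by blast
  have Y' [measurable]: "Y \<in> borel_measurable \<Omega>"
    using Y by simp
  interpret \<Omega>: prob_space \<Omega> by (rule \<Omega>)
  have AE: "AE x in \<Omega>. c * Y x \<notin> D"
  proof -
    have [measurable]: "D \<in> sets borel" using D by (simp add: borel_closed finite_imp_closed)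
    have "AE z in distr \<Omega> borel Y. c * z \<notin> D"
      unfolding distr_Y using std_normal_scaled_AE[OF D, of c] c by simp
    then show ?thesis
      by (subst (asm) AE_distr_iff) auto
  qed
  have "(\<lambda>N. \<integral>x. F (N + start) (c * Y_seq (N + start) x) \<partial>\<Omega>) \<longlonglongrightarrow> (\<integral>x. G (c * Y x) \<partial>\<Omega>)"
  proof (rule integral_dominated_convergence[where w = "\<lambda>_. B"])
    show "AE x in \<Omega>. (\<lambda>N. F (N + start) (c * Y_seq (N + start) x)) \<longlonglongrightarrow> G (c * Y x)"
      using AE
    proof (rule AE_mp, intro AE_I2 impI)
      fix x assume "x \<in> space \<Omega>" "c * Y x \<notin> D"
      then have "(\<lambda>N. F N (c * Y_seq N x)) \<longlonglongrightarrow> G (c * Y x)"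
        by (intro conv tendsto_mult tendsto_const lim) auto
      then show "(\<lambda>N. F (N + start) (c * Y_seq (N + start) x)) \<longlonglongrightarrow> G (c * Y x)"
        by (rule LIMSEQ_ignore_initial_segment)
    qed
    show "AE x in \<Omega>. norm (F (N + start) (c * Y_seq (N + start) x)) \<le> B" for N
      using bound by auto
  qed auto
  then have "(\<lambda>N. \<integral>x. F N (c * Y_seq N x) \<partial>\<Omega>) \<longlonglongrightarrow> (\<integral>x. G (c * Y x) \<partial>\<Omega>)"
    by (rule LIMSEQ_offset)
  moreover have "(\<integral>x. F N (c * Y_seq N x) \<partial>\<Omega>) =
      (\<integral>x. F N (ymean N m (xbar N x)) \<partial>cw_measure N 0 (artanh m) p)" for N
  proof -
    have "(\<integral>x. F N (c * Y_seq N x) \<partial>\<Omega>) = (\<integral>z. F N (c * z) \<partial>\<mu> N)"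
      unfolding distr_Ys[symmetric] by (subst integral_distr) auto
    also have "\<dots> = (\<integral>x. F N (ymean N m (xbar N x)) \<partial>cw_measure N 0 (artanh m) p)"
      unfolding \<mu>_def using c by (subst integral_distr) auto
    finally show ?thesis .
  qed
  moreover have "(\<integral>x. G (c * Y x) \<partial>\<Omega>) = (\<integral>z. G (c * z) \<partial>std_normal_distribution)"
    unfolding distr_Y[symmetric] by (subst integral_distr) auto
  ultimately show ?thesis
    by (simp add: c_def)
qed

section \<open>Laplace asymptotics\<close>

text \<open>\<open>S\<close> is the second-order Taylor quotient, continuous also at
  \<open>0\<close>. The density of the Gibbs measure against \<open>Q\<close> has exponent
  \<open>b * Y^2 * S (Y / sqrt N)\<close>, so its limit can be read off.\<close>

lemma power_second_order:
  fixes m :: real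
  shows "\<exists>S. continuous_on UNIV S \<and> S 0 = real p * real (p - 1) / 2 * m ^ (p - 2) \<and>
    (\<forall>u. (m + u) ^ p = m ^ p + real p * m ^ (p - 1) * u + u\<^sup>2 * S u)"
proof (induction p)
  case 0
  show ?case by (intro exI[of _ "\<lambda>_. 0"]) auto
next
  case (Suc n)
  then obtain S where S: "continuous_on UNIV S" "S 0 = real n * real (n - 1) / 2 * m ^ (n - 2)"
    "\<And>u. (m + u) ^ n = m ^ n + real n * m ^ (n - 1) * u + u\<^sup>2 * S u"
    by blast
  show ?case
  proof (intro exI[of _ "\<lambda>u. real n * m ^ (n - 1) + (m + u) * S u"] conjI allI)
    show "continuous_on UNIV (\<lambda>u. real n * m ^ (n - 1) + (m + u) * S u)"
      by (intro continuous_intros S(1))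
    have mm: "m * m ^ (n - 2) = m ^ (n - 1)" if "n \<ge> 2"
      using that by (simp add: power_Suc[symmetric] del: power_Suc) (metis Suc_diff_le diff_Suc_Suc numeral_2_eq_2)
    show "real n * m ^ (n - 1) + (m + 0) * S 0 = real (Suc n) * real (Suc n - 1) / 2 * m ^ (Suc n - 2)"
    proof (cases "n \<ge> 2")
      case True
      have "real n * m ^ (n - 1) + (m + 0) * S 0 = real n * m ^ (n - 1) + real n * real (n - 1) / 2 * (m * m ^ (n - 2))"
        by (simp add: S(2))
      also have "\<dots> = real (Suc n) * real (Suc n - 1) / 2 * m ^ (Suc n - 2)"
        unfolding mm[OF True] using True by (simp add: of_nat_diff field_simps numeral_2_eq_2)
      finally show ?thesis .
    next
      case False
      then have "n = 0 \<or> n = 1" by auto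
      then show ?thesis using S(2) by auto
    qed
    show "(m + u) ^ Suc n = m ^ Suc n + real (Suc n) * m ^ (Suc n - 1) * u + u\<^sup>2 * (real n * m ^ (n - 1) + (m + u) * S u)" for u
    proof -
      have mm: "real n * (m * m ^ (n - 1)) = real n * m ^ n" by (cases n) auto
      have "(m + u) ^ Suc n = (m + u) * (m ^ n + real n * m ^ (n - 1) * u + u\<^sup>2 * S u)"
        by (simp add: S(3))
      also have "\<dots> = m * m ^ n + (real n * (m * m ^ (n - 1))) * u + m ^ n * u + u\<^sup>2 * (real n * m ^ (n - 1) + (m + u) * S u)"
        by (simp add: algebra_simps power2_eq_square)
      finally show ?thesis unfolding mm by (simp add: algebra_simps)
    qed
  qed
qed

lemma std_normal_density_times_exp:
  "std_normal_density z * exp (r * z) = exp (r\<^sup>2 / 2) * normal_density r 1 z"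
  by (simp add: normal_density_def exp_add[symmetric] power2_eq_square field_simps)

lemma integrable_exp_abs_std_normal:
  "integrable lborel (\<lambda>w. std_normal_density w * exp (a * \<bar>w\<bar>))"
proof (rule Bochner_Integration.integrable_bound)
  show "integrable lborel (\<lambda>w. std_normal_density w * exp (a * w) + std_normal_density w * exp (- a * w))"
    unfolding std_normal_density_times_exp by (intro Bochner_Integration.integrable_add integrable_mult_right integrable_normal_density) auto
  show "AE w in lborel. norm (std_normal_density w * exp (a * \<bar>w\<bar>))
      \<le> norm (std_normal_density w * exp (a * w) + std_normal_density w * exp (- a * w))"
  proof (intro AE_I2)
    fix w :: real
    have "std_normal_density w * exp (a * \<bar>w\<bar>) \<le> std_normal_density w * exp (a * w) + std_normal_density w * exp (- a * w)"
      by (cases "w \<ge> 0") (auto simp: less_imp_le normal_density_nonneg)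
    then show "norm (std_normal_density w * exp (a * \<bar>w\<bar>))
      \<le> norm (std_normal_density w * exp (a * w) + std_normal_density w * exp (- a * w))"
      by (simp add: normal_density_nonneg)
  qed
qed auto

text \<open>Continuous, so that truncation adds nothing to the exceptional set
  \<open>D\<close>.\<close>

definition cutoff :: "nat \<Rightarrow> real \<Rightarrow> real" where
  "cutoff K y = max 0 (min 1 (real K + 1 - \<bar>y\<bar>))"

lemma cutoff_bounds: "0 \<le> cutoff K y" "cutoff K y \<le> 1"
  by (auto simp: cutoff_def)

lemma cutoff_eq_1: "\<bar>y\<bar> \<le> real K \<Longrightarrow> cutoff K y = 1"
  by (auto simp: cutoff_def)

lemma cutoff_eq_0: "real K + 1 \<le> \<bar>y\<bar> \<Longrightarrow> cutoff K y = 0"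
  by (auto simp: cutoff_def)

lemma cutoff_measurable [measurable]: "cutoff K \<in> borel_measurable borel"
  unfolding cutoff_def[abs_def] by measurable

lemma cutoff_tendsto: "(f \<longlongrightarrow> y) A \<Longrightarrow> ((\<lambda>n. cutoff K (f n)) \<longlongrightarrow> cutoff K y) A"
  unfolding cutoff_def by (intro tendsto_intros)

text \<open>Exchange of the limits in \<open>N\<close> and \<open>K\<close>, possible because the
  error \<open>e K\<close> is uniform in \<open>N\<close>.\<close>

lemma tendsto_by_truncation:
  fixes A :: "nat \<Rightarrow> real" and X :: "nat \<Rightarrow> nat \<Rightarrow> real"
  assumes X: "\<And>K. X K \<longlonglongrightarrow> l K" and l: "l \<longlonglongrightarrow> L" and e: "e \<longlonglongrightarrow> 0"
    and diff: "\<And>N K. N \<ge> 1 \<Longrightarrow> \<bar>A N - X K N\<bar> \<le> e K"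
  shows "A \<longlonglongrightarrow> L"
proof (rule LIMSEQ_I)
  fix r :: real assume r: "0 < r"
  have "\<forall>\<^sub>F K in sequentially. \<bar>l K - L\<bar> < r / 3 \<and> e K < r / 3"
    using tendstoD[OF l, of "r / 3"] order_tendstoD(2)[OF e, of "r / 3"] r
    by (auto simp: dist_real_def intro: eventually_conj)
  then obtain K where K: "\<bar>l K - L\<bar> < r / 3" "e K < r / 3"
    by (auto dest: eventually_happens)
  obtain N0 where N0: "\<And>N. N \<ge> N0 \<Longrightarrow> \<bar>X K N - l K\<bar> < r / 3"
    using LIMSEQ_D[OF X[of K], of "r / 3"] r by auto
  show "\<exists>no. \<forall>n\<ge>no. norm (A n - L) < r"
  proof (intro exI[of _ "max 1 N0"] allI impI)
    fix N assume "max 1 N0 \<le> N"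
    then have "\<bar>A N - X K N\<bar> \<le> e K" "\<bar>X K N - l K\<bar> < r / 3"
      using diff N0 by auto
    then show "norm (A N - L) < r" using K unfolding real_norm_def by linarith
  qed
qed

context cw_max
begin

text \<open>The standard deviation of the limit of \<open>Y\<close> under the Gibbs measure.\<close>

definition \<sigma> :: real where "\<sigma> = sqrt (- 1 / ddH b p m)"

lemma \<sigma>_pos: "\<sigma> > 0"
  using neg by (simp add: \<sigma>_def)

text \<open>Ratio of the limiting standard deviations of \<open>Y\<close> under the Gibbs measure
  and under \<open>Q\<close>; it is the limit of \<open>cfg_avg N (wt N)\<close>. The decay constant
  of the same name in the tail estimates is a different number.\<close>

definition \<kappa> :: real where "\<kappa> = \<sigma> / sqrt (1 - m\<^sup>2)"

lemma var_pos: "0 < 1 - m\<^sup>2"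
  using m1 abs_square_less_1[of m] by simp

lemma \<kappa>_pos: "\<kappa> > 0"
  using \<sigma>_pos var_pos by (simp add: \<kappa>_def)

text \<open>Adding the exponents gives \<open>1 / \<kappa>^2 = 1 - c * (1 - m^2)\<close>, which
  restates \<open>\<sigma>^2 = - 1 / H'' m\<close>.\<close>

lemma std_normal_tilt:
  "std_normal_density z * exp (b * (real p * real (p - 1) / 2 * m ^ (p - 2)) * (sqrt (1 - m\<^sup>2) * z)\<^sup>2) =
    std_normal_density (z / \<kappa>)"
proof -
  define c where "c = b * (real p * real (p - 1) * m ^ (p - 2))"
  have dd: "ddH b p m = c - 1 / (1 - m\<^sup>2)" by (simp add: ddH_def c_def)
  have "1 / \<kappa>\<^sup>2 = (1 - m\<^sup>2) / \<sigma>\<^sup>2"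
    using var_pos by (simp add: \<kappa>_def power_divide)
  also have "\<sigma>\<^sup>2 = - 1 / ddH b p m" using neg by (simp add: \<sigma>_def)
  also have "(1 - m\<^sup>2) / (- 1 / ddH b p m) = 1 - c * (1 - m\<^sup>2)"
    unfolding dd using neg var_pos by (simp add: field_simps)
  finally have k: "1 / \<kappa>\<^sup>2 = 1 - c * (1 - m\<^sup>2)" .
  have "(z / \<kappa>)\<^sup>2 = (1 / \<kappa>\<^sup>2) * z\<^sup>2" by (simp add: power_divide)
  also have "\<dots> = z\<^sup>2 - c * (sqrt (1 - m\<^sup>2) * z)\<^sup>2"
    unfolding k using var_pos by (simp add: power_mult_distrib algebra_simps)
  finally have "- (z / \<kappa>)\<^sup>2 / 2 = - z\<^sup>2 / 2 + b * (real p * real (p - 1) / 2 * m ^ (p - 2)) * (sqrt (1 - m\<^sup>2) * z)\<^sup>2"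
    by (simp add: c_def field_simps)
  then show ?thesis
    by (simp only: std_normal_density_def exp_add mult.assoc)
qed

text \<open>By \<open>stationary\<close> the linear part of \<open>b * t ^ p\<close> at
  \<open>m\<close> already sits in the field \<open>artanh m\<close>, and by the Legendre formula
  the constants cancel. Only the second-order remainder is left.\<close>

lemma wt_tilted:
  assumes N: "N \<ge> 1"
  shows "wt N t = gibbs N 0 (artanh m) p t / cosh (artanh m) ^ N *
    exp (real N * b * ((m + (t - m)) ^ p - m ^ p - real p * m ^ (p - 1) * (t - m)))"
proof -
  have "cosh (artanh m) ^ N = exp (real N * ln (cosh (artanh m)))"
    by (simp add: exp_of_nat_mult)
  also have "ln (cosh (artanh m)) = artanh m * m - I_fun m"
    using I_fun_eq_artanh[OF m1] by simp
  finally have "gibbs N 0 (artanh m) p t / cosh (artanh m) ^ N *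
      exp (real N * b * ((m + (t - m)) ^ p - m ^ p - real p * m ^ (p - 1) * (t - m))) =
    exp (real N * (artanh m * t) - real N * (artanh m * m - I_fun m) +
      real N * b * (t ^ p - m ^ p - real p * m ^ (p - 1) * (t - m)))"
    by (simp add: gibbs_def exp_add exp_diff)
  also have "\<dots> = wt N t"
    unfolding wt_def H_fun_def stationary by (simp add: algebra_simps)
  finally show ?thesis by simp
qed

text \<open>The limit under \<open>Q\<close> is taken with a cutoff, since the density is controlled
  only for bounded \<open>Y\<close>. The cutoff is removed before the limit by
  \<open>tail_bound\<close>, uniformly in \<open>N\<close>, and after it by dominated
  convergence.\<close>

lemma laplace_unnormalised:
  fixes F :: "nat \<Rightarrow> real \<Rightarrow> real"
  assumes F [measurable]: "\<And>N. F N \<in> borel_measurable borel"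
    and G [measurable]: "G \<in> borel_measurable borel"
    and D: "finite D"
    and conv: "\<And>y yn. y \<notin> D \<Longrightarrow> yn \<longlonglongrightarrow> y \<Longrightarrow> (\<lambda>N. F N (yn N)) \<longlonglongrightarrow> G y"
    and a: "a \<ge> 0"
    and bound: "\<And>N y. N \<ge> 1 \<Longrightarrow> \<bar>m + y / sqrt N\<bar> \<le> 1 \<Longrightarrow> \<bar>F N y\<bar> \<le> C * exp (a * \<bar>y\<bar>)"
  shows "(\<lambda>N. cfg_avg N (\<lambda>t. wt N t * F N (ymean N m t))) \<longlonglongrightarrow>
    \<kappa> * (\<integral>z. G (\<sigma> * z) \<partial>std_normal_distribution)"
proof -
  have C: "C \<ge> 0"
    using bound[of 1 0] m1 by simp
  obtain S where S: "continuous_on UNIV S" "S 0 = real p * real (p - 1) / 2 * m ^ (p - 2)"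
    "\<And>u. (m + u) ^ p = m ^ p + real p * m ^ (p - 1) * u + u\<^sup>2 * S u"
    using power_second_order[of p m] by blast
  have [measurable]: "S \<in> borel_measurable borel"
    using S(1) by (rule borel_measurable_continuous_onI)
  obtain \<tau> where \<tau>: "\<tau> \<longlonglongrightarrow> 0" "\<And>N K. N \<ge> 1 \<Longrightarrow> cfg_avg N (\<lambda>t. indicator {t. real K \<le> sqrt N * \<bar>t - m\<bar>} t *
      (wt N t * exp (a * (sqrt N * \<bar>t - m\<bar>)))) \<le> \<tau> K"
    using tail_bound[OF a] by blast
  \<comment> \<open>Makes the growth bound on \<open>F\<close> available on every compact set of
    \<open>y\<close>, for large \<open>N\<close>.\<close>
  have in_range: "\<exists>N0\<ge>1. \<forall>N::nat\<ge>N0. \<forall>y. \<bar>y\<bar> \<le> k \<longrightarrow> \<bar>m + y / sqrt (real N)\<bar> \<le> 1" if k: "k \<ge> 0" for k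
  proof -
    have "(\<lambda>N. k / sqrt (real N)) \<longlonglongrightarrow> 0"
      by (intro real_tendsto_divide_at_top[OF tendsto_const] filterlim_sqrt_real_at_top)
    then have "\<forall>\<^sub>F N in sequentially. k / sqrt (real N) < 1 - \<bar>m\<bar>"
      by (rule order_tendstoD) (use m1 in simp)
    then obtain N0 where N0: "\<And>N. N \<ge> N0 \<Longrightarrow> k / sqrt (real N) < 1 - \<bar>m\<bar>"
      by (auto simp: eventually_sequentially)
    have "\<bar>m + y / sqrt N\<bar> \<le> 1" if "N \<ge> N0" "\<bar>y\<bar> \<le> k" for N :: nat and y
    proof -
      have "\<bar>m + y / sqrt N\<bar> \<le> \<bar>m\<bar> + \<bar>y\<bar> / sqrt N"
        by (rule order_trans[OF abs_triangle_ineq]) simp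
      also have "\<bar>y\<bar> / sqrt N \<le> k / sqrt N"
        using that by (intro divide_right_mono) auto
      finally show ?thesis using N0[OF that(1)] by linarith
    qed
    then show ?thesis by (intro exI[of _ "max 1 N0"]) auto
  qed
  \<comment> \<open>\<open>G\<close> inherits the growth of \<open>F\<close> off \<open>D\<close>,
    by taking the limit along the constant sequence \<open>y\<close>.\<close>
  have G_bound: "\<bar>G y\<bar> \<le> C * exp (a * \<bar>y\<bar>)" if "y \<notin> D" for y
  proof -
    obtain N0 :: nat where "N0 \<ge> 1" "\<And>N :: nat. N \<ge> N0 \<Longrightarrow> \<bar>m + y / sqrt (real N)\<bar> \<le> 1"
      using in_range[of "\<bar>y\<bar>"] by auto
    then have "\<forall>\<^sub>F N in sequentially. \<bar>F N y\<bar> \<le> C * exp (a * \<bar>y\<bar>)"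
      using bound by (intro eventually_sequentiallyI[of N0]) auto
    moreover have "(\<lambda>N. \<bar>F N y\<bar>) \<longlonglongrightarrow> \<bar>G y\<bar>"
      by (intro tendsto_rabs conv that tendsto_const)
    ultimately show ?thesis
      by (intro tendsto_upperbound) auto
  qed
  \<comment> \<open>The density of \<open>wt\<close> against the product measure, in the variable
    \<open>Y\<close>.\<close>
  define E where "E N y = exp (b * (y\<^sup>2 * S (y / sqrt (real N))))" for N y
  define X where "X K N = (\<integral>x. E N (ymean N m (xbar N x)) * (F N (ymean N m (xbar N x)) * cutoff K (ymean N m (xbar N x)))
      \<partial>cw_measure N 0 (artanh m) p)" for K N
  define l where "l K = (\<integral>z. exp (b * S 0 * (sqrt (1 - m\<^sup>2) * z)\<^sup>2) *
      (G (sqrt (1 - m\<^sup>2) * z) * cutoff K (sqrt (1 - m\<^sup>2) * z)) \<partial>std_normal_distribution)" for K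
  have X_lim: "X K \<longlonglongrightarrow> l K" for K
  proof -
    obtain N0 :: nat where N0: "N0 \<ge> 1"
      "\<And>(N :: nat) y. N \<ge> N0 \<Longrightarrow> \<bar>y\<bar> \<le> real K + 1 \<Longrightarrow> \<bar>m + y / sqrt (real N)\<bar> \<le> 1"
      using in_range[of "real K + 1"] by auto
    have "bounded (S ` {- (real K + 1)..real K + 1})"
      by (intro compact_imp_bounded compact_continuous_image continuous_on_subset[OF S(1)]) auto
    then obtain M where "\<forall>u\<in>{- (real K + 1)..real K + 1}. \<bar>S u\<bar> \<le> M"
      unfolding bounded_iff by auto
    then have M: "\<bar>S u\<bar> \<le> M" if "\<bar>u\<bar> \<le> real K + 1" for u
      using that by (auto simp: abs_le_iff)
    have lim_E: "(\<lambda>N. E N (yn N)) \<longlonglongrightarrow> exp (b * S 0 * y\<^sup>2)" if "yn \<longlonglongrightarrow> y" for yn y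
    proof -
      have "(\<lambda>N. yn N / sqrt (real N)) \<longlonglongrightarrow> 0"
        by (intro real_tendsto_divide_at_top[OF that] filterlim_sqrt_real_at_top)
      moreover have "isCont S 0"
        using S(1) by (simp add: continuous_on_eq_continuous_at)
      ultimately have "(\<lambda>N. S (yn N / sqrt (real N))) \<longlonglongrightarrow> S 0"
        by (intro isCont_tendsto_compose[of 0 S])
      then have "(\<lambda>N. E N (yn N)) \<longlonglongrightarrow> exp (b * (y\<^sup>2 * S 0))"
        unfolding E_def by (intro tendsto_intros that)
      then show ?thesis by (simp add: mult_ac)
    qed
    show ?thesis
      unfolding X_def l_def
    proof (rule tilted_limit[OF m1 _ _ D, where start = N0])
      show "(\<lambda>N. E N (yn N) * (F N (yn N) * cutoff K (yn N))) \<longlonglongrightarrow> exp (b * S 0 * y\<^sup>2) * (G y * cutoff K y)"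
        if "y \<notin> D" "yn \<longlonglongrightarrow> y" for y yn
        by (intro tendsto_mult lim_E conv cutoff_tendsto that)
      show "\<bar>E N y * (F N y * cutoff K y)\<bar> \<le> exp (\<bar>b\<bar> * ((real K + 1)\<^sup>2 * M)) * (C * exp (a * (real K + 1)))"
        if N: "N \<ge> N0" for N y
      proof (cases "\<bar>y\<bar> \<le> real K + 1")
        case True
        have "\<bar>y\<bar> / sqrt N \<le> (real K + 1) / 1"
          using True N N0(1) by (intro frac_le) auto
        then have "\<bar>S (y / sqrt N)\<bar> \<le> M" by (intro M) simp
        moreover have "y\<^sup>2 \<le> (real K + 1)\<^sup>2" using True by (simp add: abs_le_square_iff[symmetric])
        ultimately have "\<bar>b\<bar> * (y\<^sup>2 * \<bar>S (y / sqrt N)\<bar>) \<le> \<bar>b\<bar> * ((real K + 1)\<^sup>2 * M)"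
          by (intro mult_left_mono mult_mono) auto
        then have "\<bar>b * (y\<^sup>2 * S (y / sqrt N))\<bar> \<le> \<bar>b\<bar> * ((real K + 1)\<^sup>2 * M)"
          by (simp add: abs_mult)
        then have 1: "E N y \<le> exp (\<bar>b\<bar> * ((real K + 1)\<^sup>2 * M))"
          unfolding E_def by simp
        have "\<bar>F N y\<bar> \<le> C * exp (a * \<bar>y\<bar>)"
          using N N0 True by (intro bound) auto
        also have "\<dots> \<le> C * exp (a * (real K + 1))"
          using True a C by (intro mult_left_mono) (auto intro: mult_left_mono)
        finally have 2: "\<bar>F N y\<bar> * cutoff K y \<le> (C * exp (a * (real K + 1))) * 1"
          using C cutoff_bounds by (intro mult_mono) auto
        show ?thesis
          using mult_mono[OF 1 2] C cutoff_bounds[of K y] by (simp add: abs_mult E_def)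
      next
        case False
        then show ?thesis using C by (simp add: cutoff_eq_0)
      qed
    qed (auto simp: E_def)
  qed
  have l_eq: "l K = \<kappa> * (\<integral>w. G (\<sigma> * w) * cutoff K (\<sigma> * w) \<partial>std_normal_distribution)" for K
  proof -
    have \<sigma>: "sqrt (1 - m\<^sup>2) * (\<kappa> * w) = \<sigma> * w" for w
      using var_pos by (simp add: \<kappa>_def)
    have "l K = (\<integral>z. std_normal_density (z / \<kappa>) * (G (sqrt (1 - m\<^sup>2) * z) * cutoff K (sqrt (1 - m\<^sup>2) * z)) \<partial>lborel)"
      unfolding l_def std_normal_tilt[symmetric] S(2) by (subst integral_density) (auto simp: mult_ac)
    \<comment> \<open>Substituting \<open>z = \<kappa> * w\<close> makes the Gaussian standard again
      and turns the scale \<open>sqrt (1 - m^2)\<close> into \<open>\<sigma>\<close>.\<close>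
    also have "\<dots> = \<bar>\<kappa>\<bar> *\<^sub>R (\<integral>w. std_normal_density ((0 + \<kappa> * w) / \<kappa>) *
        (G (sqrt (1 - m\<^sup>2) * (0 + \<kappa> * w)) * cutoff K (sqrt (1 - m\<^sup>2) * (0 + \<kappa> * w))) \<partial>lborel)"
      using \<kappa>_pos by (intro lborel_integral_real_affine) simp
    also have "\<dots> = \<kappa> * (\<integral>w. std_normal_density w * (G (\<sigma> * w) * cutoff K (\<sigma> * w)) \<partial>lborel)"
      using \<kappa>_pos by (simp add: \<sigma>)
    also have "\<dots> = \<kappa> * (\<integral>w. G (\<sigma> * w) * cutoff K (\<sigma> * w) \<partial>std_normal_distribution)"
      by (subst integral_density) auto
    finally show ?thesis .
  qed
  have "(\<lambda>K. \<integral>w. std_normal_density w * (G (\<sigma> * w) * cutoff K (\<sigma> * w)) \<partial>lborel) \<longlonglongrightarrow>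
      (\<integral>w. std_normal_density w * G (\<sigma> * w) \<partial>lborel)"
  proof (rule integral_dominated_convergence[where w = "\<lambda>w. C * (std_normal_density w * exp (a * \<sigma> * \<bar>w\<bar>))"])
    show "integrable lborel (\<lambda>w. C * (std_normal_density w * exp (a * \<sigma> * \<bar>w\<bar>)))"
      by (intro integrable_mult_right integrable_exp_abs_std_normal)
    show "AE w in lborel. (\<lambda>K. std_normal_density w * (G (\<sigma> * w) * cutoff K (\<sigma> * w))) \<longlonglongrightarrow> std_normal_density w * G (\<sigma> * w)"
    proof (rule AE_I2)
      fix w :: real
      have "\<forall>\<^sub>F K in sequentially. std_normal_density w * (G (\<sigma> * w) * cutoff K (\<sigma> * w)) = std_normal_density w * G (\<sigma> * w)"
        using eventually_ge_at_top[of "nat \<lceil>\<bar>\<sigma> * w\<bar>\<rceil>"]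
        by eventually_elim (simp add: cutoff_eq_1 nat_le_iff ceiling_le_iff)
      then show "(\<lambda>K. std_normal_density w * (G (\<sigma> * w) * cutoff K (\<sigma> * w))) \<longlonglongrightarrow> std_normal_density w * G (\<sigma> * w)"
        by (rule tendsto_eventually)
    qed
    have "{w. \<sigma> * w \<in> D} = (\<lambda>y. y / \<sigma>) ` D"
      using \<sigma>_pos by (auto simp: image_iff intro!: bexI[of _ "\<sigma> * _"])
    then have "AE w in lborel. w \<notin> {w. \<sigma> * w \<in> D}"
      using D by (intro AE_not_in finite_imp_null_set_lborel) simp
    then show "AE w in lborel. norm (std_normal_density w * (G (\<sigma> * w) * cutoff K (\<sigma> * w)))
        \<le> C * (std_normal_density w * exp (a * \<sigma> * \<bar>w\<bar>))" for K
    proof (rule AE_mp, intro AE_I2 impI)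
      fix w assume "w \<notin> {w. \<sigma> * w \<in> D}"
      then have "\<bar>G (\<sigma> * w)\<bar> \<le> C * exp (a * \<sigma> * \<bar>w\<bar>)"
        using G_bound[of "\<sigma> * w"] \<sigma>_pos by (simp add: abs_mult mult.assoc)
      then have "\<bar>G (\<sigma> * w)\<bar> * cutoff K (\<sigma> * w) \<le> (C * exp (a * \<sigma> * \<bar>w\<bar>)) * 1"
        using C cutoff_bounds by (intro mult_mono) auto
      then have "std_normal_density w * (\<bar>G (\<sigma> * w)\<bar> * cutoff K (\<sigma> * w)) \<le> std_normal_density w * (C * exp (a * \<sigma> * \<bar>w\<bar>))"
        by (intro mult_left_mono) auto
      then show "norm (std_normal_density w * (G (\<sigma> * w) * cutoff K (\<sigma> * w)))
        \<le> C * (std_normal_density w * exp (a * \<sigma> * \<bar>w\<bar>))"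
        using cutoff_bounds[of K] by (simp add: abs_mult mult_ac)
    qed
  qed auto
  then have "(\<lambda>K. \<integral>w. G (\<sigma> * w) * cutoff K (\<sigma> * w) \<partial>std_normal_distribution) \<longlonglongrightarrow>
      (\<integral>w. G (\<sigma> * w) \<partial>std_normal_distribution)"
    by (subst (1 2) integral_density) auto
  then have l_lim: "l \<longlonglongrightarrow> \<kappa> * (\<integral>w. G (\<sigma> * w) \<partial>std_normal_distribution)"
    unfolding l_eq[abs_def] by (intro tendsto_intros)
  have X_eq: "X K N = cfg_avg N (\<lambda>t. wt N t * (F N (ymean N m t) * cutoff K (ymean N m t)))" if N: "N \<ge> 1" for K N
  proof -
    have Z: "cfg_avg N (gibbs N 0 (artanh m) p) = cosh (artanh m) ^ N"
      using cfg_avg_exp[of N "artanh m"] by (simp add: gibbs_def[abs_def])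
    have E: "E N (ymean N m t) = exp (real N * b * ((m + (t - m)) ^ p - m ^ p - real p * m ^ (p - 1) * (t - m)))" for t
    proof -
      have "(ymean N m t)\<^sup>2 * S (ymean N m t / sqrt (real N)) = real N * ((t - m)\<^sup>2 * S (t - m))"
        using N by (simp add: ymean_def power_mult_distrib)
      then show ?thesis unfolding S(3) E_def by (simp add: mult_ac)
    qed
    have "X K N = cfg_avg N (\<lambda>t. gibbs N 0 (artanh m) p t * (E N (ymean N m t) * (F N (ymean N m t) * cutoff K (ymean N m t))))
        / cosh (artanh m) ^ N"
      unfolding X_def Z[symmetric] by (rule integral_cw_measure_xbar[where F = "\<lambda>t. E N (ymean N m t) * (F N (ymean N m t) * cutoff K (ymean N m t))"])
    also have "\<dots> = cfg_avg N (\<lambda>t. (1 / cosh (artanh m) ^ N) * (gibbs N 0 (artanh m) p t * (E N (ymean N m t) * (F N (ymean N m t) * cutoff K (ymean N m t)))))"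
      unfolding cfg_avg_cmult by simp
    also have "\<dots> = cfg_avg N (\<lambda>t. wt N t * (F N (ymean N m t) * cutoff K (ymean N m t)))"
      unfolding wt_tilted[OF N] E by (simp add: mult_ac)
    finally show ?thesis .
  qed
  show ?thesis
  proof (rule tendsto_by_truncation[OF X_lim l_lim])
    show "(\<lambda>K. C * \<tau> K) \<longlonglongrightarrow> 0"
      using tendsto_mult_left[OF \<tau>(1), of C] by simp
    fix N K :: nat assume N: "N \<ge> 1"
    have "\<bar>cfg_avg N (\<lambda>t. wt N t * F N (ymean N m t)) - X K N\<bar> \<le>
        cfg_avg N (\<lambda>t. \<bar>wt N t * F N (ymean N m t) - wt N t * (F N (ymean N m t) * cutoff K (ymean N m t))\<bar>)"
      unfolding X_eq[OF N] cfg_avg_diff[symmetric] by (rule cfg_avg_abs)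
    also have "\<dots> \<le> cfg_avg N (\<lambda>t. C * (indicator {t. real K \<le> sqrt N * \<bar>t - m\<bar>} t *
      (wt N t * exp (a * (sqrt N * \<bar>t - m\<bar>)))))"
    proof (rule cfg_avg_mono)
      fix t :: real assume t: "\<bar>t\<bar> \<le> 1"
      let ?y = "ymean N m t"
      have y: "\<bar>?y\<bar> = sqrt N * \<bar>t - m\<bar>" by (simp add: ymean_def abs_mult)
      have eq: "\<bar>wt N t * F N ?y - wt N t * (F N ?y * cutoff K ?y)\<bar> = wt N t * (\<bar>F N ?y\<bar> * (1 - cutoff K ?y))"
      proof -
        have "wt N t * F N ?y - wt N t * (F N ?y * cutoff K ?y) = wt N t * (F N ?y * (1 - cutoff K ?y))"
          by (simp add: algebra_simps)
        then show ?thesis using cutoff_bounds[of K ?y] by (simp add: abs_mult abs_of_pos[OF wt_pos])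
      qed
      show "\<bar>wt N t * F N ?y - wt N t * (F N ?y * cutoff K ?y)\<bar> \<le> C * (indicator {t. real K \<le> sqrt N * \<bar>t - m\<bar>} t *
        (wt N t * exp (a * (sqrt N * \<bar>t - m\<bar>))))"
      proof (cases "real K \<le> sqrt N * \<bar>t - m\<bar>")
        case True
        have "m + ?y / sqrt N = t" using N by (simp add: ymean_def)
        then have "\<bar>F N ?y\<bar> \<le> C * exp (a * \<bar>?y\<bar>)" using t by (intro bound[OF N]) simp
        then have "\<bar>F N ?y\<bar> * (1 - cutoff K ?y) \<le> (C * exp (a * \<bar>?y\<bar>)) * 1"
          using C cutoff_bounds[of K ?y] by (intro mult_mono) auto
        then have "wt N t * (\<bar>F N ?y\<bar> * (1 - cutoff K ?y)) \<le> wt N t * (C * exp (a * \<bar>?y\<bar>))"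
          by (intro mult_left_mono) (auto intro: less_imp_le)
        then show ?thesis unfolding eq using True by (simp add: y mult_ac)
      next
        case False
        then show ?thesis unfolding eq by (simp add: cutoff_eq_1 y)
      qed
    qed
    also have "\<dots> \<le> C * \<tau> K"
      unfolding cfg_avg_cmult by (intro mult_left_mono \<tau> N C)
    finally show "\<bar>cfg_avg N (\<lambda>t. wt N t * F N (ymean N m t)) - X K N\<bar> \<le> C * \<tau> K" .
  qed
qed

text \<open>Division by the case of the constant \<open>1\<close>, whose limit
  \<open>\<kappa>\<close> is positive.\<close>

theorem laplace:
  fixes F :: "nat \<Rightarrow> real \<Rightarrow> real"
  assumes F: "\<And>N. F N \<in> borel_measurable borel"
    and G: "G \<in> borel_measurable borel"
    and D: "finite D"
    and conv: "\<And>y yn. y \<notin> D \<Longrightarrow> yn \<longlonglongrightarrow> y \<Longrightarrow> (\<lambda>N. F N (yn N)) \<longlonglongrightarrow> G y"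
    and a: "a \<ge> 0"
    and bound: "\<And>N y. N \<ge> 1 \<Longrightarrow> \<bar>m + y / sqrt N\<bar> \<le> 1 \<Longrightarrow> \<bar>F N y\<bar> \<le> C * exp (a * \<bar>y\<bar>)"
  shows "(\<lambda>N. \<integral>x. F N (ymean N m (xbar N x)) \<partial>cw_measure N b h p) \<longlonglongrightarrow>
    (\<integral>z. G (\<sigma> * z) \<partial>std_normal_distribution)"
proof -
  interpret std: prob_space std_normal_distribution
    by (intro prob_space_normal_density) simp
  have num: "(\<lambda>N. cfg_avg N (\<lambda>t. wt N t * F N (ymean N m t))) \<longlonglongrightarrow>
      \<kappa> * (\<integral>z. G (\<sigma> * z) \<partial>std_normal_distribution)"
    by (rule laplace_unnormalised[OF F G D conv a bound])
  have "(\<lambda>N. cfg_avg N (\<lambda>t. wt N t * 1)) \<longlonglongrightarrow> \<kappa> * (\<integral>z. 1 \<partial>std_normal_distribution)"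
    by (rule laplace_unnormalised[where D = "{}" and a = 0 and C = 1 and F = "\<lambda>_ _. 1" and G = "\<lambda>_. 1"]) auto
  then have den: "(\<lambda>N. cfg_avg N (wt N)) \<longlonglongrightarrow> \<kappa>"
    using std.prob_space by simp
  have "(\<integral>x. F N (ymean N m (xbar N x)) \<partial>cw_measure N b h p) =
      cfg_avg N (\<lambda>t. wt N t * F N (ymean N m t)) / cfg_avg N (wt N)" for N
  proof -
    have "(\<integral>x. F N (ymean N m (xbar N x)) \<partial>cw_measure N b h p) =
      cfg_avg N (\<lambda>t. exp (real N * H_fun b h p m) * (wt N t * F N (ymean N m t))) /
      cfg_avg N (\<lambda>t. exp (real N * H_fun b h p m) * wt N t)"
      using integral_cw_measure_xbar[of N b h p "\<lambda>t. F N (ymean N m t)"]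
      unfolding gibbs_eq_wt[abs_def] by (simp add: mult.assoc)
    then show ?thesis unfolding cfg_avg_cmult by simp
  qed
  then show ?thesis
    using tendsto_divide[OF num den] \<kappa>_pos by simp
qed

end

section \<open>Weak convergence on the extended line\<close>

text \<open>Compactifies the extended line to \<open>[- pi / 2, pi / 2]\<close>, so that weak
  convergence of real distributions can be used.\<close>

definition ereal_arctan :: "ereal \<Rightarrow> real" where
  "ereal_arctan t = (if t = \<infinity> then pi / 2 else if t = - \<infinity> then - pi / 2 else arctan (real_of_ereal t))"

text \<open>Extended by constants, so that composing a test function with it gives a continuous
  function on the whole real line.\<close>

definition ereal_tan :: "real \<Rightarrow> ereal" where
  "ereal_tan y = (if y \<ge> pi / 2 then \<infinity> else if y \<le> - pi / 2 then - \<infinity> else ereal (tan y))"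

lemma ereal_arctan_simps [simp]:
  "ereal_arctan (ereal r) = arctan r" "ereal_arctan \<infinity> = pi / 2" "ereal_arctan (- \<infinity>) = - pi / 2"
  by (auto simp: ereal_arctan_def)

lemma ereal_tan_arctan: "ereal_tan (ereal_arctan t) = t"
  using arctan_bounded by (cases t) (auto simp: ereal_tan_def arctan not_le pi_gt_zero)

lemma ereal_arctan_bounds: "- pi / 2 \<le> ereal_arctan t" "ereal_arctan t \<le> pi / 2"
  using arctan_bounded by (cases t; auto intro: less_imp_le)+

lemma ereal_arctan_le_arctan_iff: "ereal_arctan t \<le> arctan s \<longleftrightarrow> t \<le> ereal s"
  using arctan_bounded[of s] by (cases t) (auto simp: arctan_le_iff)

lemma ereal_arctan_eq_arctan_iff: "ereal_arctan t = arctan s \<longleftrightarrow> t = ereal s"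
  using arctan_bounded[of s] by (cases t) (auto simp: arctan_eq_iff)

lemma continuous_on_ereal_tan: "continuous_on UNIV ereal_tan"
proof (rule continuous_onI_mono)
  have "range ereal_tan = UNIV"
    using ereal_tan_arctan by (metis surjI)
  then show "open (range ereal_tan)" by simp
  show "ereal_tan x \<le> ereal_tan y" if "x \<le> y" for x y
    using that tan_mono_le[of x y] by (auto simp: ereal_tan_def)
qed

lemma borel_measurable_ereal_arctan [measurable]: "ereal_arctan \<in> borel_measurable borel"
  unfolding ereal_arctan_def[abs_def] by measurable

lemma countable_atoms:
  assumes "real_distribution \<mu>"
  shows "countable {x. measure \<mu> {x} \<noteq> 0}"
proof -
  interpret real_distribution \<mu> by fact
  show ?thesis using countable_support by simp
qed

text \<open>Only real thresholds are tested; the masses at the two infinities follow. After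
  \<open>ereal_arctan\<close>, the one nontrivial point to which no real threshold corresponds is
  \<open>- pi / 2\<close>.\<close>

lemma ereal_weak_convI:
  fixes T :: "nat \<Rightarrow> 'a \<Rightarrow> ereal" and S :: "'b \<Rightarrow> ereal" and f :: "ereal \<Rightarrow> real"
  assumes M: "\<And>n. prob_space (M n)" and T [measurable]: "\<And>n. T n \<in> borel_measurable (M n)"
    and L: "prob_space L" and S [measurable]: "S \<in> borel_measurable L"
    and conv: "\<And>s. measure L {z \<in> space L. S z = ereal s} = 0 \<Longrightarrow>
      (\<lambda>n. measure (M n) {x \<in> space (M n). T n x \<le> ereal s}) \<longlonglongrightarrow> measure L {z \<in> space L. S z \<le> ereal s}"
    and f: "continuous_on UNIV f" "bounded (range f)"
  shows "(\<lambda>n. \<integral>x. f (T n x) \<partial>M n) \<longlonglongrightarrow> (\<integral>z. f (S z) \<partial>L)"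
proof -
  define \<mu> where "\<mu> n = distr (M n) borel (\<lambda>x. ereal_arctan (T n x))" for n
  define \<nu> where "\<nu> = distr L borel (\<lambda>z. ereal_arctan (S z))"
  have \<mu>: "real_distribution (\<mu> n)" for n
    unfolding \<mu>_def by (intro prob_space.real_distribution_distr M) measurable
  have \<nu>: "real_distribution \<nu>"
    unfolding \<nu>_def by (intro prob_space.real_distribution_distr L) measurable
  interpret \<mu>: real_distribution "\<mu> n" for n by (rule \<mu>)
  interpret \<nu>: real_distribution \<nu> by (rule \<nu>)
  have cdf_\<mu>: "cdf (\<mu> n) x = measure (M n) {z \<in> space (M n). ereal_arctan (T n z) \<le> x}" for n x
    unfolding \<mu>_def cdf_def by (subst measure_distr) (auto intro!: arg_cong[where f = "measure (M n)"])
  have cdf_\<nu>: "cdf \<nu> x = measure L {z \<in> space L. ereal_arctan (S z) \<le> x}" for x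
    unfolding \<nu>_def cdf_def by (subst measure_distr) (auto intro!: arg_cong[where f = "measure L"])
  have atom_\<nu>: "measure \<nu> {x} = measure L {z \<in> space L. ereal_arctan (S z) = x}" for x
    unfolding \<nu>_def by (subst measure_distr) (auto intro!: arg_cong[where f = "measure L"])
  have inner: "(\<lambda>n. cdf (\<mu> n) x) \<longlonglongrightarrow> cdf \<nu> x" if "measure \<nu> {x} = 0" "- pi / 2 < x" "x < pi / 2" for x
  proof -
    have x: "x = arctan (tan x)" using that by (simp add: arctan_tan)
    have "measure L {z \<in> space L. S z = ereal (tan x)} = 0"
      using that(1) unfolding atom_\<nu> by (subst (asm) x) (simp only: ereal_arctan_eq_arctan_iff)
    from conv[OF this] show ?thesis
      unfolding cdf_\<mu> cdf_\<nu> by (subst (1 2) x) (simp only: ereal_arctan_le_arctan_iff)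
  qed
  have "weak_conv_m \<mu> \<nu>"
    unfolding weak_conv_m_def weak_conv_def
  proof (intro allI impI)
    fix x assume cont: "isCont (cdf \<nu>) x"
    then have atom: "measure \<nu> {x} = 0" by (simp add: \<nu>.isCont_cdf)
    consider "x < - pi / 2" | "x = - pi / 2" | "- pi / 2 < x" "x < pi / 2" | "x \<ge> pi / 2"
      by linarith
    then show "(\<lambda>n. cdf (\<mu> n) x) \<longlonglongrightarrow> cdf \<nu> x"
    proof cases
      case 1
      then have "\<not> ereal_arctan t \<le> x" for t
        using ereal_arctan_bounds(1)[of t] by linarith
      then show ?thesis unfolding cdf_\<mu> cdf_\<nu> by simp
    next
      case 2
      \<comment> \<open>The point \<open>- pi / 2\<close> stands for \<open>- \<infinity>\<close>.
        If the limit has no mass there, monotonicity compares with some \<open>y\<close> slightly to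
        the right, chosen off the countably many atoms; \<open>pi\<close> in the minimum keeps
        \<open>y\<close> below \<open>pi / 2\<close>.\<close>
      have "{z \<in> space L. ereal_arctan (S z) \<le> x} = {z \<in> space L. ereal_arctan (S z) = x}"
        using ereal_arctan_bounds(1) unfolding 2 by (auto intro: antisym)
      then have zero: "cdf \<nu> x = 0"
        using atom unfolding cdf_\<nu> atom_\<nu> by simp
      show ?thesis
        unfolding zero
      proof (rule tendstoI)
        fix e :: real assume e: "0 < e"
        have "\<forall>\<^sub>F y in at x. cdf \<nu> y < e"
          using cont e zero by (intro order_tendstoD(2)[of "cdf \<nu>" "cdf \<nu> x"]) (auto simp: isCont_def)
        then obtain d where d: "d > 0" "\<And>y. y \<noteq> x \<Longrightarrow> \<bar>y - x\<bar> < d \<Longrightarrow> cdf \<nu> y < e"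
          unfolding eventually_at by (auto simp: dist_real_def)
        have "uncountable {x<..<x + min d pi}"
          using d pi_gt_zero by (intro uncountable_open_interval[THEN iffD2]) auto
        then have "\<not> {x<..<x + min d pi} \<subseteq> {x. measure \<nu> {x} \<noteq> 0}"
          using countable_subset[OF _ countable_atoms[OF \<nu>]] by blast
        then obtain y where y: "x < y" "y < x + min d pi" "measure \<nu> {y} = 0"
          unfolding subset_iff mem_Collect_eq greaterThanLessThan_iff by blast
        have "(\<lambda>n. cdf (\<mu> n) y) \<longlonglongrightarrow> cdf \<nu> y"
          using y 2 by (intro inner) auto
        moreover have "cdf \<nu> y < e"
          using y by (intro d(2)) auto
        ultimately have "\<forall>\<^sub>F n in sequentially. cdf (\<mu> n) y < e"
          by (rule order_tendstoD(2))
        then show "\<forall>\<^sub>F n in sequentially. dist (cdf (\<mu> n) x) 0 < e"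
        proof eventually_elim
          case (elim n)
          have "cdf (\<mu> n) x \<le> cdf (\<mu> n) y"
            using y by (intro \<mu>.cdf_nondecreasing) simp
          moreover have "0 \<le> cdf (\<mu> n) x" by (rule \<mu>.cdf_nonneg)
          ultimately show ?case using elim by (simp add: dist_real_def)
        qed
      qed
    next
      case 3
      then show ?thesis using inner atom by blast
    next
      case 4
      then have "ereal_arctan t \<le> x" for t
        using ereal_arctan_bounds(2)[of t] by linarith
      then show ?thesis
        unfolding cdf_\<mu> cdf_\<nu> by (simp add: prob_space.prob_space M L)
    qed
  qed
  define g where "g y = f (ereal_tan y)" for y
  have g: "continuous_on UNIV g"
    unfolding g_def by (rule continuous_on_compose2[OF f(1) continuous_on_ereal_tan]) auto
  have [measurable]: "g \<in> borel_measurable borel"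
    using g by (rule borel_measurable_continuous_onI)
  obtain B where B: "\<And>y. norm (g y) \<le> B"
    using f(2) unfolding bounded_iff g_def by auto
  have "(\<lambda>n. \<integral>y. g y \<partial>\<mu> n) \<longlonglongrightarrow> (\<integral>y. g y \<partial>\<nu>)"
    using g B by (intro weak_conv_imp_integral_bdd_continuous_conv[OF \<mu> \<nu> \<open>weak_conv_m \<mu> \<nu>\<close>])
      (auto simp: continuous_on_eq_continuous_at)
  moreover have "(\<integral>y. g y \<partial>\<mu> n) = (\<integral>x. f (T n x) \<partial>M n)" for n
    unfolding \<mu>_def by (subst integral_distr) (auto simp: g_def ereal_tan_arctan)
  moreover have "(\<integral>y. g y \<partial>\<nu>) = (\<integral>z. f (S z) \<partial>L)"
    unfolding \<nu>_def by (subst integral_distr) (auto simp: g_def ereal_tan_arctan)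
  ultimately show ?thesis by simp
qed

section \<open>The maximum likelihood estimate\<close>

definition mean_pow :: "nat \<Rightarrow> real \<Rightarrow> nat \<Rightarrow> real \<Rightarrow> real" where
  "mean_pow N h p b = (\<integral>x. xbar N x ^ p \<partial>cw_measure N b h p)"

lemma mean_pow_eq:
  "mean_pow N h p b = cfg_avg N (\<lambda>t. gibbs N b h p t * t ^ p) / cfg_avg N (gibbs N b h p)"
  unfolding mean_pow_def by (rule integral_cw_measure_xbar)

lemma gibbs_change_beta: "gibbs N (b + d) h p t = gibbs N b h p t * exp (real N * d * t ^ p)"
  by (simp add: gibbs_def exp_add[symmetric] algebra_simps)

text \<open>In an exponential family a shift of the parameter is a reweighting, so means at a moving
  parameter become expectations at the fixed \<open>b\<close>.\<close>

lemma mean_pow_change_beta: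
  "mean_pow N h p (b + d) =
    (\<integral>x. exp (real N * d * xbar N x ^ p) * xbar N x ^ p \<partial>cw_measure N b h p) /
    (\<integral>x. exp (real N * d * xbar N x ^ p) \<partial>cw_measure N b h p)"
proof -
  have "cfg_avg N (gibbs N b h p) > 0" by (intro cfg_avg_pos) simp
  then show ?thesis
    using integral_cw_measure_xbar[of N b h p "\<lambda>t. exp (real N * d * t ^ p) * t ^ p"]
      integral_cw_measure_xbar[of N b h p "\<lambda>t. exp (real N * d * t ^ p)"]
    unfolding mean_pow_eq gibbs_change_beta[abs_def] by (simp add: mult.assoc)
qed

lemma cfg_avg_pos_witness:
  assumes "\<And>t. 0 \<le> f t" "x \<in> configs N" "0 < f (xbar N x)"
  shows "0 < cfg_avg N f"
  unfolding cfg_avg_def using assms by (intro divide_pos_pos sum_pos2[of _ x]) auto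

text \<open>All spins up gives \<open>1\<close>, flipping one of them gives
  \<open>(N - 2) / N\<close>. For \<open>N = 1\<close> and even \<open>p\<close> the power would be
  constant.\<close>

lemma exists_config_pow_neq:
  assumes N: "N \<ge> 2" and p: "p \<ge> 1"
  shows "\<exists>x\<in>configs N. xbar N x ^ p \<noteq> v"
proof -
  define x1 where "x1 = (\<lambda>i\<in>{..<N}. 1 :: real)"
  define x2 where "x2 = (\<lambda>i\<in>{..<N}. if i = 0 then -1 else 1 :: real)"
  have mem: "x1 \<in> configs N" "x2 \<in> configs N"
    by (auto simp: x1_def x2_def configs_def)
  have "(\<Sum>i<N. x1 i) = real N" by (simp add: x1_def)
  then have 1: "xbar N x1 = 1" using N by (simp add: xbar_def)
  obtain n where n: "N = Suc (Suc n)" using N by (metis Suc_le_D numeral_2_eq_2 Suc_le_mono)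
  have "(\<Sum>i<N. x2 i) = (\<Sum>i<N. if i = 0 then -1 else 1)"
    by (intro sum.cong) (auto simp: x2_def)
  also have "\<dots> = real n"
    unfolding n by (subst sum.lessThan_Suc_shift) simp
  finally have "xbar N x2 = real n / real N" by (simp add: xbar_def)
  then have 2: "0 \<le> xbar N x2" "xbar N x2 < 1" by (auto simp: n)
  have "xbar N x2 ^ p < 1" using 2 p by (simp add: power_less_one_iff)
  then have "xbar N x1 ^ p \<noteq> xbar N x2 ^ p" using 1 by simp
  then show ?thesis using mem by metis
qed

text \<open>Positivity of the variance in derivative-free form: with \<open>w = t ^ p - v\<close>,
  of mean \<open>0\<close> at \<open>b\<close>, the product \<open>w * (exp (N * d * w) - 1)\<close>
  is nonnegative and nonzero on some configuration.\<close>

lemma strict_mono_mean_pow: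
  assumes N: "N \<ge> 2" and p: "p \<ge> 1"
  shows "strict_mono (mean_pow N h p)"
proof (rule strict_monoI)
  fix b b' :: real assume "b < b'"
  define d where "d = b' - b"
  have d: "d > 0" "b' = b + d" using \<open>b < b'\<close> by (auto simp: d_def)
  define v where "v = mean_pow N h p b"
  define g where "g = gibbs N b h p"
  define e where "e t = exp (real N * d * (t ^ p - v))" for t
  have g0: "cfg_avg N g > 0" unfolding g_def by (intro cfg_avg_pos) simp
  have centred: "cfg_avg N (\<lambda>t. g t * (t ^ p - v)) = 0"
  proof -
    have "cfg_avg N (\<lambda>t. g t * (t ^ p - v)) = cfg_avg N (\<lambda>t. g t * t ^ p - v * g t)"
      by (simp add: algebra_simps)
    also have "\<dots> = 0"
      unfolding cfg_avg_diff cfg_avg_cmult using g0 by (simp add: v_def mean_pow_eq g_def)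
    finally show ?thesis .
  qed
  obtain x where x: "x \<in> configs N" "xbar N x ^ p \<noteq> v"
    using exists_config_pow_neq[OF N p] by blast
  have sgn: "0 < w * (exp (real N * d * w) - 1)" if "w \<noteq> 0" for w :: real
  proof (cases "w > 0")
    case True
    then show ?thesis using d N by (intro mult_pos_pos) auto
  next
    case False
    then have "w < 0" using that by simp
    then show ?thesis using d N by (intro mult_neg_neg) (auto simp: mult_pos_neg)
  qed
  have "0 < cfg_avg N (\<lambda>t. g t * ((t ^ p - v) * (e t - 1)))"
  proof (rule cfg_avg_pos_witness[OF _ x(1)])
    show "0 \<le> g t * ((t ^ p - v) * (e t - 1))" for t
      using sgn[of "t ^ p - v"] by (cases "t ^ p = v") (auto simp: e_def g_def intro!: mult_nonneg_nonneg less_imp_le)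
    show "0 < g (xbar N x) * ((xbar N x ^ p - v) * (e (xbar N x) - 1))"
      using sgn[of "xbar N x ^ p - v"] x(2) by (auto simp: e_def g_def intro!: mult_pos_pos)
  qed
  also have "(\<lambda>t. g t * ((t ^ p - v) * (e t - 1))) = (\<lambda>t. g t * ((t ^ p - v) * e t) - g t * (t ^ p - v))"
    by (simp add: algebra_simps)
  also have "cfg_avg N \<dots> = cfg_avg N (\<lambda>t. g t * e t * t ^ p - v * (g t * e t))"
    unfolding cfg_avg_diff centred by (subst cfg_avg_diff[symmetric]) (simp add: algebra_simps)
  also have "\<dots> = cfg_avg N (\<lambda>t. g t * e t * t ^ p) - v * cfg_avg N (\<lambda>t. g t * e t)"
    unfolding cfg_avg_diff cfg_avg_cmult ..
  finally have pos: "v * cfg_avg N (\<lambda>t. g t * e t) < cfg_avg N (\<lambda>t. g t * e t * t ^ p)" by simp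
  have den: "0 < cfg_avg N (\<lambda>t. g t * e t)"
    by (intro cfg_avg_pos) (auto simp: g_def e_def)
  have gb': "gibbs N b' h p t = exp (real N * d * v) * (g t * e t)" for t
    unfolding d(2) gibbs_change_beta by (simp add: g_def e_def exp_add[symmetric] algebra_simps)
  have "mean_pow N h p b' = cfg_avg N (\<lambda>t. g t * e t * t ^ p) / cfg_avg N (\<lambda>t. g t * e t)"
    unfolding mean_pow_eq gb'[abs_def] mult.assoc cfg_avg_cmult by simp
  then show "mean_pow N h p b < mean_pow N h p b'"
    using pos den by (simp add: v_def pos_less_divide_eq)
qed

lemma continuous_on_mean_pow: "continuous_on UNIV (mean_pow N h p)"
proof -
  have "cfg_avg N (\<lambda>t. exp (real N * (b * t ^ p + h * t))) \<noteq> 0" for b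
    using cfg_avg_pos[of "\<lambda>t. exp (real N * (b * t ^ p + h * t))" N] by simp
  then show ?thesis
    unfolding mean_pow_eq[abs_def] gibbs_def[abs_def] cfg_avg_def
    by (intro continuous_intros) auto
qed

text \<open>Monotonicity settles the case of a solution. Without one, the intermediate value theorem
  puts all means on one side of \<open>xbar ^ p\<close>, and the infinite default value has the
  matching sign.\<close>

lemma cw_mle_le_iff:
  assumes N: "N \<ge> 2" and p: "p \<ge> 1"
  shows "cw_mle N h p x \<le> ereal s \<longleftrightarrow> xbar N x ^ p \<le> mean_pow N h p s"
proof -
  let ?E = "mean_pow N h p" and ?t = "xbar N x ^ p"
  have mle: "cw_mle N h p x = (if \<exists>b. ?E b = ?t then ereal (THE b. ?E b = ?t)
      else if \<forall>b. ?E b < ?t then \<infinity> else - \<infinity>)"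
    unfolding cw_mle_def Let_def mean_pow_def ..
  note mono = strict_mono_mean_pow[OF N p, of h]
  show ?thesis
  proof (cases "\<exists>b. ?E b = ?t")
    case True
    then obtain b where b: "?E b = ?t" by blast
    have "(THE b. ?E b = ?t) = b"
      using b strict_mono_eq[OF mono] by (intro the_equality) (auto, metis)
    then have "cw_mle N h p x = ereal b"
      unfolding mle using True by simp
    then show ?thesis
      using strict_mono_less_eq[OF mono, of b s] b by simp
  next
    case False
    have "?E s > ?t" if above: "\<not> (\<forall>b. ?E b < ?t)"
    proof (rule ccontr)
      assume "\<not> ?t < ?E s"
      then have s: "?E s \<le> ?t" by simp
      obtain b where b: "?t \<le> ?E b" using above by (auto simp: not_less)
      then have "s \<le> b" using s strict_mono_less_eq[OF mono, of s b] by linarith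
      then have "\<exists>c\<ge>s. c \<le> b \<and> ?E c = ?t"
        using s b by (intro IVT' continuous_on_subset[OF continuous_on_mean_pow]) auto
      then show False using False by blast
    qed
    then show ?thesis
      unfolding mle using False
      by (cases "\<forall>b. ?E b < ?t") (auto simp: not_le less_imp_le)
  qed
qed

section \<open>Lower bound for the mean at supercritical parameters\<close>

lemma cfg_avg_const: "cfg_avg N (\<lambda>_. c) = c"
  using cfg_avg_cmult[of N c "\<lambda>t. exp (real N * (0 * t))"] cfg_avg_exp[of N 0] by simp

text \<open>Jensen under the Gibbs measure: since \<open>h = 0\<close>, the expectation of
  \<open>exp (- N * b * t ^ p)\<close> is \<open>1 / Z\<close>, and the tangent inequality
  \<open>1 + u <= exp u\<close> around the mean gives the bound at every \<open>N\<close>.\<close>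

lemma cw_Z_le_exp_mean_pow: "cw_Z N b 0 p \<le> exp (real N * b * mean_pow N 0 p b)"
proof -
  define g where "g = gibbs N b 0 p"
  define v where "v = mean_pow N 0 p b"
  have Z: "cfg_avg N g > 0" unfolding g_def by (intro cfg_avg_pos) simp
  have gv: "cfg_avg N (\<lambda>t. g t * t ^ p) = v * cfg_avg N g"
    using Z by (simp add: v_def mean_pow_eq g_def)
  have "exp (- (real N * b * v)) * cfg_avg N g =
      exp (- (real N * b * v)) * ((1 + real N * b * v) * cfg_avg N g - real N * b * cfg_avg N (\<lambda>t. g t * t ^ p))"
    unfolding gv by (simp add: algebra_simps)
  also have "\<dots> = cfg_avg N (\<lambda>t. exp (- (real N * b * v)) * ((1 + real N * b * v) * g t - real N * b * (g t * t ^ p)))"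
    unfolding cfg_avg_cmult cfg_avg_diff ..
  also have "\<dots> \<le> cfg_avg N (\<lambda>t. 1)"
  proof (rule cfg_avg_mono)
    fix t :: real
    have "1 + real N * b * (v - t ^ p) \<le> exp (real N * b * (v - t ^ p))"
      by (rule exp_ge_add_one_self)
    then have "g t * (1 + real N * b * (v - t ^ p)) \<le> g t * exp (real N * b * (v - t ^ p))"
      by (intro mult_left_mono) (auto simp: g_def intro: less_imp_le)
    also have "\<dots> = exp (real N * b * v)"
      by (simp add: g_def gibbs_def exp_add[symmetric] algebra_simps)
    finally have "exp (- (real N * b * v)) * (g t * (1 + real N * b * (v - t ^ p))) \<le>
        exp (- (real N * b * v)) * exp (real N * b * v)"
      by (intro mult_left_mono) auto
    then show "exp (- (real N * b * v)) * ((1 + real N * b * v) * g t - real N * b * (g t * t ^ p)) \<le> 1"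
      by (simp add: exp_minus algebra_simps)
  qed
  also have "\<dots> = 1" by (rule cfg_avg_const)
  finally show ?thesis
    by (simp add: cw_Z_eq_cfg_avg g_def v_def exp_minus field_simps)
qed

lemma jensen_exp_cw:
  fixes f :: "real \<Rightarrow> real"
  shows "exp (\<integral>x. f (xbar N x) \<partial>cw_measure N b h p) \<le> (\<integral>x. exp (f (xbar N x)) \<partial>cw_measure N b h p)"
proof -
  interpret prob_space "cw_measure N b h p" by (rule prob_space_cw_measure)
  note int = integrable_cw_measure[of N b h p]
  define v where "v = (\<integral>x. f (xbar N x) \<partial>cw_measure N b h p)"
  have "(\<integral>x. 1 + (f (xbar N x) - v) \<partial>cw_measure N b h p) = 1 + (v - v)"
    using prob_space Bochner_Integration.integral_add[OF int int, of "\<lambda>_. 1" "\<lambda>x. f (xbar N x) - v"]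
      Bochner_Integration.integral_diff[OF int int, of "\<lambda>x. f (xbar N x)" "\<lambda>_. v"]
    by (simp add: v_def)
  then have "exp v = (\<integral>x. exp v * (1 + (f (xbar N x) - v)) \<partial>cw_measure N b h p)"
    by simp
  also have "\<dots> \<le> (\<integral>x. exp (f (xbar N x)) \<partial>cw_measure N b h p)"
  proof (rule integral_mono[OF int int])
    fix x
    have "exp v * (1 + (f (xbar N x) - v)) \<le> exp v * exp (f (xbar N x) - v)"
      by (intro mult_left_mono exp_ge_add_one_self) auto
    then show "exp v * (1 + (f (xbar N x) - v)) \<le> exp (f (xbar N x))"
      by (simp add: exp_add[symmetric])
  qed
  finally show ?thesis by (simp add: v_def)
qed

text \<open>Restricting the Gibbs variational principle to product measures of mean \<open>x\<close>: the
  free energy is at least \<open>H x\<close> in the limit, and it is at most \<open>b\<close> times the mean of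
  \<open>xbar ^ p\<close> because it is convex in \<open>b\<close> and vanishes at \<open>b = 0\<close>.\<close>

lemma mean_pow_supercritical:
  assumes x: "\<bar>x\<bar> < 1" and H: "H_fun b 0 p x > 0"
  shows "\<exists>e>0. \<forall>\<^sub>F N in sequentially. e \<le> b * mean_pow N 0 p b"
proof -
  define a where "a = artanh x"
  \<comment> \<open>\<open>tilted_limit\<close> asks for a bound on the whole line; clipping
    provides it and changes nothing on configurations.\<close>
  define clip :: "real \<Rightarrow> real" where "clip t = max (-1) (min 1 t)" for t
  have clip: "\<bar>clip t\<bar> \<le> 1" for t by (auto simp: clip_def)
  \<comment> \<open>Up to normalisers, the log-density per spin of the Gibbs measure against
    independent spins of mean \<open>x\<close>.\<close>
  define f where "f t = b * t ^ p - a * t" for t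
  define F where "F N y = f (clip (x + y / sqrt (real N)))" for N y
  have Flim: "(\<lambda>N. \<integral>\<omega>. F N (ymean N x (xbar N \<omega>)) \<partial>cw_measure N 0 (artanh x) p) \<longlonglongrightarrow>
      (\<integral>z. f x \<partial>std_normal_distribution)"
  proof (rule tilted_limit[where D = "{}" and start = 0 and G = "\<lambda>_. f x", OF x])
    show "F N \<in> borel_measurable borel" for N
      unfolding F_def f_def clip_def by measurable
    show "(\<lambda>N. F N (yn N)) \<longlonglongrightarrow> f x" if "yn \<longlonglongrightarrow> y" for yn y
    proof -
      have "(\<lambda>N. yn N / sqrt (real N)) \<longlonglongrightarrow> 0"
        by (intro real_tendsto_divide_at_top[OF that] filterlim_sqrt_real_at_top)
      then have "(\<lambda>N. F N (yn N)) \<longlonglongrightarrow> f (clip (x + 0))"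
        unfolding F_def f_def clip_def by (intro tendsto_intros)
      then show ?thesis using x by (simp add: clip_def)
    qed
    show "\<bar>F N y\<bar> \<le> \<bar>b\<bar> + \<bar>a\<bar>" for N y
    proof -
      define t where "t = clip (x + y / sqrt (real N))"
      have "\<bar>F N y\<bar> \<le> \<bar>b\<bar> * \<bar>t\<bar> ^ p + \<bar>a\<bar> * \<bar>t\<bar>"
        unfolding F_def f_def t_def[symmetric] by (rule order_trans[OF abs_triangle_ineq4]) (simp add: abs_mult power_abs)
      also have "\<dots> \<le> \<bar>b\<bar> * 1 + \<bar>a\<bar> * 1"
        using clip by (intro add_mono mult_left_mono power_le_one) (auto simp: t_def)
      finally show ?thesis by simp
    qed
  qed auto
  interpret std: prob_space std_normal_distribution
    by (intro prob_space_normal_density) simp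
  have Fint: "(\<integral>\<omega>. F N (ymean N x (xbar N \<omega>)) \<partial>cw_measure N 0 a p) = (\<integral>\<omega>. f (xbar N \<omega>) \<partial>cw_measure N 0 a p)" if "N \<ge> 1" for N
  proof (intro Bochner_Integration.integral_cong refl)
    fix \<omega> assume "\<omega> \<in> space (cw_measure N 0 a p)"
    then have "\<bar>xbar N \<omega>\<bar> \<le> 1" by (intro abs_xbar_le_1) simp
    moreover have "x + ymean N x (xbar N \<omega>) / sqrt (real N) = xbar N \<omega>"
      using that by (simp add: ymean_def)
    ultimately show "F N (ymean N x (xbar N \<omega>)) = f (xbar N \<omega>)"
      by (simp add: F_def clip_def)
  qed
  have "(\<lambda>N. ln (cosh a) + (\<integral>\<omega>. F N (ymean N x (xbar N \<omega>)) \<partial>cw_measure N 0 (artanh x) p)) \<longlonglongrightarrow> ln (cosh a) + f x"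
    using Flim std.prob_space by (intro tendsto_intros) simp
  also have "ln (cosh a) + f x = H_fun b 0 p x"
    using I_fun_eq_artanh[OF x] by (simp add: H_fun_def f_def a_def)
  finally have "\<forall>\<^sub>F N in sequentially. H_fun b 0 p x / 2 <
      ln (cosh a) + (\<integral>\<omega>. F N (ymean N x (xbar N \<omega>)) \<partial>cw_measure N 0 (artanh x) p)"
    by (rule order_tendstoD) (use H in simp)
  then have "\<forall>\<^sub>F N in sequentially. H_fun b 0 p x / 2 \<le> b * mean_pow N 0 p b"
    using eventually_ge_at_top[of 1]
  proof eventually_elim
    case (elim N)
    have Z: "cfg_avg N (gibbs N 0 a p) = cosh a ^ N"
      using cfg_avg_exp[of N a] by (simp add: gibbs_def[abs_def])
    have "exp (real N * (\<integral>\<omega>. f (xbar N \<omega>) \<partial>cw_measure N 0 a p)) \<le>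
        (\<integral>\<omega>. exp (real N * f (xbar N \<omega>)) \<partial>cw_measure N 0 a p)"
      using jensen_exp_cw[where f = "\<lambda>t. real N * f t" and N = N and b = 0 and h = a and p = p] by simp
    also have "\<dots> = cfg_avg N (\<lambda>t. gibbs N 0 a p t * exp (real N * f t)) / cosh a ^ N"
      unfolding Z[symmetric] by (rule integral_cw_measure_xbar)
    also have "(\<lambda>t. gibbs N 0 a p t * exp (real N * f t)) = gibbs N b 0 p"
      by (simp add: gibbs_def[abs_def] f_def exp_add[symmetric] algebra_simps)
    also have "cfg_avg N (gibbs N b 0 p) \<le> exp (real N * b * mean_pow N 0 p b)"
      using cw_Z_le_exp_mean_pow[of N b p] by (simp add: cw_Z_eq_cfg_avg)
    finally have "exp (real N * (\<integral>\<omega>. f (xbar N \<omega>) \<partial>cw_measure N 0 a p)) \<le>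
        exp (real N * b * mean_pow N 0 p b) / cosh a ^ N"
      by (simp add: divide_right_mono)
    also have "cosh a ^ N = exp (real N * ln (cosh a))"
      by (simp add: exp_of_nat_mult)
    finally have "real N * (ln (cosh a) + (\<integral>\<omega>. f (xbar N \<omega>) \<partial>cw_measure N 0 a p)) \<le> real N * (b * mean_pow N 0 p b)"
      by (simp add: exp_diff[symmetric] algebra_simps)
    then have "ln (cosh a) + (\<integral>\<omega>. f (xbar N \<omega>) \<partial>cw_measure N 0 a p) \<le> b * mean_pow N 0 p b"
      using elim(2) by simp
    then show ?case
      using elim Fint[of N] by (simp add: a_def)
  qed
  then show ?thesis using H by (intro exI[of _ "H_fun b 0 p x / 2"]) auto
qed

section \<open>The critical inverse temperature\<close>

lemma artanh_ge: "x \<le> artanh x" if "0 \<le> x" "x < 1" for x :: real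
proof -
  have "artanh 0 - 0 \<le> artanh x - x"
  proof (rule DERIV_nonneg_imp_nondecreasing[where f = "\<lambda>y. artanh y - y"])
    fix y :: real assume y: "0 \<le> y" "y \<le> x"
    then have y1: "\<bar>y\<bar> < 1" "0 < 1 - y\<^sup>2" using that abs_square_less_1[of y] by auto
    have "((\<lambda>y. artanh y - y) has_real_derivative 1 / (1 - y\<^sup>2) - 1) (at y)"
      using y1 by (auto intro!: derivative_eq_intros)
    moreover have "0 \<le> 1 / (1 - y\<^sup>2) - 1" using y1 by (simp add: field_simps)
    ultimately show "\<exists>z. ((\<lambda>y. artanh y - y) has_real_derivative z) (at y) \<and> 0 \<le> z" by blast
  qed (use that in simp)
  then show ?thesis by simp
qed

text \<open>Integrates \<open>y <= artanh y\<close>; the endpoint is reached by continuity. This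
  quadratic bound is what makes \<open>beta_tilde\<close> positive.\<close>

lemma I_fun_ge:
  assumes "\<bar>x\<bar> \<le> 1"
  shows "x\<^sup>2 / 2 \<le> I_fun x"
proof -
  have inner: "x\<^sup>2 / 2 \<le> I_fun x" if "0 \<le> x" "x < 1" for x
  proof -
    have "I_fun 0 - 0\<^sup>2 / 2 \<le> I_fun x - x\<^sup>2 / 2"
    proof (rule DERIV_nonneg_imp_nondecreasing[where f = "\<lambda>y. I_fun y - y\<^sup>2 / 2"])
      fix y :: real assume y: "0 \<le> y" "y \<le> x"
      then have "((\<lambda>y. I_fun y - y\<^sup>2 / 2) has_real_derivative artanh y - y) (at y)"
        using that by (auto intro!: derivative_eq_intros I_fun_has_real_derivative)
      then show "\<exists>z. ((\<lambda>y. I_fun y - y\<^sup>2 / 2) has_real_derivative z) (at y) \<and> 0 \<le> z"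
        using artanh_ge[of y] y that by (intro exI[of _ "artanh y - y"] conjI) auto
    qed (use that in simp)
    then show ?thesis by simp
  qed
  have one: "1\<^sup>2 / 2 \<le> I_fun 1"
  proof -
    have "continuous_on {0..1} (\<lambda>x. I_fun x - x\<^sup>2 / 2)"
      by (intro continuous_intros continuous_on_subset[OF continuous_on_I_fun]) auto
    then have "((\<lambda>x. I_fun x - x\<^sup>2 / 2) \<longlongrightarrow> I_fun 1 - 1\<^sup>2 / 2) (at 1 within {0..1})"
      unfolding continuous_on_def by (rule bspec) simp
    then have "((\<lambda>x. I_fun x - x\<^sup>2 / 2) \<longlongrightarrow> I_fun 1 - 1\<^sup>2 / 2) (at_left 1)"
      by (simp only: at_within_Icc_at_left[OF zero_less_one])
    moreover have "\<forall>\<^sub>F x in at_left 1. 0 \<le> I_fun x - x\<^sup>2 / 2"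
      unfolding eventually_at_left_field using inner by (intro exI[of _ 0]) auto
    ultimately have "0 \<le> I_fun 1 - 1\<^sup>2 / 2"
      by (intro tendsto_lowerbound) auto
    then show ?thesis by simp
  qed
  have "x\<^sup>2 / 2 \<le> I_fun x" if "0 \<le> x" "x \<le> 1" for x
    using inner[of x] one that by (cases "x = 1") auto
  from this[of "\<bar>x\<bar>"] show ?thesis
    using assms I_fun_minus[of x] by (cases "x \<ge> 0") auto
qed

lemma I_fun_pos: "\<bar>x\<bar> \<le> 1 \<Longrightarrow> x \<noteq> 0 \<Longrightarrow> 0 < I_fun x"
  using I_fun_ge[of x] zero_less_power2[of x] by linarith

text \<open>As \<open>H\<close> vanishes at \<open>0\<close>, the supremum is never negative, so it
  is zero exactly when \<open>H\<close> has no positive value.\<close>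

lemma SUP_H_fun_eq_0_iff:
  assumes p: "p \<ge> 1"
  shows "(SUP x\<in>{-1..1}. H_fun b 0 p x) = 0 \<longleftrightarrow> (\<forall>x. \<bar>x\<bar> \<le> 1 \<longrightarrow> b * x ^ p \<le> I_fun x)"
proof -
  have bdd: "bdd_above (H_fun b 0 p ` {-1..1})"
    by (intro bounded_imp_bdd_above compact_imp_bounded compact_continuous_image continuous_on_H_fun compact_Icc)
  have H0: "H_fun b 0 p 0 = 0" using p by (simp add: H_fun_def power_0_left)
  have "0 \<le> (SUP x\<in>{-1..1}. H_fun b 0 p x)"
    by (rule cSUP_upper2[OF bdd, of 0]) (auto simp: H0)
  then have "(SUP x\<in>{-1..1}. H_fun b 0 p x) = 0 \<longleftrightarrow> (SUP x\<in>{-1..1}. H_fun b 0 p x) \<le> 0"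
    by auto
  also have "\<dots> \<longleftrightarrow> (\<forall>x\<in>{-1..1}. H_fun b 0 p x \<le> 0)"
    by (rule cSUP_le_iff[OF _ bdd]) auto
  also have "\<dots> \<longleftrightarrow> (\<forall>x. \<bar>x\<bar> \<le> 1 \<longrightarrow> b * x ^ p \<le> I_fun x)"
    by (auto simp: H_fun_def abs_le_iff)
  finally show ?thesis .
qed

definition flat_betas :: "nat \<Rightarrow> real set" where
  "flat_betas p = {b. 0 \<le> b \<and> (\<forall>x. \<bar>x\<bar> \<le> 1 \<longrightarrow> b * x ^ p \<le> I_fun x)}"

lemma beta_tilde_eq: "p \<ge> 1 \<Longrightarrow> beta_tilde p = Sup (flat_betas p)"
  by (simp add: beta_tilde_def flat_betas_def SUP_H_fun_eq_0_iff)

lemma bdd_above_flat_betas: "bdd_above (flat_betas p)"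
  by (rule bdd_aboveI[of _ "I_fun 1"]) (auto simp: flat_betas_def dest: spec[of _ 1])

lemma flat_betas_le: "p \<ge> 1 \<Longrightarrow> b \<in> flat_betas p \<Longrightarrow> b \<le> beta_tilde p"
  unfolding beta_tilde_eq by (rule cSup_upper[OF _ bdd_above_flat_betas])

lemma half_in_flat_betas:
  assumes "p \<ge> 2"
  shows "1 / 2 \<in> flat_betas p"
  unfolding flat_betas_def
proof safe
  fix x :: real assume x: "\<bar>x\<bar> \<le> 1"
  have "x ^ p \<le> \<bar>x\<bar> ^ p" by (metis abs_ge_self power_abs)
  also have "\<dots> \<le> \<bar>x\<bar> ^ 2" using x assms by (intro power_decreasing) auto
  finally show "1 / 2 * x ^ p \<le> I_fun x" using I_fun_ge[OF x] by simp
qed simp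

lemma beta_tilde_pos: "p \<ge> 2 \<Longrightarrow> 0 < beta_tilde p"
  using flat_betas_le[of p "1 / 2"] half_in_flat_betas[of p] by simp

lemma H_fun_at_0: "p \<ge> 1 \<Longrightarrow> H_fun b 0 p 0 = 0"
  by (simp add: H_fun_def power_0_left)

text \<open>Compare with an admissible \<open>c > b\<close>: strictness comes from
  \<open>c - b\<close> where \<open>x ^ p > 0\<close>, and from \<open>I_fun x > 0\<close>
  elsewhere.\<close>

lemma subcritical_nonneg:
  assumes p: "p \<ge> 2" and b: "0 \<le> b" "b < beta_tilde p" and x: "\<bar>x\<bar> \<le> 1" "x \<noteq> 0"
  shows "H_fun b 0 p x < 0"
proof -
  have "flat_betas p \<noteq> {}" using half_in_flat_betas[OF p] by auto
  then obtain c where c: "c \<in> flat_betas p" "b < c"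
    using b(2) p less_cSup_iff[OF _ bdd_above_flat_betas] by (auto simp: beta_tilde_eq)
  show ?thesis
  proof (cases "0 < x ^ p")
    case True
    then have "b * x ^ p < c * x ^ p" using c by simp
    also have "\<dots> \<le> I_fun x" using c x by (simp add: flat_betas_def)
    finally show ?thesis by (simp add: H_fun_def)
  next
    case False
    then have "b * x ^ p \<le> 0" using b by (simp add: mult_nonneg_nonpos)
    then show ?thesis using I_fun_pos[OF x] by (simp add: H_fun_def)
  qed
qed

text \<open>A negative \<open>b\<close> is harmless for even \<open>p\<close>; for odd
  \<open>p\<close> the reflection of \<open>x\<close> exchanges \<open>b\<close> and
  \<open>- b\<close>, which creates the second critical value \<open>- beta_tilde p\<close>.\<close>

lemma subcritical:
  assumes p: "p \<ge> 2" and b: "b < beta_tilde p" "even p \<or> - beta_tilde p < b" and x: "\<bar>x\<bar> \<le> 1" "x \<noteq> 0"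
  shows "H_fun b 0 p x < 0"
proof (cases "0 \<le> b")
  case True
  then show ?thesis using subcritical_nonneg assms by blast
next
  case False
  show ?thesis
  proof (cases "even p")
    case True
    then have "b * x ^ p \<le> 0" using False by (intro mult_nonpos_nonneg) (auto simp: zero_le_even_power)
    then show ?thesis using I_fun_pos[OF x] by (simp add: H_fun_def)
  next
    case odd: False
    have "H_fun (- b) 0 p (- x) < 0"
      using odd b False x by (intro subcritical_nonneg p) auto
    then show ?thesis using odd by (simp add: H_fun_def I_fun_minus)
  qed
qed

text \<open>The defining inequality may fail first at an endpoint. Shrinking that point towards
  \<open>0\<close> by continuity gives an interior one, as a tilt of mean \<open>x\<close>
  requires.\<close>

lemma supercritical_aux:
  assumes p: "p \<ge> 2" and b: "beta_tilde p < b"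
  shows "\<exists>x. \<bar>x\<bar> < 1 \<and> 0 < H_fun b 0 p x"
proof -
  have "b \<notin> flat_betas p" using flat_betas_le[of p b] b p by auto
  moreover have "b \<ge> 0" using beta_tilde_pos[OF p] b by simp
  ultimately obtain x where x: "\<bar>x\<bar> \<le> 1" "0 < H_fun b 0 p x"
    by (auto simp: flat_betas_def H_fun_def not_le)
  have "continuous_on {0..1} (\<lambda>r. H_fun b 0 p (r * x))"
  proof (rule continuous_on_compose2[OF continuous_on_H_fun])
    show "(\<lambda>r. r * x) ` {0..1} \<subseteq> {-1..1}"
    proof safe
      fix r :: real assume "r \<in> {0..1}"
      then have "\<bar>r * x\<bar> \<le> 1 * 1" unfolding abs_mult using x by (intro mult_mono) auto
      then show "r * x \<in> {-1..1}" by (auto simp: abs_le_iff)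
    qed
  qed (intro continuous_intros)
  then have "((\<lambda>r. H_fun b 0 p (r * x)) \<longlongrightarrow> H_fun b 0 p (1 * x)) (at 1 within {0..1})"
    unfolding continuous_on_def by (rule bspec) simp
  then have "((\<lambda>r. H_fun b 0 p (r * x)) \<longlongrightarrow> H_fun b 0 p (1 * x)) (at_left 1)"
    by (simp only: at_within_Icc_at_left[OF zero_less_one])
  then have "\<forall>\<^sub>F r in at_left 1. 0 < H_fun b 0 p (r * x)"
    by (rule order_tendstoD) (use x in simp)
  then obtain c where c: "c < 1" "\<And>r. c < r \<Longrightarrow> r < 1 \<Longrightarrow> 0 < H_fun b 0 p (r * x)"
    unfolding eventually_at_left_field by auto
  define r where "r = (max c 0 + 1) / 2"
  have r: "c < r" "0 \<le> r" "r < 1" using c(1) by (auto simp: r_def)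
  have "\<bar>r * x\<bar> \<le> r * 1" unfolding abs_mult using x r by (intro mult_mono) auto
  then show ?thesis using c(2)[OF r(1,3)] r by (intro exI[of _ "r * x"]) auto
qed

lemma supercritical:
  assumes p: "p \<ge> 2" and b: "beta_tilde p < b \<or> odd p \<and> b < - beta_tilde p"
  shows "\<exists>x. \<bar>x\<bar> < 1 \<and> 0 < H_fun b 0 p x"
proof (cases "beta_tilde p < b")
  case True
  then show ?thesis by (rule supercritical_aux[OF p])
next
  case False
  then have odd: "odd p" and "beta_tilde p < - b" using b by auto
  then obtain x where "\<bar>x\<bar> < 1" "0 < H_fun (- b) 0 p x"
    using supercritical_aux[OF p, of "- b"] by auto
  then show ?thesis
    using odd by (intro exI[of _ "- x"]) (simp add: H_fun_def I_fun_minus)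
qed

lemma ddH_at_0: "p \<ge> 3 \<Longrightarrow> ddH b p 0 = - 1"
  by (simp add: ddH_def power_0_left)

text \<open>If \<open>0\<close> maximises, stationarity forces \<open>h = 0\<close>, and quadratic
  decay leaves room \<open>k\<close>: as \<open>x ^ p <= x^2\<close>, even \<open>b + k\<close> is
  admissible, which makes \<open>b < beta_tilde p\<close> strict.\<close>

lemma maximizer_0_iff:
  assumes p: "p \<ge> 3" and b: "0 \<le> b" and m: "\<bar>m\<bar> < 1"
    and max: "\<And>x. \<bar>x\<bar> \<le> 1 \<Longrightarrow> x \<noteq> m \<Longrightarrow> H_fun b h p x < H_fun b h p m"
  shows "m = 0 \<longleftrightarrow> h = 0 \<and> b < beta_tilde p"
proof
  assume m0: "m = 0"
  have "dH b h p m = 0" by (rule stationary_at_max[OF m max])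
  then have h: "h = 0" using p by (simp add: dH_def m0 power_0_left)
  obtain k where k: "k > 0" "\<And>x. \<bar>x\<bar> \<le> 1 \<Longrightarrow> H_fun b h p x \<le> H_fun b h p m - k * (x - m)\<^sup>2"
    using quadratic_decay[OF m max] ddH_at_0[OF p, of b] m0 by auto
  have "b + k \<in> flat_betas p"
    unfolding flat_betas_def
  proof safe
    show "0 \<le> b + k" using b k by simp
    fix x :: real assume x: "\<bar>x\<bar> \<le> 1"
    have "x ^ p \<le> \<bar>x\<bar> ^ p" by (metis abs_ge_self power_abs)
    also have "\<dots> \<le> \<bar>x\<bar> ^ 2" using x p by (intro power_decreasing) auto
    finally have "k * x ^ p \<le> k * x\<^sup>2" using k by simp
    moreover have "b * x ^ p - I_fun x \<le> - k * x\<^sup>2"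
      using k(2)[OF x] H_fun_at_0[of p b] p unfolding h m0 by (simp add: H_fun_def power_0_left)
    ultimately show "(b + k) * x ^ p \<le> I_fun x" by (simp add: algebra_simps)
  qed
  then show "h = 0 \<and> b < beta_tilde p"
    using flat_betas_le[of p "b + k"] p k h by auto
next
  assume hb: "h = 0 \<and> b < beta_tilde p"
  show "m = 0"
  proof (rule ccontr)
    assume "m \<noteq> 0"
    then have "H_fun b 0 p m < 0"
      using hb b p m by (intro subcritical_nonneg) auto
    moreover have "H_fun b 0 p 0 < H_fun b 0 p m"
      using max[of 0] \<open>m \<noteq> 0\<close> hb by simp
    ultimately show False using H_fun_at_0[of p b] p by simp
  qed
qed

section \<open>Gaussian integrals\<close>

lemma integral_std_normal_exp: "(\<integral>z. exp (r * z) \<partial>std_normal_distribution) = exp (r\<^sup>2 / 2)"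
proof -
  have "(\<integral>z. exp (r * z) \<partial>std_normal_distribution) = (\<integral>z. exp (r\<^sup>2 / 2) * normal_density r 1 z \<partial>lborel)"
    by (subst integral_density) (auto simp: std_normal_density_times_exp)
  then show ?thesis by simp
qed

lemma integral_std_normal_exp_id:
  "(\<integral>z. exp (r * z) * z \<partial>std_normal_distribution) = exp (r\<^sup>2 / 2) * r"
proof -
  have "(\<integral>z. exp (r * z) * z \<partial>std_normal_distribution) = (\<integral>z. exp (r\<^sup>2 / 2) * (normal_density r 1 z * z) \<partial>lborel)"
    by (subst integral_density) (auto simp: std_normal_density_times_exp mult.assoc[symmetric])
  then show ?thesis by (simp add: integral_normal_moment_nz_1)
qed

lemma finite_real_power_eq:
  assumes "p \<ge> 1"
  shows "finite {z :: real. z ^ p = c}"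
proof (rule finite_subset)
  show "{z. z ^ p = c} \<subseteq> {root p \<bar>c\<bar>, - root p \<bar>c\<bar>}"
  proof
    fix z assume "z \<in> {z. z ^ p = c}"
    then have "root p \<bar>c\<bar> = \<bar>z\<bar>"
      using assms by (auto simp: power_abs real_root_power_cancel)
    then show "z \<in> {root p \<bar>c\<bar>, - root p \<bar>c\<bar>}" by auto
  qed
qed simp

lemma prob_space_std_normal: "prob_space std_normal_distribution"
  by (intro prob_space_normal_density) simp

lemma std_normal_atomless: "measure std_normal_distribution {z} = 0"
proof -
  have "AE x in std_normal_distribution. x \<notin> {z}"
    using std_normal_scaled_AE[of "{z}" 1] by simp
  then show ?thesis
    by (subst (asm) AE_iff_measurable[of "{z}"]) (auto simp: measure_def)
qed

lemma std_normal_nonpos: "measure std_normal_distribution {z. z \<le> 0} = 1 / 2"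
proof -
  interpret prob_space std_normal_distribution by (rule prob_space_std_normal)
  have eq: "prob A = (\<integral>z. std_normal_density z * indicator A z \<partial>lborel)" if [measurable]: "A \<in> sets borel" for A
  proof -
    have "prob A = (\<integral>z. indicator A z \<partial>std_normal_distribution)" by simp
    also have "\<dots> = (\<integral>z. std_normal_density z * indicator A z \<partial>lborel)"
      by (subst integral_density) auto
    finally show ?thesis .
  qed
  have "prob {z. z \<le> 0} = (\<integral>z. std_normal_density z * indicator {z. z \<le> 0} z \<partial>lborel)"
    by (rule eq) simp
  also have "\<dots> = \<bar>-1\<bar> *\<^sub>R (\<integral>z. std_normal_density (0 + (-1) * z) * indicator {z. z \<le> 0} (0 + (-1) * z) \<partial>lborel)"
    by (rule lborel_integral_real_affine) simp
  also have "\<dots> = (\<integral>z. std_normal_density z * indicator {z. 0 \<le> z} z \<partial>lborel)"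
    by (simp add: std_normal_density_def indicator_def)
  also have "\<dots> = prob {z. 0 \<le> z}"
    by (rule eq[symmetric]) simp
  finally have sym: "prob {z. z \<le> 0} = prob {z. 0 \<le> z}" .
  have "prob {z. 0 \<le> z} = prob ({0} \<union> {z. 0 < z})"
    by (rule arg_cong[where f = prob]) auto
  also have "\<dots> = prob {0} + prob {z. 0 < z}"
    by (rule finite_measure_Union) auto
  finally have "prob {z. 0 \<le> z} = prob {z. 0 < z}" by (simp add: std_normal_atomless)
  moreover have "prob {z. z \<le> 0} + prob {z. 0 < z} = prob ({z. z \<le> 0} \<union> {z. 0 < z})"
    by (rule finite_measure_Union[symmetric]) auto
  moreover have "{z. z \<le> 0} \<union> {z. 0 < z} = (UNIV :: real set)" by auto
  ultimately show ?thesis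
    using sym prob_space by simp
qed

text \<open>An interval on which \<open>z ^ p > c\<close> has positive mass. The consequence
  \<open>gamma_p p < 1\<close> makes \<open>beta_tilde p\<close> a genuine atom of the even limit
  law.\<close>

lemma std_normal_power_le_less_1:
  assumes p: "p \<ge> 1"
  shows "measure std_normal_distribution {z. z ^ p \<le> c} < 1"
proof -
  interpret prob_space std_normal_distribution by (rule prob_space_std_normal)
  define r where "r = max 1 c"
  define A where "A = {r<..<r + 1}"
  have [measurable]: "A \<in> sets borel" by (simp add: A_def)
  have A: "z ^ p > c" if "z \<in> A" for z
  proof -
    have "z \<le> z ^ p" using that p self_le_power[of z p] by (auto simp: A_def r_def)
    then show ?thesis using that by (auto simp: A_def r_def)
  qed
  have "prob A \<noteq> 0"
  proof
    assume "prob A = 0"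
    then have "AE z in std_normal_distribution. z \<notin> A"
      by (subst AE_iff_measurable[of A]) (auto simp: emeasure_eq_measure)
    then have "AE z in lborel. z \<notin> A"
      by (subst (asm) AE_density) (auto simp: normal_density_pos)
    then have "emeasure lborel A = 0"
      by (subst (asm) AE_iff_measurable[of A]) auto
    then show False by (simp add: A_def)
  qed
  then have "prob A > 0" by (simp add: zero_less_measure_iff)
  moreover have "prob {z. z ^ p \<le> c} + prob A = prob ({z. z ^ p \<le> c} \<union> A)"
    using A by (intro finite_measure_Union[symmetric]) (auto simp: not_le[symmetric])
  moreover have "prob ({z. z ^ p \<le> c} \<union> A) \<le> 1" by simp
  ultimately show ?thesis by linarith
qed

section \<open>Limits of probabilities and moments\<close>

context cw_max
begin

text \<open>The thresholds \<open>c N\<close> move with \<open>N\<close>. Off \<open>D\<close>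
  membership in the event stabilises along every convergent sequence, which is what
  \<open>laplace\<close> asks of an indicator.\<close>

lemma laplace_indicator:
  fixes W :: "nat \<Rightarrow> real \<Rightarrow> real"
  assumes W [measurable]: "\<And>N. W N \<in> borel_measurable borel"
    and A: "A \<in> sets borel" and D: "finite D"
    and ev: "\<And>y yn. y \<notin> D \<Longrightarrow> yn \<longlonglongrightarrow> y \<Longrightarrow> \<forall>\<^sub>F N in sequentially. (W N (yn N) \<le> c N) = (y \<in> A)"
  shows "(\<lambda>N. measure (cw_measure N b h p) {x \<in> configs N. W N (ymean N m (xbar N x)) \<le> c N})
    \<longlonglongrightarrow> measure std_normal_distribution {z. \<sigma> * z \<in> A}"
proof -
  have [measurable]: "A \<in> sets borel" by (rule A)
  have "(\<lambda>N. \<integral>x. indicat_real {y. W N y \<le> c N} (ymean N m (xbar N x)) \<partial>cw_measure N b h p) \<longlonglongrightarrow>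
    (\<integral>z. indicat_real A (\<sigma> * z) \<partial>std_normal_distribution)"
  proof (rule laplace[OF _ _ D, where a = 0 and C = 1 and F = "\<lambda>N. indicator {y. W N y \<le> c N}" and G = "indicator A"])
    show "(\<lambda>N. indicator {y. W N y \<le> c N} (yn N)) \<longlonglongrightarrow> (indicator A y :: real)" if "y \<notin> D" "yn \<longlonglongrightarrow> y" for y yn
      by (rule tendsto_eventually, use ev[OF that] in eventually_elim) (auto simp: indicator_def)
  qed auto
  moreover have "(\<integral>z. indicat_real A (\<sigma> * z) \<partial>std_normal_distribution) = measure std_normal_distribution {z. \<sigma> * z \<in> A}"
  proof -
    have "(\<integral>z. indicat_real A (\<sigma> * z) \<partial>std_normal_distribution) = (\<integral>z. indicat_real {z. \<sigma> * z \<in> A} z \<partial>std_normal_distribution)"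
      by (simp add: indicator_def)
    then show ?thesis by simp
  qed
  moreover have "(\<integral>x. indicat_real {y. W N y \<le> c N} (ymean N m (xbar N x)) \<partial>cw_measure N b h p) =
      measure (cw_measure N b h p) {x \<in> configs N. W N (ymean N m (xbar N x)) \<le> c N}" for N
    unfolding measure_cw_measure by (intro Bochner_Integration.integral_cong) (auto simp: indicator_def)
  ultimately show ?thesis by (simp del: integral_indicator)
qed

lemma laplace_cdf:
  fixes W :: "nat \<Rightarrow> real \<Rightarrow> real" and w :: "real \<Rightarrow> real"
  assumes W: "\<And>N. W N \<in> borel_measurable borel" and w: "w \<in> borel_measurable borel"
    and conv: "\<And>y yn. yn \<longlonglongrightarrow> y \<Longrightarrow> (\<lambda>N. W N (yn N)) \<longlonglongrightarrow> w y"
    and c: "c \<longlonglongrightarrow> c0" and D: "finite {y. w y = c0}"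
  shows "(\<lambda>N. measure (cw_measure N b h p) {x \<in> configs N. W N (ymean N m (xbar N x)) \<le> c N})
    \<longlonglongrightarrow> measure std_normal_distribution {z. w (\<sigma> * z) \<le> c0}"
proof -
  have [measurable]: "w \<in> borel_measurable borel" by (rule w)
  have "(\<lambda>N. measure (cw_measure N b h p) {x \<in> configs N. W N (ymean N m (xbar N x)) \<le> c N})
    \<longlonglongrightarrow> measure std_normal_distribution {z. \<sigma> * z \<in> {y. w y \<le> c0}}"
  proof (rule laplace_indicator[OF W _ D])
    fix y yn assume y: "y \<notin> {y. w y = c0}" "yn \<longlonglongrightarrow> y"
    have lim: "(\<lambda>N. W N (yn N) - c N) \<longlonglongrightarrow> w y - c0"
      by (intro tendsto_diff conv y c)
    show "\<forall>\<^sub>F N in sequentially. (W N (yn N) \<le> c N) = (y \<in> {y. w y \<le> c0})"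
    proof (cases "w y < c0")
      case True
      then have "\<forall>\<^sub>F N in sequentially. W N (yn N) - c N < 0"
        by (intro order_tendstoD(2)[OF lim]) simp
      then show ?thesis by eventually_elim (use True in auto)
    next
      case False
      then have "w y > c0" using y by auto
      then have "\<forall>\<^sub>F N in sequentially. W N (yn N) - c N > 0"
        by (intro order_tendstoD(1)[OF lim]) simp
      then show ?thesis by eventually_elim (use \<open>w y > c0\<close> in auto)
    qed
  qed measurable
  then show ?thesis by simp
qed

lemma laplace_cdf_at_top:
  fixes W :: "nat \<Rightarrow> real \<Rightarrow> real" and w :: "real \<Rightarrow> real"
  assumes W: "\<And>N. W N \<in> borel_measurable borel"
    and conv: "\<And>y yn. yn \<longlonglongrightarrow> y \<Longrightarrow> (\<lambda>N. W N (yn N)) \<longlonglongrightarrow> w y"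
    and c: "filterlim c at_top sequentially"
  shows "(\<lambda>N. measure (cw_measure N b h p) {x \<in> configs N. W N (ymean N m (xbar N x)) \<le> c N}) \<longlonglongrightarrow> 1"
proof -
  have "(\<lambda>N. measure (cw_measure N b h p) {x \<in> configs N. W N (ymean N m (xbar N x)) \<le> c N})
    \<longlonglongrightarrow> measure std_normal_distribution {z. \<sigma> * z \<in> UNIV}"
  proof (rule laplace_indicator[OF W, where D = "{}"])
    fix y yn assume "yn \<longlonglongrightarrow> (y :: real)"
    then have "\<forall>\<^sub>F N in sequentially. W N (yn N) < w y + 1"
      by (intro order_tendstoD(2)[OF conv]) auto
    moreover have "\<forall>\<^sub>F N in sequentially. w y + 1 \<le> c N"
      using c by (simp add: filterlim_at_top)
    ultimately show "\<forall>\<^sub>F N in sequentially. (W N (yn N) \<le> c N) = (y \<in> UNIV)"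
      by eventually_elim auto
  qed auto
  then show ?thesis
    using prob_space.prob_space[OF prob_space_std_normal] by simp
qed

lemma laplace_cdf_at_bot:
  fixes W :: "nat \<Rightarrow> real \<Rightarrow> real" and w :: "real \<Rightarrow> real"
  assumes W: "\<And>N. W N \<in> borel_measurable borel"
    and conv: "\<And>y yn. yn \<longlonglongrightarrow> y \<Longrightarrow> (\<lambda>N. W N (yn N)) \<longlonglongrightarrow> w y"
    and c: "filterlim c at_bot sequentially"
  shows "(\<lambda>N. measure (cw_measure N b h p) {x \<in> configs N. W N (ymean N m (xbar N x)) \<le> c N}) \<longlonglongrightarrow> 0"
proof -
  have "(\<lambda>N. measure (cw_measure N b h p) {x \<in> configs N. W N (ymean N m (xbar N x)) \<le> c N})
    \<longlonglongrightarrow> measure std_normal_distribution {z. \<sigma> * z \<in> {}}"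
  proof (rule laplace_indicator[OF W, where D = "{}"])
    fix y yn assume "yn \<longlonglongrightarrow> (y :: real)"
    then have "\<forall>\<^sub>F N in sequentially. w y - 1 < W N (yn N)"
      by (intro order_tendstoD(1)[OF conv]) auto
    moreover have "\<forall>\<^sub>F N in sequentially. c N \<le> w y - 1"
      using c by (simp add: filterlim_at_bot)
    ultimately show "\<forall>\<^sub>F N in sequentially. (W N (yn N) \<le> c N) = (y \<in> {})"
      by eventually_elim auto
  qed auto
  then show ?thesis by simp
qed

end

section \<open>The Gaussian regime\<close>

context cw_max
begin

definition slope :: real where
  "slope = real p * m ^ (p - 1)"

text \<open>The delta-method variable: the fluctuation of \<open>xbar ^ p\<close> on the scale
  \<open>sqrt N\<close>, as a function of \<open>Y\<close>. It behaves like
  \<open>slope * Y\<close>.\<close>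

definition pow_dev :: "nat \<Rightarrow> real \<Rightarrow> real" where
  "pow_dev N y = sqrt (real N) * ((m + y / sqrt (real N)) ^ p - m ^ p)"

lemma pow_dev_measurable [measurable]: "pow_dev N \<in> borel_measurable borel"
  unfolding pow_dev_def[abs_def] by measurable

lemma xbar_pow_eq: "N \<ge> 1 \<Longrightarrow> t ^ p = m ^ p + pow_dev N (ymean N m t) / sqrt (real N)"
  by (simp add: pow_dev_def ymean_def)

lemma pow_dev_tendsto:
  assumes "yn \<longlonglongrightarrow> y"
  shows "(\<lambda>N. pow_dev N (yn N)) \<longlonglongrightarrow> slope * y"
proof -
  obtain S where S: "continuous_on UNIV S"
    "\<And>u. (m + u) ^ p = m ^ p + real p * m ^ (p - 1) * u + u\<^sup>2 * S u"
    using power_second_order[of p m] by blast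
  have sq: "filterlim (\<lambda>N. sqrt (real N)) at_top sequentially"
    by (intro filterlim_sqrt_real_at_top)
  have u0: "(\<lambda>N. yn N / sqrt (real N)) \<longlonglongrightarrow> 0"
    by (rule real_tendsto_divide_at_top[OF assms sq])
  have "isCont S 0" using S(1) by (simp add: continuous_on_eq_continuous_at)
  then have "(\<lambda>N. S (yn N / sqrt (real N))) \<longlonglongrightarrow> S 0"
    by (rule isCont_tendsto_compose[OF _ u0])
  then have "(\<lambda>N. slope * yn N + yn N * (yn N / sqrt (real N)) * S (yn N / sqrt (real N))) \<longlonglongrightarrow> slope * y + y * 0 * S 0"
    by (intro tendsto_intros assms u0)
  moreover have "\<forall>\<^sub>F N in sequentially. slope * yn N + yn N * (yn N / sqrt (real N)) * S (yn N / sqrt (real N)) = pow_dev N (yn N)"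
    using eventually_ge_at_top[of 1]
  proof eventually_elim
    case (elim N)
    then have "sqrt (real N) > 0" by simp
    then show ?case unfolding pow_dev_def S(2) slope_def by (simp add: field_simps power2_eq_square)
  qed
  ultimately show ?thesis by (simp add: tendsto_cong)
qed

lemma pow_dev_bound:
  assumes "N \<ge> 1" "\<bar>m + y / sqrt (real N)\<bar> \<le> 1"
  shows "\<bar>pow_dev N y\<bar> \<le> real p * \<bar>y\<bar>"
proof -
  have "norm ((m + y / sqrt (real N)) ^ p - m ^ p) \<le> real p * norm ((m + y / sqrt (real N)) - m)"
    by (rule norm_power_diff) (use assms m1 in auto)
  then have "sqrt (real N) * \<bar>(m + y / sqrt (real N)) ^ p - m ^ p\<bar> \<le> sqrt (real N) * (real p * (\<bar>y\<bar> / sqrt (real N)))"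
    by (intro mult_left_mono) auto
  then show ?thesis using assms by (simp add: pow_dev_def abs_mult)
qed

text \<open>Up to a constant, the shift by \<open>s / sqrt N\<close> reweights by
  \<open>exp (s * pow_dev)\<close>. In the limit this is the Gaussian tilt
  \<open>exp (r * Z)\<close> with \<open>r = s * slope * \<sigma>\<close>, which moves the mean of
  \<open>Z\<close> to \<open>r\<close> and that of \<open>slope * \<sigma> * Z\<close> to
  \<open>(slope * \<sigma>)^2 * s\<close>.\<close>

lemma mean_pow_local:
  "(\<lambda>N. sqrt (real N) * (mean_pow N h p (b + s / sqrt (real N)) - m ^ p)) \<longlonglongrightarrow> (slope * \<sigma>)\<^sup>2 * s"
proof -
  define E where "E N F = (\<integral>x. F (ymean N m (xbar N x)) \<partial>cw_measure N b h p)" for N and F :: "real \<Rightarrow> real"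
  have exp_bound: "exp (s * pow_dev N y) \<le> exp (\<bar>s\<bar> * real p * \<bar>y\<bar>)"
    if "N \<ge> 1" "\<bar>m + y / sqrt (real N)\<bar> \<le> 1" for N y
  proof -
    have "s * pow_dev N y \<le> \<bar>s\<bar> * \<bar>pow_dev N y\<bar>" by (metis abs_ge_self abs_mult)
    also have "\<dots> \<le> \<bar>s\<bar> * (real p * \<bar>y\<bar>)" by (intro mult_left_mono pow_dev_bound that) auto
    finally show ?thesis by (simp add: mult.assoc)
  qed
  have den: "(\<lambda>N. E N (\<lambda>y. exp (s * pow_dev N y))) \<longlonglongrightarrow> (\<integral>z. exp (s * (slope * (\<sigma> * z))) \<partial>std_normal_distribution)"
    unfolding E_def
  proof (rule laplace[where D = "{}" and C = 1 and a = "\<bar>s\<bar> * real p" and F = "\<lambda>N y. exp (s * pow_dev N y)" and G = "\<lambda>y. exp (s * (slope * y))"])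
    show "(\<lambda>N. exp (s * pow_dev N (yn N))) \<longlonglongrightarrow> exp (s * (slope * y))" if "yn \<longlonglongrightarrow> y" for y yn
      by (intro tendsto_intros pow_dev_tendsto that)
    show "\<bar>exp (s * pow_dev N y)\<bar> \<le> 1 * exp (\<bar>s\<bar> * real p * \<bar>y\<bar>)" if "1 \<le> N" "\<bar>m + y / sqrt (real N)\<bar> \<le> 1" for N y
      using exp_bound[OF that] by simp
  qed auto
  have num: "(\<lambda>N. E N (\<lambda>y. exp (s * pow_dev N y) * pow_dev N y)) \<longlonglongrightarrow>
      (\<integral>z. exp (s * (slope * (\<sigma> * z))) * (slope * (\<sigma> * z)) \<partial>std_normal_distribution)"
    unfolding E_def
  proof (rule laplace[where D = "{}" and C = 1 and a = "(\<bar>s\<bar> + 1) * real p" and F = "\<lambda>N y. exp (s * pow_dev N y) * pow_dev N y"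
        and G = "\<lambda>y. exp (s * (slope * y)) * (slope * y)"])
    show "(\<lambda>N. exp (s * pow_dev N (yn N)) * pow_dev N (yn N)) \<longlonglongrightarrow> exp (s * (slope * y)) * (slope * y)" if "yn \<longlonglongrightarrow> y" for y yn
      by (intro tendsto_mult[OF tendsto_exp] tendsto_mult[OF tendsto_const] pow_dev_tendsto that)
    show "\<bar>exp (s * pow_dev N y) * pow_dev N y\<bar> \<le> 1 * exp ((\<bar>s\<bar> + 1) * real p * \<bar>y\<bar>)"
      if N: "1 \<le> N" "\<bar>m + y / sqrt (real N)\<bar> \<le> 1" for N y
    proof -
      have "real p * \<bar>y\<bar> \<le> exp (real p * \<bar>y\<bar>)"
        using exp_ge_add_one_self[of "real p * \<bar>y\<bar>"] by linarith
      then have "\<bar>pow_dev N y\<bar> \<le> exp (real p * \<bar>y\<bar>)"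
        using pow_dev_bound[OF N] by linarith
      then have "exp (s * pow_dev N y) * \<bar>pow_dev N y\<bar> \<le> exp (\<bar>s\<bar> * real p * \<bar>y\<bar>) * exp (real p * \<bar>y\<bar>)"
        using exp_bound[OF N] by (intro mult_mono) auto
      then show ?thesis by (simp add: abs_mult exp_add[symmetric] algebra_simps)
    qed
  qed auto
  define r where "r = s * slope * \<sigma>"
  have den': "(\<integral>z. exp (s * (slope * (\<sigma> * z))) \<partial>std_normal_distribution) = exp (r\<^sup>2 / 2)"
    using integral_std_normal_exp[of r] by (simp add: r_def mult_ac)
  have num': "(\<integral>z. exp (s * (slope * (\<sigma> * z))) * (slope * (\<sigma> * z)) \<partial>std_normal_distribution) = slope * \<sigma> * (exp (r\<^sup>2 / 2) * r)"
  proof -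
    have "(\<integral>z. exp (s * (slope * (\<sigma> * z))) * (slope * (\<sigma> * z)) \<partial>std_normal_distribution) =
        (\<integral>z. (slope * \<sigma>) * (exp (r * z) * z) \<partial>std_normal_distribution)"
      by (simp add: r_def mult_ac)
    also have "\<dots> = slope * \<sigma> * (\<integral>z. exp (r * z) * z \<partial>std_normal_distribution)"
      by (rule integral_mult_right_zero)
    finally show ?thesis by (simp only: integral_std_normal_exp_id)
  qed
  have "(\<lambda>N. E N (\<lambda>y. exp (s * pow_dev N y) * pow_dev N y) / E N (\<lambda>y. exp (s * pow_dev N y))) \<longlonglongrightarrow>
      slope * \<sigma> * (exp (r\<^sup>2 / 2) * r) / exp (r\<^sup>2 / 2)"
    using tendsto_divide[OF num den] unfolding den' num' by simp
  also have "slope * \<sigma> * (exp (r\<^sup>2 / 2) * r) / exp (r\<^sup>2 / 2) = (slope * \<sigma>)\<^sup>2 * s"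
    by (simp add: r_def power2_eq_square)
  finally have lim: "(\<lambda>N. E N (\<lambda>y. exp (s * pow_dev N y) * pow_dev N y) / E N (\<lambda>y. exp (s * pow_dev N y))) \<longlonglongrightarrow>
      (slope * \<sigma>)\<^sup>2 * s" .
  have "\<forall>\<^sub>F N in sequentially. E N (\<lambda>y. exp (s * pow_dev N y) * pow_dev N y) / E N (\<lambda>y. exp (s * pow_dev N y)) =
      sqrt (real N) * (mean_pow N h p (b + s / sqrt (real N)) - m ^ p)"
    using eventually_ge_at_top[of 1]
  proof eventually_elim
    case (elim N)
    \<comment> \<open>The part of the reweighting due to \<open>m ^ p\<close>; it cancels between
      numerator and denominator.\<close>
    define k where "k = exp (s * sqrt (real N) * m ^ p)"
    have rt: "sqrt (real N) > 0" "real N / sqrt (real N) = sqrt (real N)"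
      using elim by (auto simp: real_div_sqrt)
    have e: "exp (real N * (s / sqrt (real N)) * t ^ p) = k * exp (s * pow_dev N (ymean N m t))" for t
    proof -
      have "real N * (s / sqrt (real N)) * t ^ p = s * sqrt (real N) * t ^ p"
        using rt(2) by (metis mult.commute times_divide_eq_right)
      also have "\<dots> = s * sqrt (real N) * m ^ p + s * pow_dev N (ymean N m t)"
        unfolding xbar_pow_eq[OF elim, of t] using rt(1) by (simp add: algebra_simps)
      finally show ?thesis by (simp add: k_def exp_add)
    qed
    have pos: "E N (\<lambda>y. exp (s * pow_dev N y)) > 0"
      unfolding E_def integral_cw_measure_xbar[where F = "\<lambda>t. exp (s * pow_dev N (ymean N m t))"]
      by (intro divide_pos_pos cfg_avg_pos mult_pos_pos) auto
    have "mean_pow N h p (b + s / sqrt (real N)) =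
        (\<integral>x. k * exp (s * pow_dev N (ymean N m (xbar N x))) * xbar N x ^ p \<partial>cw_measure N b h p) /
        (\<integral>x. k * exp (s * pow_dev N (ymean N m (xbar N x))) \<partial>cw_measure N b h p)"
      unfolding mean_pow_change_beta e ..
    also have "(\<integral>x. k * exp (s * pow_dev N (ymean N m (xbar N x))) \<partial>cw_measure N b h p) = k * E N (\<lambda>y. exp (s * pow_dev N y))"
      by (simp add: E_def)
    also have "(\<integral>x. k * exp (s * pow_dev N (ymean N m (xbar N x))) * xbar N x ^ p \<partial>cw_measure N b h p) =
        (\<integral>x. k * m ^ p * exp (s * pow_dev N (ymean N m (xbar N x))) +
          k / sqrt (real N) * (exp (s * pow_dev N (ymean N m (xbar N x))) * pow_dev N (ymean N m (xbar N x))) \<partial>cw_measure N b h p)"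
      by (intro Bochner_Integration.integral_cong refl)
        (subst xbar_pow_eq[OF elim], simp add: algebra_simps)
    also have "\<dots> = k * m ^ p * E N (\<lambda>y. exp (s * pow_dev N y)) + k / sqrt (real N) * E N (\<lambda>y. exp (s * pow_dev N y) * pow_dev N y)"
      by (subst Bochner_Integration.integral_add[OF integrable_cw_measure integrable_cw_measure]) (simp add: E_def)
    finally have mean: "mean_pow N h p (b + s / sqrt (real N)) =
        (k * m ^ p * E N (\<lambda>y. exp (s * pow_dev N y)) + k / sqrt (real N) * E N (\<lambda>y. exp (s * pow_dev N y) * pow_dev N y)) /
        (k * E N (\<lambda>y. exp (s * pow_dev N y)))" .
    have alg: "B / A = c * ((k * v * A + k / c * B) / (k * A) - v)" if "A > 0" "c > 0" for A B c v :: real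
      using that by (simp add: k_def field_simps)
    show ?case
      unfolding mean by (rule alg[OF pos rt(1)])
  qed
  then show ?thesis using lim by (simp add: tendsto_cong)
qed

end

lemma ereal_scaled_diff_le_iff:
  assumes "c > 0"
  shows "ereal c * (t - ereal b) \<le> ereal s \<longleftrightarrow> t \<le> ereal (b + s / c)"
  using assms by (cases t) (auto simp: field_simps)

lemma normal_density_rescale:
  assumes "c \<noteq> 0"
  shows "\<bar>c\<bar> * normal_density 0 \<bar>c\<bar> (c * z) = std_normal_density z"
  using assms by (simp add: normal_density_def power_mult_distrib real_sqrt_mult)

lemma integral_scaled_std_normal:
  fixes f :: "real \<Rightarrow> real"
  assumes c: "c \<noteq> 0" and f [measurable]: "f \<in> borel_measurable borel"
  shows "(\<integral>z. f (c * z) \<partial>std_normal_distribution) = (\<integral>w. f w \<partial>density lborel (normal_density 0 \<bar>c\<bar>))"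
proof -
  have "(\<integral>w. f w \<partial>density lborel (normal_density 0 \<bar>c\<bar>)) = (\<integral>w. normal_density 0 \<bar>c\<bar> w * f w \<partial>lborel)"
    by (subst integral_density) auto
  also have "\<dots> = \<bar>c\<bar> *\<^sub>R (\<integral>z. normal_density 0 \<bar>c\<bar> (0 + c * z) * f (0 + c * z) \<partial>lborel)"
    by (rule lborel_integral_real_affine[OF c])
  also have "\<dots> = (\<integral>z. std_normal_density z * f (c * z) \<partial>lborel)"
    unfolding normal_density_rescale[OF c, symmetric] by (simp add: mult.assoc)
  also have "\<dots> = (\<integral>z. f (c * z) \<partial>std_normal_distribution)"
    by (subst integral_density) auto
  finally show ?thesis ..
qed

context cw_max
begin

text \<open>The limiting event is \<open>slope * \<sigma> * Z <= (slope * \<sigma>)^2 * s\<close>,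
  that is \<open>Z / (slope * \<sigma>) <= s\<close>. The absolute value is there because
  \<open>slope\<close> may be negative.\<close>

theorem mle_gaussian_limit:
  assumes m0: "m \<noteq> 0"
  shows "weak_conv_ereal
    (\<lambda>N. distr (cw_measure N b h p) borel (\<lambda>x. ereal (sqrt (real N)) * (cw_mle N h p x - ereal b)))
    (distr (density lborel (normal_density 0 \<bar>1 / (slope * \<sigma>)\<bar>)) borel ereal)"
  unfolding weak_conv_ereal_def
proof (intro allI impI)
  fix f :: "ereal \<Rightarrow> real" assume f: "continuous_on UNIV f" "bounded (range f)"
  have [measurable]: "f \<in> borel_measurable borel"
    using f(1) by (rule borel_measurable_continuous_onI)
  define c where "c = 1 / (slope * \<sigma>)"
  have sl: "slope \<noteq> 0" using m0 p2 by (simp add: slope_def)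
  have c: "c \<noteq> 0" using sl \<sigma>_pos by (simp add: c_def)
  have lim: "(\<lambda>N. \<integral>x. f (ereal (sqrt (real N)) * (cw_mle N h p x - ereal b)) \<partial>cw_measure N b h p) \<longlonglongrightarrow>
      (\<integral>z. f (ereal (c * z)) \<partial>std_normal_distribution)"
  proof (rule ereal_weak_convI[OF prob_space_cw_measure _ prob_space_std_normal _ _ f])
    fix s :: real
    have "(\<lambda>N. measure (cw_measure N b h p) {x \<in> configs N. pow_dev N (ymean N m (xbar N x)) \<le>
        sqrt (real N) * (mean_pow N h p (b + s / sqrt (real N)) - m ^ p)}) \<longlonglongrightarrow>
      measure std_normal_distribution {z. slope * (\<sigma> * z) \<le> (slope * \<sigma>)\<^sup>2 * s}"
    proof (rule laplace_cdf[OF _ _ pow_dev_tendsto mean_pow_local])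
      have "{y. slope * y = (slope * \<sigma>)\<^sup>2 * s} \<subseteq> {(slope * \<sigma>)\<^sup>2 * s / slope}"
        using sl by (auto simp: field_simps)
      then show "finite {y. slope * y = (slope * \<sigma>)\<^sup>2 * s}"
        by (rule finite_subset) simp
    qed auto
    also have "{z. slope * (\<sigma> * z) \<le> (slope * \<sigma>)\<^sup>2 * s} = {z \<in> space std_normal_distribution. ereal (c * z) \<le> ereal s}"
    proof -
      have "slope * (\<sigma> * z) \<le> (slope * \<sigma>)\<^sup>2 * s \<longleftrightarrow> c * z \<le> s" for z
      proof -
        have pos: "(slope * \<sigma>)\<^sup>2 > 0" using sl \<sigma>_pos by simp
        have "slope * (\<sigma> * z) = (slope * \<sigma>)\<^sup>2 * (c * z)"
          using sl \<sigma>_pos by (simp add: c_def power2_eq_square)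
        then show ?thesis by (simp only: mult_le_cancel_left_pos[OF pos])
      qed
      then show ?thesis by simp
    qed
    finally have "(\<lambda>N. measure (cw_measure N b h p) {x \<in> configs N. pow_dev N (ymean N m (xbar N x)) \<le>
        sqrt (real N) * (mean_pow N h p (b + s / sqrt (real N)) - m ^ p)}) \<longlonglongrightarrow>
      measure std_normal_distribution {z \<in> space std_normal_distribution. ereal (c * z) \<le> ereal s}" .
    moreover have "\<forall>\<^sub>F N in sequentially.
      measure (cw_measure N b h p) {x \<in> configs N. pow_dev N (ymean N m (xbar N x)) \<le>
        sqrt (real N) * (mean_pow N h p (b + s / sqrt (real N)) - m ^ p)} =
      measure (cw_measure N b h p) {x \<in> space (cw_measure N b h p).
        ereal (sqrt (real N)) * (cw_mle N h p x - ereal b) \<le> ereal s}"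
      using eventually_ge_at_top[of 2]
    proof eventually_elim
      case (elim N)
      then have N: "N \<ge> 1" and rt: "sqrt (real N) > 0" by auto
      have "ereal (sqrt (real N)) * (cw_mle N h p x - ereal b) \<le> ereal s \<longleftrightarrow>
          pow_dev N (ymean N m (xbar N x)) \<le> sqrt (real N) * (mean_pow N h p (b + s / sqrt (real N)) - m ^ p)" for x
      proof -
        have "ereal (sqrt (real N)) * (cw_mle N h p x - ereal b) \<le> ereal s \<longleftrightarrow>
            xbar N x ^ p \<le> mean_pow N h p (b + s / sqrt (real N))"
          unfolding ereal_scaled_diff_le_iff[OF rt] using elim p2 by (intro cw_mle_le_iff) auto
        also have "\<dots> \<longleftrightarrow> pow_dev N (ymean N m (xbar N x)) \<le> sqrt (real N) * (mean_pow N h p (b + s / sqrt (real N)) - m ^ p)"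
          unfolding xbar_pow_eq[OF N, of "xbar N x"] using rt by (simp add: field_simps)
        finally show ?thesis .
      qed
      then show ?case by simp
    qed
    ultimately show "(\<lambda>N. measure (cw_measure N b h p) {x \<in> space (cw_measure N b h p).
        ereal (sqrt (real N)) * (cw_mle N h p x - ereal b) \<le> ereal s}) \<longlonglongrightarrow>
      measure std_normal_distribution {z \<in> space std_normal_distribution. ereal (c * z) \<le> ereal s}"
      by (rule Lim_transform_eventually)
  qed auto
  have "(\<integral>z. f (ereal (c * z)) \<partial>std_normal_distribution) =
      (\<integral>w. f (ereal w) \<partial>density lborel (normal_density 0 \<bar>c\<bar>))"
    by (rule integral_scaled_std_normal[OF c, where f = "\<lambda>w. f (ereal w)"]) measurable
  then show "(\<lambda>N. \<integral>x. f x \<partial>distr (cw_measure N b h p) borel (\<lambda>x. ereal (sqrt (real N)) * (cw_mle N h p x - ereal b))) \<longlonglongrightarrow>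
      (\<integral>x. f x \<partial>distr (density lborel (normal_density 0 \<bar>1 / (slope * \<sigma>)\<bar>)) borel ereal)"
    using lim by (simp add: integral_distr c_def)
qed

end

section \<open>The degenerate regime\<close>

text \<open>For \<open>p >= 3\<close> the coupling leaves the curvature at \<open>0\<close> equal to
  \<open>- 1\<close>, so all subcritical parameters, negative ones included, share the standard
  Gaussian limit.\<close>

lemma cw_max_zero:
  assumes p: "p \<ge> 3" and b: "b < beta_tilde p" "even p \<or> - beta_tilde p < b"
  shows "cw_max p b 0 0"
proof
  show "H_fun b 0 p x < H_fun b 0 p 0" if "\<bar>x\<bar> \<le> 1" "x \<noteq> 0" for x
    using subcritical[OF _ b that] H_fun_at_0[of p b] p by simp
qed (use p ddH_at_0[OF p, of b] in auto)

lemma sigma_zero: "p \<ge> 3 \<Longrightarrow> cw_max.\<sigma> p b 0 = 1" if "cw_max p b 0 0"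
  using that by (simp add: cw_max.\<sigma>_def ddH_at_0)

text \<open>Later applied with the candidate value \<open>s\<close> of the estimate in the role of
  \<open>b\<close>; the limit is the same for all of them.\<close>

lemma scaled_mean_pow_limit:
  assumes p: "p \<ge> 3" and b: "b < beta_tilde p" "even p \<or> - beta_tilde p < b"
  shows "(\<lambda>N. sqrt (real N) ^ p * mean_pow N 0 p b) \<longlonglongrightarrow> (\<integral>z. z ^ p \<partial>std_normal_distribution)"
proof -
  interpret cw_max p b 0 0 by (rule cw_max_zero[OF p b])
  have "(\<lambda>N. \<integral>x. ymean N 0 (xbar N x) ^ p \<partial>cw_measure N b 0 p) \<longlonglongrightarrow> (\<integral>z. (\<sigma> * z) ^ p \<partial>std_normal_distribution)"
  proof (rule laplace[where D = "{}" and a = "real p" and C = 1 and F = "\<lambda>N y. y ^ p" and G = "\<lambda>y. y ^ p"])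
    fix y :: real
    have "\<bar>y\<bar> \<le> exp \<bar>y\<bar>" using exp_ge_add_one_self[of "\<bar>y\<bar>"] by linarith
    then have "\<bar>y\<bar> ^ p \<le> exp \<bar>y\<bar> ^ p" by (intro power_mono) auto
    then show "\<bar>y ^ p\<bar> \<le> 1 * exp (real p * \<bar>y\<bar>)"
      by (simp add: power_abs exp_of_nat_mult)
  qed (auto intro: tendsto_power)
  then show ?thesis
    using sigma_zero[OF cw_max_axioms p] by (simp add: ymean_def power_mult_distrib mean_pow_def)
qed

lemma mle_event_eq:
  assumes N: "N \<ge> 2" and p: "p \<ge> 1"
  shows "{x \<in> configs N. cw_mle N 0 p x \<le> ereal s} =
    {x \<in> configs N. ymean N 0 (xbar N x) ^ p \<le> sqrt (real N) ^ p * mean_pow N 0 p s}"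
  using N by (simp add: cw_mle_le_iff[OF N p] ymean_def power_mult_distrib)

text \<open>In the limit neither the law of \<open>Y\<close> nor the threshold depends on
  \<open>s\<close>, so the cdf becomes constant: no mass stays inside the subcritical range.\<close>

lemma mle_cdf_subcritical:
  assumes p: "p \<ge> 3" and b: "b < beta_tilde p" "even p \<or> - beta_tilde p < b"
    and s: "s < beta_tilde p" "even p \<or> - beta_tilde p < s"
  shows "(\<lambda>N. measure (cw_measure N b 0 p) {x \<in> configs N. cw_mle N 0 p x \<le> ereal s}) \<longlonglongrightarrow>
    measure std_normal_distribution {z. z ^ p \<le> (\<integral>z. z ^ p \<partial>std_normal_distribution)}"
proof -
  interpret cw_max p b 0 0 by (rule cw_max_zero[OF p b])
  have "(\<lambda>N. measure (cw_measure N b 0 p) {x \<in> configs N. ymean N 0 (xbar N x) ^ p \<le> sqrt (real N) ^ p * mean_pow N 0 p s}) \<longlonglongrightarrow>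
    measure std_normal_distribution {z. (\<sigma> * z) ^ p \<le> (\<integral>z. z ^ p \<partial>std_normal_distribution)}"
    using p by (intro laplace_cdf[where W = "\<lambda>N y. y ^ p"] scaled_mean_pow_limit s finite_real_power_eq)
      (auto intro: tendsto_power)
  moreover have "\<forall>\<^sub>F N in sequentially.
    measure (cw_measure N b 0 p) {x \<in> configs N. ymean N 0 (xbar N x) ^ p \<le> sqrt (real N) ^ p * mean_pow N 0 p s} =
    measure (cw_measure N b 0 p) {x \<in> configs N. cw_mle N 0 p x \<le> ereal s}"
    using eventually_ge_at_top[of 2] by eventually_elim (use p in \<open>simp add: mle_event_eq\<close>)
  ultimately show ?thesis
    using sigma_zero[OF cw_max_axioms p] by (simp add: Lim_transform_eventually)
qed

lemma sqrt_power_at_top: "p \<ge> 1 \<Longrightarrow> filterlim (\<lambda>N. sqrt (real N) ^ p) at_top sequentially"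
  by (intro filterlim_pow_at_top filterlim_sqrt_real_at_top) auto

text \<open>Data drawn at \<open>b\<close> have \<open>xbar ^ p\<close> of order
  \<open>N powr (- p / 2)\<close>, while the mean at \<open>s\<close> stays above
  \<open>e / s\<close>; the rescaled threshold diverges.\<close>

lemma mle_cdf_supercritical:
  assumes p: "p \<ge> 3" and b: "b < beta_tilde p" "even p \<or> - beta_tilde p < b"
    and s: "beta_tilde p < s"
  shows "(\<lambda>N. measure (cw_measure N b 0 p) {x \<in> configs N. cw_mle N 0 p x \<le> ereal s}) \<longlonglongrightarrow> 1"
proof -
  interpret cw_max p b 0 0 by (rule cw_max_zero[OF p b])
  have s0: "s > 0" using beta_tilde_pos[of p] p s by simp
  obtain x where "\<bar>x\<bar> < 1" "0 < H_fun s 0 p x"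
    using supercritical[of p s] p s by auto
  then obtain e where e: "e > 0" "\<forall>\<^sub>F N in sequentially. e \<le> s * mean_pow N 0 p s"
    using mean_pow_supercritical by blast
  have "filterlim (\<lambda>N. e / s * sqrt (real N) ^ p) at_top sequentially"
    using p e s0 by (intro filterlim_tendsto_pos_mult_at_top[OF tendsto_const] sqrt_power_at_top) auto
  moreover have "\<forall>\<^sub>F N in sequentially. e / s * sqrt (real N) ^ p \<le> sqrt (real N) ^ p * mean_pow N 0 p s"
    using e(2)
  proof eventually_elim
    case (elim N)
    then have "e / s \<le> mean_pow N 0 p s" using s0 by (simp add: field_simps)
    then have "e / s * sqrt (real N) ^ p \<le> mean_pow N 0 p s * sqrt (real N) ^ p"
      by (intro mult_right_mono) auto
    then show ?case by (simp add: mult.commute)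
  qed
  ultimately have "filterlim (\<lambda>N. sqrt (real N) ^ p * mean_pow N 0 p s) at_top sequentially"
    by (rule filterlim_at_top_mono)
  then have "(\<lambda>N. measure (cw_measure N b 0 p) {x \<in> configs N. ymean N 0 (xbar N x) ^ p \<le> sqrt (real N) ^ p * mean_pow N 0 p s}) \<longlonglongrightarrow> 1"
    by (intro laplace_cdf_at_top[where W = "\<lambda>N y. y ^ p" and w = "\<lambda>y. y ^ p"]) (auto intro: tendsto_power)
  moreover have "\<forall>\<^sub>F N in sequentially.
    measure (cw_measure N b 0 p) {x \<in> configs N. ymean N 0 (xbar N x) ^ p \<le> sqrt (real N) ^ p * mean_pow N 0 p s} =
    measure (cw_measure N b 0 p) {x \<in> configs N. cw_mle N 0 p x \<le> ereal s}"
    using eventually_ge_at_top[of 2] by eventually_elim (use p in \<open>simp add: mle_event_eq\<close>)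
  ultimately show ?thesis by (rule Lim_transform_eventually)
qed

text \<open>The mirror case: for negative \<open>s\<close> the mean stays below
  \<open>e / s < 0\<close>, so the rescaled threshold tends to \<open>- \<infinity>\<close>.\<close>

lemma mle_cdf_below:
  assumes p: "p \<ge> 3" and b: "b < beta_tilde p" "- beta_tilde p < b"
    and odd: "odd p" and s: "s < - beta_tilde p"
  shows "(\<lambda>N. measure (cw_measure N b 0 p) {x \<in> configs N. cw_mle N 0 p x \<le> ereal s}) \<longlonglongrightarrow> 0"
proof -
  interpret cw_max p b 0 0 using b by (intro cw_max_zero[OF p]) auto
  have s0: "s < 0" using beta_tilde_pos[of p] p s by simp
  obtain x where "\<bar>x\<bar> < 1" "0 < H_fun s 0 p x"
    using supercritical[of p s] p s odd by auto
  then obtain e where e: "e > 0" "\<forall>\<^sub>F N in sequentially. e \<le> s * mean_pow N 0 p s"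
    using mean_pow_supercritical by blast
  have "filterlim (\<lambda>N. e / - s * sqrt (real N) ^ p) at_top sequentially"
    using p e s0 by (intro filterlim_tendsto_pos_mult_at_top[OF tendsto_const] sqrt_power_at_top) (auto intro: divide_pos_neg)
  moreover have "\<forall>\<^sub>F N in sequentially. e / - s * sqrt (real N) ^ p \<le> - (sqrt (real N) ^ p * mean_pow N 0 p s)"
    using e(2)
  proof eventually_elim
    case (elim N)
    then have "e / - s \<le> - mean_pow N 0 p s" using s0 by (simp add: field_simps)
    then have "e / - s * sqrt (real N) ^ p \<le> - mean_pow N 0 p s * sqrt (real N) ^ p"
      by (intro mult_right_mono) auto
    then show ?case by (simp add: mult.commute)
  qed
  ultimately have "filterlim (\<lambda>N. - (sqrt (real N) ^ p * mean_pow N 0 p s)) at_top sequentially"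
    by (rule filterlim_at_top_mono)
  then have "filterlim (\<lambda>N. sqrt (real N) ^ p * mean_pow N 0 p s) at_bot sequentially"
    by (simp add: filterlim_uminus_at_bot)
  then have "(\<lambda>N. measure (cw_measure N b 0 p) {x \<in> configs N. ymean N 0 (xbar N x) ^ p \<le> sqrt (real N) ^ p * mean_pow N 0 p s}) \<longlonglongrightarrow> 0"
    by (intro laplace_cdf_at_bot[where W = "\<lambda>N y. y ^ p" and w = "\<lambda>y. y ^ p"]) (auto intro: tendsto_power)
  moreover have "\<forall>\<^sub>F N in sequentially.
    measure (cw_measure N b 0 p) {x \<in> configs N. ymean N 0 (xbar N x) ^ p \<le> sqrt (real N) ^ p * mean_pow N 0 p s} =
    measure (cw_measure N b 0 p) {x \<in> configs N. cw_mle N 0 p x \<le> ereal s}"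
    using eventually_ge_at_top[of 2] by eventually_elim (use p in \<open>simp add: mle_event_eq\<close>)
  ultimately show ?thesis by (rule Lim_transform_eventually)
qed

section \<open>Two-point limit laws\<close>

lemma two_point_cdf:
  assumes q: "0 \<le> q" "q \<le> 1"
  shows "measure (measure_pmf (map_pmf g (bernoulli_pmf q))) {t. P t} =
    (if P (g True) then q else 0) + (if P (g False) then 1 - q else 0)"
proof -
  have "measure (measure_pmf (map_pmf g (bernoulli_pmf q))) {t. P t} = measure (measure_pmf (bernoulli_pmf q)) {c. P (g c)}"
    by (simp add: vimage_def)
  also have "\<dots> = (\<Sum>c\<in>{c. P (g c)}. pmf (bernoulli_pmf q) c)"
    by (rule measure_measure_pmf_finite) simp
  also have "\<dots> = (\<Sum>c\<in>UNIV. if P (g c) then pmf (bernoulli_pmf q) c else 0)"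
    by (rule sum.mono_neutral_cong_left) auto
  also have "\<dots> = (if P (g True) then q else 0) + (if P (g False) then 1 - q else 0)"
    using q by (simp add: UNIV_bool)
  finally show ?thesis .
qed

lemma mle_weak_conv_pmf:
  assumes conv: "\<And>s. measure (measure_pmf L) {t. t = ereal s} = 0 \<Longrightarrow>
    (\<lambda>N. measure (cw_measure N b h p) {x \<in> configs N. cw_mle N h p x \<le> ereal s}) \<longlonglongrightarrow>
      measure (measure_pmf L) {t. t \<le> ereal s}"
  shows "weak_conv_ereal (\<lambda>N. distr (cw_measure N b h p) borel (cw_mle N h p)) (measure_pmf L)"
  unfolding weak_conv_ereal_def
proof (intro allI impI)
  fix f :: "ereal \<Rightarrow> real" assume f: "continuous_on UNIV f" "bounded (range f)"
  have [measurable]: "f \<in> borel_measurable borel"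
    using f(1) by (rule borel_measurable_continuous_onI)
  have "(\<lambda>N. \<integral>x. f (cw_mle N h p x) \<partial>cw_measure N b h p) \<longlonglongrightarrow> (\<integral>t. f t \<partial>measure_pmf L)"
    using conv by (intro ereal_weak_convI[OF prob_space_cw_measure _ measure_pmf.prob_space_axioms _ _ f]) auto
  then show "(\<lambda>N. \<integral>x. f x \<partial>distr (cw_measure N b h p) borel (cw_mle N h p)) \<longlonglongrightarrow> (\<integral>t. f t \<partial>measure_pmf L)"
    by (simp add: integral_distr)
qed

text \<open>For odd \<open>p\<close> the Gaussian moment is \<open>0\<close> and
  \<open>z ^ p <= 0\<close> means \<open>z <= 0\<close>, so the limiting cdf is \<open>0\<close>,
  \<open>1/2\<close> and \<open>1\<close> on the three intervals cut out by the atoms.\<close>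

theorem mle_limit_odd:
  assumes p: "p \<ge> 3" "odd p" and b: "0 \<le> b" "b < beta_tilde p"
  shows "weak_conv_ereal (\<lambda>N. distr (cw_measure N b 0 p) borel (cw_mle N 0 p))
    (measure_pmf (map_pmf (\<lambda>c. if c then ereal (beta_tilde p) else ereal (- beta_tilde p)) (bernoulli_pmf (1/2))))"
proof (rule mle_weak_conv_pmf)
  define B where "B = beta_tilde p"
  have B: "B > 0" using beta_tilde_pos[of p] p by (simp add: B_def)
  fix s
  let ?L = "measure_pmf (map_pmf (\<lambda>c. if c then ereal (beta_tilde p) else ereal (- beta_tilde p)) (bernoulli_pmf (1/2)))"
  assume "measure ?L {t. t = ereal s} = 0"
  then have s: "s \<noteq> B" "s \<noteq> - B"
    by (subst (asm) two_point_cdf; auto simp: B_def split: if_splits)+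
  have L: "measure ?L {t. t \<le> ereal s} = (if B \<le> s then 1/2 else 0) + (if - B \<le> s then 1/2 else 0)"
    by (subst two_point_cdf) (auto simp: B_def)
  have mu: "(\<integral>z. z ^ p \<partial>std_normal_distribution) = 0"
  proof -
    obtain k where "p = 2 * k + 1" using p(2) by (elim oddE)
    moreover have "(\<integral>z. z ^ p \<partial>std_normal_distribution) = (\<integral>z. std_normal_density z * z ^ p \<partial>lborel)"
      by (subst integral_density) auto
    ultimately show ?thesis using integral_std_normal_moment_odd[of k] by simp
  qed
  have half: "measure std_normal_distribution {z. z ^ p \<le> (\<integral>z. z ^ p \<partial>std_normal_distribution)} = 1 / 2"
  proof -
    have "z ^ p \<le> 0 \<longleftrightarrow> z \<le> 0" for z :: real
      using p by (auto simp: power_le_zero_eq)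
    then show ?thesis unfolding mu by (simp add: std_normal_nonpos)
  qed
  consider "s < - B" | "- B < s" "s < B" | "B < s" using s by linarith
  then show "(\<lambda>N. measure (cw_measure N b 0 p) {x \<in> configs N. cw_mle N 0 p x \<le> ereal s}) \<longlonglongrightarrow>
      measure ?L {t. t \<le> ereal s}"
  proof cases
    case 1
    then show ?thesis
      unfolding L using mle_cdf_below[of p b s] p b B by (simp add: B_def)
  next
    case 2
    then show ?thesis
      unfolding L using mle_cdf_subcritical[of p b s] p b B half by (simp add: B_def)
  next
    case 3
    then show ?thesis
      unfolding L using mle_cdf_supercritical[of p b s] p b B by (simp add: B_def)
  qed
qed

text \<open>For even \<open>p\<close> every \<open>s < beta_tilde p\<close> is subcritical, however
  negative, so the cdf tends to \<open>gamma_p p\<close> at all of them and this mass sits at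
  \<open>- \<infinity>\<close>.\<close>

theorem mle_limit_even:
  assumes p: "p \<ge> 3" "even p" and b: "b < beta_tilde p"
  shows "weak_conv_ereal (\<lambda>N. distr (cw_measure N b 0 p) borel (cw_mle N 0 p))
    (measure_pmf (map_pmf (\<lambda>c. if c then - \<infinity> else ereal (beta_tilde p)) (bernoulli_pmf (gamma_p p))))"
proof (rule mle_weak_conv_pmf)
  have g: "0 \<le> gamma_p p" "gamma_p p < 1"
    using std_normal_power_le_less_1[of p] p by (auto simp: gamma_p_def)
  fix s
  let ?L = "measure_pmf (map_pmf (\<lambda>c. if c then - \<infinity> else ereal (beta_tilde p)) (bernoulli_pmf (gamma_p p)))"
  assume "measure ?L {t. t = ereal s} = 0"
  then have s: "s \<noteq> beta_tilde p"
    by (subst (asm) two_point_cdf) (use g in auto)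
  have L: "measure ?L {t. t \<le> ereal s} = gamma_p p + (if beta_tilde p \<le> s then 1 - gamma_p p else 0)"
    by (subst two_point_cdf) (use g in auto)
  show "(\<lambda>N. measure (cw_measure N b 0 p) {x \<in> configs N. cw_mle N 0 p x \<le> ereal s}) \<longlonglongrightarrow>
      measure ?L {t. t \<le> ereal s}"
  proof (cases "s < beta_tilde p")
    case True
    then show ?thesis
      unfolding L using mle_cdf_subcritical[of p b s] p b by (simp add: gamma_p_def)
  next
    case False
    then show ?thesis
      unfolding L using mle_cdf_supercritical[of p b s] p b s by simp
  qed
qed

theorem mainTheorem6:
  fixes p :: nat and b h m :: real
  assumes p3: "p \<ge> 3"
    and b0: "b \<ge> 0"
    and reg: "p_regular b h p"
    and m_in: "m \<in> {-1<..<1}"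
    and m_max: "\<forall>x\<in>{-1..1}. x \<noteq> m \<longrightarrow> H_fun b h p x < H_fun b h p m"
  shows
    "(m \<noteq> 0 \<longrightarrow>
       weak_conv_ereal
         (\<lambda>N. distr (cw_measure N b h p) borel
                 (\<lambda>x. ereal (sqrt (real N)) * (cw_mle N h p x - ereal b)))
         (distr (density lborel
                   (normal_density 0
                      (sqrt (- deriv (deriv (H_fun b h p)) m / (real p ^ 2 * m ^ (2 * p - 2))))))
                borel ereal))
     \<and> (m = 0 \<longleftrightarrow> h = 0 \<and> b < beta_tilde p)
     \<and> (m = 0 \<and> odd p \<longrightarrow>
          weak_conv_ereal (\<lambda>N. distr (cw_measure N b h p) borel (cw_mle N h p))
            (measure_pmf (map_pmf (\<lambda>c. if c then ereal (beta_tilde p) else ereal (- beta_tilde p))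
                                  (bernoulli_pmf (1/2)))))
     \<and> (m = 0 \<and> even p \<longrightarrow>
          weak_conv_ereal (\<lambda>N. distr (cw_measure N b h p) borel (cw_mle N h p))
            (measure_pmf (map_pmf (\<lambda>c. if c then - \<infinity> else ereal (beta_tilde p))
                                  (bernoulli_pmf (gamma_p p)))))"
proof -
  have m1: "\<bar>m\<bar> < 1" using m_in by auto
  have max: "H_fun b h p x < H_fun b h p m" if "\<bar>x\<bar> \<le> 1" "x \<noteq> m" for x
    using m_max that by (auto simp: abs_le_iff)
  obtain m' where m': "m' \<in> {-1<..<1}" "\<And>x. x \<in> {-1..1} \<Longrightarrow> x \<noteq> m' \<Longrightarrow> H_fun b h p x < H_fun b h p m'"
    "deriv (deriv (H_fun b h p)) m' < 0"
    using reg unfolding p_regular_def by blast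
  \<comment> \<open>Two strict global maximizers coincide, so the curvature condition of
    \<open>p_regular\<close> holds at \<open>m\<close>.\<close>
  have "m' = m"
  proof (rule ccontr)
    assume "m' \<noteq> m"
    then have "H_fun b h p m' < H_fun b h p m" "H_fun b h p m < H_fun b h p m'"
      using m'(1) m1 by (intro max m'(2); auto)+
    then show False by simp
  qed
  then have neg: "ddH b p m < 0" using m'(3) deriv_deriv_H_fun[OF m1] by simp
  interpret cw_max p b h m
    using p3 m1 max neg by unfold_locales auto
  have iff: "m = 0 \<longleftrightarrow> h = 0 \<and> b < beta_tilde p"
    by (rule maximizer_0_iff[OF p3 b0 m1 max])
  \<comment> \<open>The variance in the statement is the square of
    \<open>1 / (slope * \<sigma>)\<close>; taking the root produces the absolute value.\<close>
  have sd: "sqrt (- deriv (deriv (H_fun b h p)) m / (real p ^ 2 * m ^ (2 * p - 2))) = \<bar>1 / (slope * \<sigma>)\<bar>"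
  proof -
    have "m ^ (2 * p - 2) = (m ^ (p - 1))\<^sup>2"
    proof -
      have "2 * p - 2 = (p - 1) * 2" by simp
      then show ?thesis by (simp only: power_mult)
    qed
    moreover have "\<sigma>\<^sup>2 = - 1 / ddH b p m" using neg by (simp add: \<sigma>_def)
    ultimately have "- ddH b p m / (real p ^ 2 * m ^ (2 * p - 2)) = (1 / (slope * \<sigma>))\<^sup>2"
      by (simp add: slope_def power_divide power_mult_distrib)
    then show ?thesis
      unfolding deriv_deriv_H_fun[OF m1] by simp
  qed
  show ?thesis
    unfolding sd
    using mle_gaussian_limit iff mle_limit_odd[of p b] mle_limit_even[of p b] p3 b0 by blast
qed

end
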